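(* Let $K$ be a field, $Q$ a finite quiver, $\mathcal B$ the set of finite directed paths of $Q$, $\succ$ an admissible order on $\mathcal B$, and $J$ the ideal of $KQ$ generated by the arrows. Let $m\ge2$ and let $\mathcal T\subset\mathcal B$ be a tip-reduced set of paths of length at least $2$ with $J^m\subseteq\langle\mathcal T\rangle$. Then $\mathcal V^{ad}_{\mathcal T}(m)$ is a subvariety of $\mathcal V_{\mathcal T}$, and thus an affine algebraic variety. The points of $\mathcal V^{ad}_{\mathcal T}(m)$ are in one-to-one correspondence (via $\mathbf c\mapsto KQ/\langle\mathcal G_{\mathbf c}\rangle$) with the finite dimensional algebras of the form $KQ/I$ such that (1) $I$ is an admissible ideal with $J^m\subseteq I\subseteq J^2$, and (2) the reduced Gröbner basis of $I$ has tip set $\mathcal T$.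
   Context: Vertices of $Q$ are regarded as paths of length $0$ in $\mathcal B$; paths are read left to right; $\ell$ denotes length. For $p,q\in\mathcal B$, $p$ is a subpath of $q$ if $q=rps$ for some $r,s\in\mathcal B$. An admissible order $\succ$ on $\mathcal B$ is a well-order such that: if $p\succ q$ then $pr\succ qr$ whenever $pr,qr$ are nonzero, and $sp\succ sq$ whenever $sp,sq$ are nonzero; and if $p=rqs\neq0$ then $p\succeq q$. For $0\ne x=\sum_p\alpha_pp$ in a path algebra, $\mathrm{tip}(x)$ is the $\succ$-largest $p$ with $\alpha_p\neq0$; $\mathrm{tip}(X)=\{\mathrm{tip}(x)\mid 0\neq x\in X\}$. A set $X$ is tip-reduced if for distinct nonzero $x,y\in X$, $\mathrm{tip}(x)$ is not a subpath of $\mathrm{tip}(y)$. Paths are parallel, $p\|q$, if they have the same origin and the same terminus vertices. All ideals are two-sided; an ideal $I$ is admissible if $J^k\subseteq I\subseteq J^2$ for some $k\ge2$. For an ideal $I$ put $I_{Mon}=\langle\mathrm{tip}(I)\rangle$. There is a unique minimal set $\mathcal T_I$ of paths generating $I_{Mon}$, and for each $t\in\mathcal T_I$ there is a unique $g_t\in I$ with $t-g_t\in\mathrm{Span}_K(\mathcal B\setminus\mathrm{tip}(I))$; the set $\{g_t\mid t\in\mathcal T_I\}$ is the reduced Gröbner basis of $I$. Let $\mathcal N$ be the set of paths having no element of $\mathcal T$ as a subpath, and for $t\in\mathcal T$ let $\mathcal N(t)=\{n\in\mathcal N\mid n\|t,\ t\succ n\}$, $D=\sum_{t\in\mathcal T}|\mathcal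 N(t)|$ (finite here). For $\mathbf c=(c_{t,n})\in K^D$ let $\mathcal G_{\mathbf c}=\{t-\sum_{n\in\mathcal N(t)}c_{t,n}n\mid t\in\mathcal T\}$, and $\mathcal V_{\mathcal T}=\{\mathbf c\in K^D\mid \mathcal G_{\mathbf c}\text{ is the reduced Gröbner basis of }\langle\mathcal G_{\mathbf c}\rangle\}$. Reduction: for a set $\mathcal F$ of nonzero elements and $x=\sum_p\alpha_pp$, if $\alpha_p\ne0$ and $p=r\,\mathrm{tip}(f)\,s$ with $f\in\mathcal F$, $r,s\in\mathcal B$, and $\beta$ is the coefficient of $\mathrm{tip}(f)$ in $f$, then a simple reduction of $x$ by $\mathcal F$ is $\beta x-\alpha_prfs$; a complete reduction is a finite sequence of simple reductions ending in $0$ or in an element with no simple reductions by $\mathcal F$. For $x,y$ with tips $t,t'$ having coefficients $\alpha_t,\beta_{t'}$ and paths $p,q$ with $tp=qt'$, $\ell(q)\ge1$, $1\le\ell(p)<\ell(t')$, the overlap relation is $\beta_{t'}xp-\alpha_tqy$. Construction of $\mathcal V^{ad}_{\mathcal T}(m)$: take variables $x_{t,n}$ for $t\in\mathcal T$ and $n\in\mathcal N(t)$ with $\ell(n)\ge2$, let $R$ be the polynomial ring over $K$ in these variables, and in the path algebra over the fraction field of $R$ let $\mathcal H=\{t-\sum_{n\in\mathcal N(t),\,\ell(n)\ge2}x_{t,n}n\mid t\in\mathcal T\}$. Completely reduce by $\mathcal H$ each overlap relation of elements of $\mathcal H$, and let $f_1,\dots,f_r\in R$ be the coefficients of the paths in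 $\mathcal N$ so obtained; completely reduce by $\mathcal H$ each path of length $m$, and let $f_1^*,\dots,f_s^*\in R$ be the coefficients of the paths in $\mathcal N$ so obtained. Then $\mathcal V^{ad}_{\mathcal T}(m)$ is the common zero set of all $f_i$ and $f_j^*$, regarded as a subset of $K^D$ by setting $c_{t,n}=0$ whenever $\ell(n)\le1$. An affine algebraic variety is the zero set in some $K^d$ of a set of polynomials; a subvariety of $\mathcal V_{\mathcal T}$ is a subset of $\mathcal V_{\mathcal T}$ that is itself such a zero set in $K^D$. *)

theory Defs
  imports
    "HOL-Algebra.QuotRing"
    "HOL-Algebra.Ideal_Product"
    "HOL-Algebra.Module"
    "HOL-Library.Poly_Mapping"
    "HOL-Library.FuncSet"
    "HOL-Computational_Algebra.Polynomial_Factorial"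
    "Graph_Theory.Arc_Walk"
begin

section \<open>Polynomials in variables indexed by an arbitrary type\<close>

text \<open>
  The distribution makes \<open>('x \<Rightarrow>\<^sub>0 nat) \<Rightarrow>\<^sub>0 'k\<close> an integral domain only for linearly ordered \<open>'x\<close>,
  and this type-class instance cannot be generalised.  A copy of the type carries the instance
  for every \<open>'x\<close>, as needed to form the fraction field.
\<close>

typedef (overloaded) ('x, 'k) mpoly = "UNIV :: (('x \<Rightarrow>\<^sub>0 nat) \<Rightarrow>\<^sub>0 'k::zero) set"
  by (rule exI, rule UNIV_I)

setup_lifting type_definition_mpoly

instantiation mpoly :: (type, comm_ring_1) comm_ring_1
begin
lift_definition zero_mpoly :: "('a, 'b) mpoly" is 0 .
lift_definition one_mpoly :: "('a, 'b) mpoly" is 1 .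
lift_definition plus_mpoly :: "('a, 'b) mpoly \<Rightarrow> ('a, 'b) mpoly \<Rightarrow> ('a, 'b) mpoly" is "(+)" .
lift_definition minus_mpoly :: "('a, 'b) mpoly \<Rightarrow> ('a, 'b) mpoly \<Rightarrow> ('a, 'b) mpoly" is "(-)" .
lift_definition times_mpoly :: "('a, 'b) mpoly \<Rightarrow> ('a, 'b) mpoly \<Rightarrow> ('a, 'b) mpoly" is "(*)" .
lift_definition uminus_mpoly :: "('a, 'b) mpoly \<Rightarrow> ('a, 'b) mpoly" is "uminus" .
instance
proof
  fix a b c :: "('a, 'b) mpoly"
  show "a * b * c = a * (b * c)" by transfer (rule mult.assoc)
  show "a * b = b * a" by transfer (rule mult.commute)
  show "1 * a = a" by transfer (rule mult_1)
  show "a + b + c = a + (b + c)" by transfer (rule add.assoc)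
  show "a + b = b + a" by transfer (rule add.commute)
  show "0 + a = a" by transfer (rule add_0)
  show "- a + a = 0" by transfer (rule left_minus)
  show "a - b = a + - b" by transfer (rule diff_conv_add_uminus)
  show "(a + b) * c = a * c + b * c" by transfer (rule distrib_right)
  show "(0 :: ('a, 'b) mpoly) \<noteq> 1" by transfer (rule zero_neq_one)
qed
end

lemma unique_product_monomials:
  fixes A B :: "('x \<Rightarrow>\<^sub>0 nat) set"
  assumes "finite V" "finite A" "A \<noteq> {}" "finite B" "B \<noteq> {}"
    and "\<And>a a' v. a \<in> A \<Longrightarrow> a' \<in> A \<Longrightarrow> v \<notin> V \<Longrightarrow> Poly_Mapping.lookup a v = Poly_Mapping.lookup a' v"
    and "\<And>b b' v. b \<in> B \<Longrightarrow> b' \<in> B \<Longrightarrow> v \<notin> V \<Longrightarrow> Poly_Mapping.lookup b v = Poly_Mapping.lookup b' v"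
  shows "\<exists>a\<in>A. \<exists>b\<in>B. \<forall>a'\<in>A. \<forall>b'\<in>B. a' + b' = a + b \<longrightarrow> a' = a \<and> b' = b"
  using assms
proof (induction V arbitrary: A B rule: finite_induct)
  case empty
  have "a' = a" if "a \<in> A" "a' \<in> A" for a a'
    using empty.prems(5)[OF that(2,1)] by (intro poly_mapping_eqI) simp
  moreover have "b' = b" if "b \<in> B" "b' \<in> B" for b b'
    using empty.prems(6)[OF that(2,1)] by (intro poly_mapping_eqI) simp
  ultimately show ?case using empty.prems(2,4) by blast
next
  case (insert v V)
  define ma where "ma = Max ((\<lambda>a. Poly_Mapping.lookup a v) ` A)"
  define mb where "mb = Max ((\<lambda>b. Poly_Mapping.lookup b v) ` B)"
  have ma: "Poly_Mapping.lookup a v \<le> ma" if "a \<in> A" for a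
    using that insert.prems(1) by (simp add: ma_def)
  have mb: "Poly_Mapping.lookup b v \<le> mb" if "b \<in> B" for b
    using that insert.prems(3) by (simp add: mb_def)
  define A' where "A' = {a\<in>A. Poly_Mapping.lookup a v = ma}"
  define B' where "B' = {b\<in>B. Poly_Mapping.lookup b v = mb}"
  have "ma \<in> (\<lambda>a. Poly_Mapping.lookup a v) ` A" "mb \<in> (\<lambda>b. Poly_Mapping.lookup b v) ` B"
    using insert.prems(1-4) by (auto simp: ma_def mb_def intro!: Max_in)
  then have ne: "A' \<noteq> {}" "B' \<noteq> {}"
    by (auto simp: A'_def B'_def)
  have "\<exists>a\<in>A'. \<exists>b\<in>B'. \<forall>a'\<in>A'. \<forall>b'\<in>B'. a' + b' = a + b \<longrightarrow> a' = a \<and> b' = b"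
  proof (rule insert.IH)
    show "Poly_Mapping.lookup a w = Poly_Mapping.lookup a' w" if "a \<in> A'" "a' \<in> A'" "w \<notin> V" for a a' w
      using that insert.prems(5)[of a a' w] by (cases "w = v") (auto simp: A'_def)
    show "Poly_Mapping.lookup b w = Poly_Mapping.lookup b' w" if "b \<in> B'" "b' \<in> B'" "w \<notin> V" for b b' w
      using that insert.prems(6)[of b b' w] by (cases "w = v") (auto simp: B'_def)
  qed (use ne insert.prems(1,3) in \<open>auto simp: A'_def B'_def\<close>)
  then obtain a b where ab: "a \<in> A'" "b \<in> B'"
    and uniq: "\<And>a' b'. a' \<in> A' \<Longrightarrow> b' \<in> B' \<Longrightarrow> a' + b' = a + b \<Longrightarrow> a' = a \<and> b' = b"
    by blast
  have "a' = a \<and> b' = b" if "a' \<in> A" "b' \<in> B" "a' + b' = a + b" for a' b'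
  proof -
    have "Poly_Mapping.lookup a' v + Poly_Mapping.lookup b' v = ma + mb"
      using arg_cong[OF that(3), of "\<lambda>x. Poly_Mapping.lookup x v"] ab by (simp add: lookup_add A'_def B'_def)
    with ma[OF that(1)] mb[OF that(2)] have "Poly_Mapping.lookup a' v = ma" "Poly_Mapping.lookup b' v = mb" by auto
    with that show ?thesis by (intro uniq) (auto simp: A'_def B'_def)
  qed
  with ab show ?case by (auto simp: A'_def B'_def)
qed

instance mpoly :: (type, idom) idom
proof
  fix f g :: "('a, 'b) mpoly"
  assume "f \<noteq> 0" "g \<noteq> 0"
  then show "f * g \<noteq> 0"
  proof (transfer)
    fix f g :: "('a \<Rightarrow>\<^sub>0 nat) \<Rightarrow>\<^sub>0 'b"
    assume nz: "f \<noteq> 0" "g \<noteq> 0"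
    let ?V = "\<Union>(Poly_Mapping.keys ` (Poly_Mapping.keys f \<union> Poly_Mapping.keys g))"
    have "\<exists>a\<in>Poly_Mapping.keys f. \<exists>b\<in>Poly_Mapping.keys g.
        \<forall>a'\<in>Poly_Mapping.keys f. \<forall>b'\<in>Poly_Mapping.keys g. a' + b' = a + b \<longrightarrow> a' = a \<and> b' = b"
      by (rule unique_product_monomials[of ?V]) (use nz in \<open>auto simp: in_keys_iff\<close>)
    then obtain a b where ab: "a \<in> Poly_Mapping.keys f" "b \<in> Poly_Mapping.keys g"
      and uniq: "\<And>a' b'. a' \<in> Poly_Mapping.keys f \<Longrightarrow> b' \<in> Poly_Mapping.keys g \<Longrightarrow>
        a' + b' = a + b \<Longrightarrow> a' = a \<and> b' = b"
      by blast
    have zero: "Poly_Mapping.lookup g q = 0"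
      if "l \<in> Poly_Mapping.keys f" "l \<noteq> a" "a + b = l + q" for l q
      using uniq[of l q] that by (metis in_keys_iff)
    have inner: "Sum_any (\<lambda>q. Poly_Mapping.lookup g q when a + b = l + q) =
        (Poly_Mapping.lookup g b when l = a)"
      if "l \<in> Poly_Mapping.keys f" for l
    proof (cases "l = a")
      case True
      then show ?thesis by simp
    next
      case False
      then have "(\<lambda>q. Poly_Mapping.lookup g q when a + b = l + q) = (\<lambda>q. 0)"
        using zero[OF that] by (auto simp: fun_eq_iff when_def)
      with False show ?thesis by (simp only:) simp
    qed
    have "Poly_Mapping.lookup (f * g) (a + b) = Sum_any (\<lambda>l. Poly_Mapping.lookup f l *
        Sum_any (\<lambda>q. Poly_Mapping.lookup g q when a + b = l + q))"
      by (simp add: lookup_mult prod_fun_def)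
    also have "\<dots> = Sum_any (\<lambda>l. Poly_Mapping.lookup f l * Poly_Mapping.lookup g b when l = a)"
    proof (rule arg_cong[of _ _ Sum_any], rule ext)
      fix l
      show "Poly_Mapping.lookup f l * Sum_any (\<lambda>q. Poly_Mapping.lookup g q when a + b = l + q) =
          (Poly_Mapping.lookup f l * Poly_Mapping.lookup g b when l = a)"
      proof (cases "l \<in> Poly_Mapping.keys f")
        case True
        then show ?thesis by (simp only: inner) (simp add: when_def)
      next
        case False
        then show ?thesis by (simp add: in_keys_iff)
      qed
    qed
    also have "\<dots> = Poly_Mapping.lookup f a * Poly_Mapping.lookup g b"
      by simp
    finally have prod: "Poly_Mapping.lookup (f * g) (a + b) =
      Poly_Mapping.lookup f a * Poly_Mapping.lookup g b" .
    have "Poly_Mapping.lookup f a \<noteq> 0" "Poly_Mapping.lookup g b \<noteq> 0"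
      using ab by (simp_all only: in_keys_iff not_False_eq_True)
    with prod have "Poly_Mapping.lookup (f * g) (a + b) \<noteq> 0"
      by (simp only: mult_eq_0_iff) blast
    then show "f * g \<noteq> 0"
      by (rule contrapos_nn) (simp only: lookup_zero)
  qed
qed

definition mpoly_var :: "'x \<Rightarrow> ('x, 'k::zero_neq_one) mpoly" where
  "mpoly_var v = Abs_mpoly (Poly_Mapping.single (Poly_Mapping.single v 1) 1)"

definition mpoly_eval :: "('x \<Rightarrow> 'k) \<Rightarrow> ('x, 'k::comm_semiring_1) mpoly \<Rightarrow> 'k" where
  "mpoly_eval c f = (\<Sum>m\<in>Poly_Mapping.keys (Rep_mpoly f). Poly_Mapping.lookup (Rep_mpoly f) m *
     (\<Prod>v\<in>Poly_Mapping.keys m. c v ^ Poly_Mapping.lookup m v))"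

text \<open>The polynomial ring in the variables \<open>X\<close>, inside the polynomials in all variables.\<close>

definition polys_in :: "'x set \<Rightarrow> ('x, 'k::zero) mpoly set" where
  "polys_in X = {f. \<forall>m\<in>Poly_Mapping.keys (Rep_mpoly f). Poly_Mapping.keys m \<subseteq> X}"


section \<open>Affine varieties\<close>

text \<open>Affine space with coordinates indexed by \<open>X\<close>; functions are \<open>undefined\<close> off \<open>X\<close>.\<close>

definition affine_space :: "'x set \<Rightarrow> ('x \<Rightarrow> 'k) set" where
  "affine_space X = X \<rightarrow>\<^sub>E UNIV"

definition zero_set :: "'x set \<Rightarrow> ('x, 'k::field) mpoly set \<Rightarrow> ('x \<Rightarrow> 'k) set" where
  "zero_set X F = {c \<in> affine_space X. \<forall>f\<in>F. mpoly_eval c f = 0}"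

definition affine_variety :: "'x set \<Rightarrow> ('x \<Rightarrow> 'k::field) set \<Rightarrow> bool" where
  "affine_variety X V \<longleftrightarrow> finite X \<and> (\<exists>F \<subseteq> polys_in X. V = zero_set X F)"

definition subvariety :: "'x set \<Rightarrow> ('x \<Rightarrow> 'k::field) set \<Rightarrow> ('x \<Rightarrow> 'k) set \<Rightarrow> bool" where
  "subvariety X V W \<longleftrightarrow> V \<subseteq> W \<and> affine_variety X V"


section \<open>Paths and path algebras\<close>

text \<open>
  A path is a pair of its origin and its list of arrows, in reading order; the trivial path at
  \<open>v\<close> is \<open>(v, [])\<close>.
\<close>

type_synonym ('v, 'e) path = "'v \<times> 'e list"

type_synonym ('v, 'e, 'k) path_elem = "('v, 'e) path \<Rightarrow>\<^sub>0 'k"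

definition paths :: "('v, 'e) pre_digraph \<Rightarrow> ('v, 'e) path set" where
  "paths G = {(u, es). \<exists>v. pre_digraph.awalk G u es v}"

definition path_length :: "('v, 'e) path \<Rightarrow> nat" where
  "path_length p = length (snd p)"

definition origin :: "('v, 'e) path \<Rightarrow> 'v" where
  "origin p = fst p"

definition terminus :: "('v, 'e) pre_digraph \<Rightarrow> ('v, 'e) path \<Rightarrow> 'v" where
  "terminus G p = last (pre_digraph.awalk_verts G (fst p) (snd p))"

definition parallel :: "('v, 'e) pre_digraph \<Rightarrow> ('v, 'e) path \<Rightarrow> ('v, 'e) path \<Rightarrow> bool" where
  "parallel G p q \<longleftrightarrow> origin p = origin q \<and> terminus G p = terminus G q"

definition composable :: "('v, 'e) pre_digraph \<Rightarrow> ('v, 'e) path \<Rightarrow> ('v, 'e) path \<Rightarrow> bool" where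
  "composable G p q \<longleftrightarrow> terminus G p = origin q"

text \<open>Concatenation; it represents the product of paths only if they are composable.\<close>

definition path_append :: "('v, 'e) path \<Rightarrow> ('v, 'e) path \<Rightarrow> ('v, 'e) path" where
  "path_append p q = (fst p, snd p @ snd q)"

text \<open>\<open>q = r p s\<close>, a nonzero product of paths.\<close>

definition path_factor ::
  "('v, 'e) pre_digraph \<Rightarrow> ('v, 'e) path \<Rightarrow> ('v, 'e) path \<Rightarrow> ('v, 'e) path \<Rightarrow> ('v, 'e) path \<Rightarrow> bool" where
  "path_factor G q r p s \<longleftrightarrow> r \<in> paths G \<and> p \<in> paths G \<and> s \<in> paths G \<and>
     composable G r p \<and> composable G p s \<and> q = path_append (path_append r p) s"

definition subpath :: "('v, 'e) pre_digraph \<Rightarrow> ('v, 'e) path \<Rightarrow> ('v, 'e) path \<Rightarrow> bool" where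
  "subpath G p q \<longleftrightarrow> (\<exists>r s. path_factor G q r p s)"

definition path_mult ::
  "('v, 'e) pre_digraph \<Rightarrow> ('v, 'e, 'k::comm_ring_1) path_elem \<Rightarrow> ('v, 'e, 'k) path_elem \<Rightarrow>
    ('v, 'e, 'k) path_elem" where
  "path_mult G x y = (\<Sum>p\<in>Poly_Mapping.keys x. \<Sum>q\<in>Poly_Mapping.keys y.
     if composable G p q then Poly_Mapping.single (path_append p q) (Poly_Mapping.lookup x p * Poly_Mapping.lookup y q) else 0)"

definition path_smult :: "'k::comm_ring_1 \<Rightarrow> ('v, 'e, 'k) path_elem \<Rightarrow> ('v, 'e, 'k) path_elem" where
  "path_smult a x = Poly_Mapping.map ((*) a) x"

definition of_path :: "('v, 'e) path \<Rightarrow> ('v, 'e, 'k::comm_ring_1) path_elem" where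
  "of_path p = Poly_Mapping.single p 1"

definition path_algebra ::
  "('v, 'e) pre_digraph \<Rightarrow> ('k::comm_ring_1, ('v, 'e, 'k) path_elem) module" where
  "path_algebra G = \<lparr>carrier = {x. Poly_Mapping.keys x \<subseteq> paths G}, monoid.mult = path_mult G,
     one = (\<Sum>v\<in>verts G. of_path (v, [])), zero = 0, add = (+), module.smult = path_smult\<rparr>"

definition arrow_ideal :: "('v, 'e) pre_digraph \<Rightarrow> ('v, 'e, 'k::comm_ring_1) path_elem set" where
  "arrow_ideal G = genideal (path_algebra G) {of_path (tail G e, [e]) |e. e \<in> arcs G}"

primrec ideal_power :: "('a, 'b) ring_scheme \<Rightarrow> 'a set \<Rightarrow> nat \<Rightarrow> 'a set" where
  "ideal_power R I 0 = carrier R"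
| "ideal_power R I (Suc k) = ideal_prod R (ideal_power R I k) I"

definition admissible_ideal ::
  "('v, 'e) pre_digraph \<Rightarrow> ('v, 'e, 'k::comm_ring_1) path_elem set \<Rightarrow> bool" where
  "admissible_ideal G I \<longleftrightarrow> ideal I (path_algebra G) \<and>
     (\<exists>k\<ge>2. ideal_power (path_algebra G) (arrow_ideal G) k \<subseteq> I \<and>
            I \<subseteq> ideal_power (path_algebra G) (arrow_ideal G) 2)"

text \<open>The quotient ring together with the scalar multiplication it inherits.\<close>

definition quotient_algebra ::
  "('k, 'a, 'b) module_scheme \<Rightarrow> 'a set \<Rightarrow> ('k, 'a set) module" where
  "quotient_algebra A I =
     ring.extend (A Quot I) (module.fields (\<lambda>k X. \<Union>x\<in>X. I +>\<^bsub>A\<^esub> (k \<odot>\<^bsub>A\<^esub> x)))"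

definition finite_dim :: "('k, 'a, 'b) module_scheme \<Rightarrow> bool" where
  "finite_dim A \<longleftrightarrow> (\<exists>S. finite S \<and> S \<subseteq> carrier A \<and>
     (\<forall>x\<in>carrier A. \<exists>f. x = (\<Oplus>\<^bsub>A\<^esub>s\<in>S. f s \<odot>\<^bsub>A\<^esub> s)))"


section \<open>Admissible orders, tips and reduced Groebner bases\<close>

text \<open>As usual for \<^const>\<open>well_order_on\<close>, \<open>(p, q) \<in> ord\<close> means \<open>p \<preceq> q\<close>.\<close>

definition path_gt :: "('v, 'e) path rel \<Rightarrow> ('v, 'e) path \<Rightarrow> ('v, 'e) path \<Rightarrow> bool" where
  "path_gt ord p q \<longleftrightarrow> (q, p) \<in> ord \<and> p \<noteq> q"

definition admissible_order :: "('v, 'e) pre_digraph \<Rightarrow> ('v, 'e) path rel \<Rightarrow> bool" where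
  "admissible_order G ord \<longleftrightarrow> well_order_on (paths G) ord \<and>
     (\<forall>p\<in>paths G. \<forall>q\<in>paths G. \<forall>r\<in>paths G. path_gt ord p q \<longrightarrow> composable G p r \<longrightarrow> composable G q r \<longrightarrow>
        path_gt ord (path_append p r) (path_append q r)) \<and>
     (\<forall>p\<in>paths G. \<forall>q\<in>paths G. \<forall>s\<in>paths G. path_gt ord p q \<longrightarrow> composable G s p \<longrightarrow> composable G s q \<longrightarrow>
        path_gt ord (path_append s p) (path_append s q)) \<and>
     (\<forall>p q r s. path_factor G p r q s \<longrightarrow> (q, p) \<in> ord)"

definition tip :: "('v, 'e) path rel \<Rightarrow> ('v, 'e, 'k::comm_ring_1) path_elem \<Rightarrow> ('v, 'e) path" where
  "tip ord x = (THE p. p \<in> Poly_Mapping.keys x \<and> (\<forall>q\<in>Poly_Mapping.keys x. (q, p) \<in> ord))"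

definition tips :: "('v, 'e) path rel \<Rightarrow> ('v, 'e, 'k::comm_ring_1) path_elem set \<Rightarrow> ('v, 'e) path set" where
  "tips ord X = {tip ord x |x. x \<in> X \<and> x \<noteq> 0}"

definition tip_reduced ::
  "('v, 'e) pre_digraph \<Rightarrow> ('v, 'e) path rel \<Rightarrow> ('v, 'e, 'k::comm_ring_1) path_elem set \<Rightarrow> bool" where
  "tip_reduced G ord X \<longleftrightarrow> (\<forall>x\<in>X. \<forall>y\<in>X. x \<noteq> 0 \<longrightarrow> y \<noteq> 0 \<longrightarrow> x \<noteq> y \<longrightarrow>
     \<not> subpath G (tip ord x) (tip ord y))"

definition path_ideal :: "('v, 'e) pre_digraph \<Rightarrow> ('v, 'e) path set \<Rightarrow> ('v, 'e, 'k::comm_ring_1) path_elem set" where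
  "path_ideal G S = genideal (path_algebra G) (of_path ` S)"

definition min_tips ::
  "('v, 'e) pre_digraph \<Rightarrow> ('v, 'e) path rel \<Rightarrow> ('v, 'e, 'k::field) path_elem set \<Rightarrow> ('v, 'e) path set" where
  "min_tips G ord I = (let I_Mon = (path_ideal G (tips ord I) :: ('v, 'e, 'k) path_elem set) in
     THE S. S \<subseteq> paths G \<and> path_ideal G S = I_Mon \<and> (\<forall>S'. S' \<subset> S \<longrightarrow> path_ideal G S' \<noteq> I_Mon))"

definition gb_element ::
  "('v, 'e) pre_digraph \<Rightarrow> ('v, 'e) path rel \<Rightarrow> ('v, 'e, 'k::field) path_elem set \<Rightarrow> ('v, 'e) path \<Rightarrow>
    ('v, 'e, 'k) path_elem" where
  "gb_element G ord I t =
     (THE g. g \<in> I \<and> Poly_Mapping.keys (of_path t - g) \<subseteq> paths G - tips ord I)"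

definition reduced_groebner_basis ::
  "('v, 'e) pre_digraph \<Rightarrow> ('v, 'e) path rel \<Rightarrow> ('v, 'e, 'k::field) path_elem set \<Rightarrow>
    ('v, 'e, 'k) path_elem set" where
  "reduced_groebner_basis G ord I = gb_element G ord I ` min_tips G ord I"


section \<open>Reductions and overlaps\<close>

definition simple_reduction ::
  "('v, 'e) pre_digraph \<Rightarrow> ('v, 'e) path rel \<Rightarrow> ('v, 'e, 'k::comm_ring_1) path_elem set \<Rightarrow>
    ('v, 'e, 'k) path_elem \<Rightarrow> ('v, 'e, 'k) path_elem \<Rightarrow> bool" where
  "simple_reduction G ord F x y \<longleftrightarrow> (\<exists>f\<in>F. \<exists>p r s. Poly_Mapping.lookup x p \<noteq> 0 \<and> path_factor G p r (tip ord f) s \<and>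
     y = path_smult (Poly_Mapping.lookup f (tip ord f)) x
         - path_smult (Poly_Mapping.lookup x p) (path_mult G (path_mult G (of_path r) f) (of_path s)))"

definition complete_reduction ::
  "('v, 'e) pre_digraph \<Rightarrow> ('v, 'e) path rel \<Rightarrow> ('v, 'e, 'k::comm_ring_1) path_elem set \<Rightarrow>
    ('v, 'e, 'k) path_elem \<Rightarrow> ('v, 'e, 'k) path_elem \<Rightarrow> bool" where
  "complete_reduction G ord F x y \<longleftrightarrow> (simple_reduction G ord F)\<^sup>*\<^sup>* x y \<and>
     (y = 0 \<or> (\<nexists>z. simple_reduction G ord F y z))"

definition overlap_relations ::
  "('v, 'e) pre_digraph \<Rightarrow> ('v, 'e) path rel \<Rightarrow> ('v, 'e, 'k::comm_ring_1) path_elem set \<Rightarrow>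
    ('v, 'e, 'k) path_elem set" where
  "overlap_relations G ord F =
     {path_smult (Poly_Mapping.lookup y (tip ord y)) (path_mult G x (of_path p))
      - path_smult (Poly_Mapping.lookup x (tip ord x)) (path_mult G (of_path q) y) |x y p q.
        x \<in> F \<and> y \<in> F \<and> x \<noteq> 0 \<and> y \<noteq> 0 \<and> p \<in> paths G \<and> q \<in> paths G \<and>
        composable G (tip ord x) p \<and> composable G q (tip ord y) \<and>
        path_append (tip ord x) p = path_append q (tip ord y) \<and>
        1 \<le> path_length q \<and> 1 \<le> path_length p \<and> path_length p < path_length (tip ord y)}"


section \<open>The varieties\<close>

definition normal_paths :: "('v, 'e) pre_digraph \<Rightarrow> ('v, 'e) path set \<Rightarrow> ('v, 'e) path set" where
  "normal_paths G T = {n \<in> paths G. \<not> (\<exists>t\<in>T. subpath G t n)}"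

definition normal_below ::
  "('v, 'e) pre_digraph \<Rightarrow> ('v, 'e) path rel \<Rightarrow> ('v, 'e) path set \<Rightarrow> ('v, 'e) path \<Rightarrow> ('v, 'e) path set" where
  "normal_below G ord T t = {n \<in> normal_paths G T. parallel G n t \<and> path_gt ord t n}"

text \<open>The index set of the coordinates of \<open>K\<^sup>D\<close>, and the part of it that carries the variables \<open>x\<^sub>t\<^sub>,\<^sub>n\<close>.\<close>

definition coords ::
  "('v, 'e) pre_digraph \<Rightarrow> ('v, 'e) path rel \<Rightarrow> ('v, 'e) path set \<Rightarrow> (('v, 'e) path \<times> ('v, 'e) path) set" where
  "coords G ord T = (SIGMA t:T. normal_below G ord T t)"

definition ad_coords ::
  "('v, 'e) pre_digraph \<Rightarrow> ('v, 'e) path rel \<Rightarrow> ('v, 'e) path set \<Rightarrow> (('v, 'e) path \<times> ('v, 'e) path) set" where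
  "ad_coords G ord T = {(t, n) \<in> coords G ord T. 2 \<le> path_length n}"

definition G_family ::
  "('v, 'e) pre_digraph \<Rightarrow> ('v, 'e) path rel \<Rightarrow> ('v, 'e) path set \<Rightarrow>
    (('v, 'e) path \<times> ('v, 'e) path \<Rightarrow> 'k::field) \<Rightarrow> ('v, 'e, 'k) path_elem set" where
  "G_family G ord T c =
     {of_path t - (\<Sum>n\<in>normal_below G ord T t. path_smult (c (t, n)) (of_path n)) |t. t \<in> T}"

definition G_ideal ::
  "('v, 'e) pre_digraph \<Rightarrow> ('v, 'e) path rel \<Rightarrow> ('v, 'e) path set \<Rightarrow>
    (('v, 'e) path \<times> ('v, 'e) path \<Rightarrow> 'k::field) \<Rightarrow> ('v, 'e, 'k) path_elem set" where
  "G_ideal G ord T c = genideal (path_algebra G) (G_family G ord T c)"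

definition V_variety ::
  "('v, 'e) pre_digraph \<Rightarrow> ('v, 'e) path rel \<Rightarrow> ('v, 'e) path set \<Rightarrow>
    (('v, 'e) path \<times> ('v, 'e) path \<Rightarrow> 'k::field) set" where
  "V_variety G ord T = {c \<in> affine_space (coords G ord T).
     G_family G ord T c = reduced_groebner_basis G ord (G_ideal G ord T c)}"

text \<open>The elements over which reductions are carried out have coefficients in the fraction field of
  the polynomial ring.\<close>

type_synonym ('v, 'e, 'k) coeff_poly = "(('v, 'e) path \<times> ('v, 'e) path, 'k) mpoly"

type_synonym ('v, 'e, 'k) generic_elem = "('v, 'e, ('v, 'e, 'k) coeff_poly fract) path_elem"

definition H_family ::
  "('v, 'e) pre_digraph \<Rightarrow> ('v, 'e) path rel \<Rightarrow> ('v, 'e) path set \<Rightarrow> ('v, 'e, 'k::field) generic_elem set" where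
  "H_family G ord T =
     {of_path t - (\<Sum>n\<in>{n \<in> normal_below G ord T t. 2 \<le> path_length n}.
        path_smult (to_fract (mpoly_var (t, n))) (of_path n)) |t. t \<in> T}"

definition H_inputs ::
  "('v, 'e) pre_digraph \<Rightarrow> ('v, 'e) path rel \<Rightarrow> ('v, 'e) path set \<Rightarrow> nat \<Rightarrow>
    ('v, 'e, 'k::field) generic_elem set" where
  "H_inputs G ord T m = overlap_relations G ord (H_family G ord T) \<union>
     {of_path p |p. p \<in> paths G \<and> path_length p = m}"

text \<open>Complete reductions are not unique, so \<open>red\<close> records which one is used for each input.\<close>

definition reduction_choice ::
  "('v, 'e) pre_digraph \<Rightarrow> ('v, 'e) path rel \<Rightarrow> ('v, 'e) path set \<Rightarrow> nat \<Rightarrow>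
    (('v, 'e, 'k::field) generic_elem \<Rightarrow> ('v, 'e, 'k) generic_elem) \<Rightarrow> bool" where
  "reduction_choice G ord T m red \<longleftrightarrow>
     (\<forall>z\<in>H_inputs G ord T m. complete_reduction G ord (H_family G ord T) z (red z))"

definition ad_polys ::
  "('v, 'e) pre_digraph \<Rightarrow> ('v, 'e) path rel \<Rightarrow> ('v, 'e) path set \<Rightarrow> nat \<Rightarrow>
    (('v, 'e, 'k::field) generic_elem \<Rightarrow> ('v, 'e, 'k) generic_elem) \<Rightarrow> ('v, 'e, 'k) coeff_poly set" where
  "ad_polys G ord T m red = {f \<in> polys_in (ad_coords G ord T).
     \<exists>z\<in>H_inputs G ord T m. \<exists>n\<in>normal_paths G T. Poly_Mapping.lookup (red z) n = to_fract f}"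

definition V_ad ::
  "('v, 'e) pre_digraph \<Rightarrow> ('v, 'e) path rel \<Rightarrow> ('v, 'e) path set \<Rightarrow> nat \<Rightarrow>
    (('v, 'e, 'k::field) generic_elem \<Rightarrow> ('v, 'e, 'k) generic_elem) \<Rightarrow>
    (('v, 'e) path \<times> ('v, 'e) path \<Rightarrow> 'k) set" where
  "V_ad G ord T m red = {c \<in> affine_space (coords G ord T).
     restrict c (ad_coords G ord T) \<in> zero_set (ad_coords G ord T) (ad_polys G ord T m red) \<and>
     (\<forall>i\<in>coords G ord T - ad_coords G ord T. c i = 0)}"


section \<open>Existence of complete reductions\<close>

text \<open>So the hypothesis \<^const>\<open>reduction_choice\<close> can always be met.\<close>


lemma path_append_paths:
  assumes "fin_digraph G" "p \<in> paths G" "q \<in> paths G" "composable G p q"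
  shows "path_append p q \<in> paths G" "terminus G (path_append p q) = terminus G q"
proof -
  interpret fin_digraph G by fact
  obtain v w where v: "awalk (fst p) (snd p) v" and w: "awalk (fst q) (snd q) w"
    using assms(2,3) by (auto simp: paths_def)
  have "v = fst q" using assms(4) v by (auto simp: composable_def terminus_def origin_def)
  with v w have *: "awalk (fst p) (snd p @ snd q) w" by auto
  then show "path_append p q \<in> paths G" by (auto simp: paths_def path_append_def)
  show "terminus G (path_append p q) = terminus G q"
    using awalkE[OF *] awalkE[OF w] by (metis fst_conv path_append_def snd_conv terminus_def)
qed

lemma path_mult_of_path_left:
  "path_mult G (of_path r) f = (\<Sum>q\<in>Poly_Mapping.keys f.
     if composable G r q then Poly_Mapping.single (path_append r q) (Poly_Mapping.lookup f q) else 0)"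
  by (simp add: path_mult_def of_path_def keys_single cong: if_cong)

lemma path_mult_of_path_right:
  "path_mult G f (of_path s) = (\<Sum>q\<in>Poly_Mapping.keys f.
     if composable G q s then Poly_Mapping.single (path_append q s) (Poly_Mapping.lookup f q) else 0)"
  by (simp add: path_mult_def of_path_def keys_single cong: if_cong)

lemma lookup_of_path_left:
  assumes "composable G r q"
  shows "Poly_Mapping.lookup (path_mult G (of_path r) f) (path_append r q) = Poly_Mapping.lookup f q"
proof -
  have "Poly_Mapping.lookup (path_mult G (of_path r) f) (path_append r q) =
    (\<Sum>k\<in>Poly_Mapping.keys f. if k = q then Poly_Mapping.lookup f q else 0)"
    unfolding path_mult_of_path_left lookup_sum
  proof (rule sum.cong[OF refl])
    fix k
    have "k = q" if "composable G r k" "path_append r k = path_append r q"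
      using that assms by (auto simp: path_append_def composable_def origin_def prod_eq_iff)
    then show "Poly_Mapping.lookup (if composable G r k then
        Poly_Mapping.single (path_append r k) (Poly_Mapping.lookup f k) else 0) (path_append r q) =
      (if k = q then Poly_Mapping.lookup f q else 0)"
      using assms by (auto simp: lookup_single when_def)
  qed
  also have "\<dots> = Poly_Mapping.lookup f q" by (simp add: in_keys_iff)
  finally show ?thesis .
qed

lemma lookup_of_path_right:
  assumes "composable G q s"
  shows "Poly_Mapping.lookup (path_mult G f (of_path s)) (path_append q s) = Poly_Mapping.lookup f q"
proof -
  have "Poly_Mapping.lookup (path_mult G f (of_path s)) (path_append q s) =
    (\<Sum>k\<in>Poly_Mapping.keys f. if k = q then Poly_Mapping.lookup f q else 0)"
    unfolding path_mult_of_path_right lookup_sum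
  proof (rule sum.cong[OF refl])
    fix k
    have "k = q" if "path_append k s = path_append q s"
      using that by (auto simp: path_append_def prod_eq_iff)
    then show "Poly_Mapping.lookup (if composable G k s then
        Poly_Mapping.single (path_append k s) (Poly_Mapping.lookup f k) else 0) (path_append q s) =
      (if k = q then Poly_Mapping.lookup f q else 0)"
      using assms by (auto simp: lookup_single when_def)
  qed
  also have "\<dots> = Poly_Mapping.lookup f q" by (simp add: in_keys_iff)
  finally show ?thesis .
qed

lemma keys_of_path_left:
  assumes "k \<in> Poly_Mapping.keys (path_mult G (of_path r) f)"
  shows "\<exists>q\<in>Poly_Mapping.keys f. composable G r q \<and> k = path_append r q"
proof (rule ccontr)
  assume *: "\<not> ?thesis"
  have "Poly_Mapping.lookup (path_mult G (of_path r) f) k = 0"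
    unfolding path_mult_of_path_left lookup_sum
    by (rule sum.neutral) (use * in \<open>auto simp: lookup_single when_def\<close>)
  with assms show False by (simp add: in_keys_iff)
qed

lemma keys_of_path_right:
  assumes "k \<in> Poly_Mapping.keys (path_mult G f (of_path s))"
  shows "\<exists>q\<in>Poly_Mapping.keys f. composable G q s \<and> k = path_append q s"
proof (rule ccontr)
  assume *: "\<not> ?thesis"
  have "Poly_Mapping.lookup (path_mult G f (of_path s)) k = 0"
    unfolding path_mult_of_path_right lookup_sum
    by (rule sum.neutral) (use * in \<open>auto simp: lookup_single when_def\<close>)
  with assms show False by (simp add: in_keys_iff)
qed

lemma tip_props:
  assumes "admissible_order G ord" "x \<noteq> 0" "Poly_Mapping.keys x \<subseteq> paths G"
  shows "tip ord x \<in> Poly_Mapping.keys x" "q \<in> Poly_Mapping.keys x \<Longrightarrow> (q, tip ord x) \<in> ord"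
proof -
  have wo: "linear_order_on (paths G) ord"
    using assms(1) by (simp add: admissible_order_def well_order_on_def)
  have tot: "(p,q) \<in> ord \<or> (q,p) \<in> ord" if "p \<in> paths G" "q \<in> paths G" for p q
    using wo that unfolding linear_order_on_def total_on_def partial_order_on_def preorder_on_def refl_on_def
    by metis
  have trans: "trans ord" and antisym: "antisym ord"
    using wo by (auto simp: linear_order_on_def partial_order_on_def preorder_on_def)
  have ex: "\<exists>p\<in>A. \<forall>q\<in>A. (q, p) \<in> ord" if "finite A" "A \<noteq> {}" "A \<subseteq> paths G" for A
    using that
  proof (induction rule: finite_ne_induct)
    case (singleton x) then show ?case using tot by blast
  next
    case (insert x F)
    then obtain p where p: "p \<in> F" "\<forall>q\<in>F. (q, p) \<in> ord" by blast
    consider "(x,p) \<in> ord" | "(p,x) \<in> ord" using tot insert p by blast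
    then show ?case
    proof cases
      case 1 with p show ?thesis by blast
    next
      case 2
      have "(x,x) \<in> ord" using tot insert.prems by blast
      with 2 p show ?thesis using transD[OF trans] by blast
    qed
  qed
  have "\<exists>!p. p \<in> Poly_Mapping.keys x \<and> (\<forall>q\<in>Poly_Mapping.keys x. (q, p) \<in> ord)"
    using ex[of "Poly_Mapping.keys x"] assms(2,3) antisymD[OF antisym] by (metis finite_keys keys_eq_empty)
  from theI'[OF this] show "tip ord x \<in> Poly_Mapping.keys x"
    "q \<in> Poly_Mapping.keys x \<Longrightarrow> (q, tip ord x) \<in> ord" by (auto simp: tip_def)
qed

lemma lookup_smult: "Poly_Mapping.lookup (path_smult a x) k = a * Poly_Mapping.lookup x k"
  by (simp add: path_smult_def map.rep_eq when_def)

lemma simple_reduction_keys: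
  assumes fin: "fin_digraph G" and adm: "admissible_order G ord"
    and F: "0 \<notin> F" "\<And>f. f \<in> F \<Longrightarrow> Poly_Mapping.keys f \<subseteq> paths G"
    and red: "simple_reduction G ord F x y"
  shows "\<exists>p\<in>Poly_Mapping.keys x - Poly_Mapping.keys y.
    \<forall>k\<in>Poly_Mapping.keys y - Poly_Mapping.keys x. (k, p) \<in> ord - Id"
proof -
  from red obtain f p r s where f: "f \<in> F" and p: "Poly_Mapping.lookup x p \<noteq> 0"
    and pf: "path_factor G p r (tip ord f) s"
    and y: "y = path_smult (Poly_Mapping.lookup f (tip ord f)) x
         - path_smult (Poly_Mapping.lookup x p) (path_mult G (path_mult G (of_path r) f) (of_path s))"
    unfolding simple_reduction_def by blast
  let ?t = "tip ord f" and ?z = "path_mult G (path_mult G (of_path r) f) (of_path s)"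
  have fk: "Poly_Mapping.keys f \<subseteq> paths G" and f0: "f \<noteq> 0" using F f by auto
  note tp = tip_props[OF adm f0 fk]
  from pf have P: "r \<in> paths G" "?t \<in> paths G" "s \<in> paths G" "composable G r ?t" "composable G ?t s"
    and p_eq: "p = path_append (path_append r ?t) s" by (auto simp: path_factor_def)
  have cs: "composable G (path_append r q) s \<longleftrightarrow> composable G q s"
    if "q \<in> paths G" "composable G r q" for q
    using path_append_paths(2)[OF fin P(1) that] by (simp add: composable_def)
  have "Poly_Mapping.lookup ?z p = Poly_Mapping.lookup f ?t"
    unfolding p_eq using P cs by (simp add: lookup_of_path_left lookup_of_path_right)
  then have y0: "p \<notin> Poly_Mapping.keys y" by (simp add: in_keys_iff y lookup_minus lookup_smult)
  have "(k, p) \<in> ord - Id" if k: "k \<in> Poly_Mapping.keys y - Poly_Mapping.keys x" for k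
  proof -
    have "k \<in> Poly_Mapping.keys ?z"
      using k by (auto simp: in_keys_iff y lookup_minus lookup_smult)
    then obtain q' where "q' \<in> Poly_Mapping.keys (path_mult G (of_path r) f)"
      "composable G q' s" "k = path_append q' s" using keys_of_path_right by blast
    then obtain q where q: "q \<in> Poly_Mapping.keys f" "composable G r q"
       "composable G (path_append r q) s" and k_eq: "k = path_append (path_append r q) s"
      using keys_of_path_left by blast
    have "k \<noteq> p" using k y0 by auto
    then have "q \<noteq> ?t" using k_eq p_eq by auto
    then have "path_gt ord ?t q" using tp(2)[OF q(1)] by (simp add: path_gt_def)
    moreover have qp: "q \<in> paths G" using q fk by auto
    ultimately have gt: "path_gt ord (path_append r ?t) (path_append r q)"
      using adm P q unfolding admissible_order_def by blast
    have "path_gt ord p k"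
      unfolding p_eq k_eq
      using adm gt path_append_paths(1)[OF fin P(1) qp q(2)] path_append_paths(1)[OF fin P(1,2,4)]
        P(3) q(3) cs[OF P(2,4)] P(5) unfolding admissible_order_def by blast
    then show ?thesis by (auto simp: path_gt_def)
  qed
  moreover have "p \<in> Poly_Mapping.keys x - Poly_Mapping.keys y" using p y0 by (simp add: in_keys_iff)
  ultimately show ?thesis by blast
qed

lemma complete_reduction_exists:
  assumes fin: "fin_digraph G" and adm: "admissible_order G ord"
    and F: "0 \<notin> F" "\<And>f. f \<in> F \<Longrightarrow> Poly_Mapping.keys f \<subseteq> paths G"
  shows "\<exists>y. complete_reduction G ord F x y"
proof -
  have "wf (ord - Id)" using adm by (simp add: admissible_order_def well_order_on_def)
  then have "wf (inv_image (mult (ord - Id)) (\<lambda>x. mset_set (Poly_Mapping.keys x)))"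
    by (intro wf_inv_image wf_mult)
  then show ?thesis
  proof (induction x rule: wf_induct_rule)
    case (less x)
    show ?case
    proof (cases "\<exists>y. simple_reduction G ord F x y")
      case False
      then show ?thesis by (auto simp: complete_reduction_def)
    next
      case True
      then obtain y where y: "simple_reduction G ord F x y" by blast
      let ?A = "Poly_Mapping.keys x" and ?B = "Poly_Mapping.keys y"
      obtain p where p: "p \<in> ?A - ?B" "\<forall>k\<in>?B - ?A. (k, p) \<in> ord - Id"
        using simple_reduction_keys[OF fin adm F y] by blast
      have "(mset_set (?A \<inter> ?B) + mset_set (?B - ?A), mset_set (?A \<inter> ?B) + mset_set (?A - ?B)) \<in> mult (ord - Id)"
        using p by (intro one_step_implies_mult) (auto simp: mset_set_empty_iff)
      moreover have "mset_set (?A \<inter> ?B) + mset_set (?B - ?A) = mset_set ?B"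
        by (subst mset_set_Union[symmetric]) (auto intro: arg_cong[of _ _ mset_set])
      moreover have "mset_set (?A \<inter> ?B) + mset_set (?A - ?B) = mset_set ?A"
        by (subst mset_set_Union[symmetric]) (auto intro: arg_cong[of _ _ mset_set])
      ultimately have "(y, x) \<in> inv_image (mult (ord - Id)) (\<lambda>x. mset_set (Poly_Mapping.keys x))"
        by simp
      from less.IH[OF this] obtain z where "complete_reduction G ord F y z" by blast
      with y show ?thesis by (auto simp: complete_reduction_def intro: converse_rtranclp_into_rtranclp)
    qed
  qed
qed

lemma sum_keys_aux:
  assumes "finite A" "k \<notin> A"
  shows "Poly_Mapping.lookup (\<Sum>n\<in>A. path_smult (c n) (of_path n)) k = 0"
  using assms by (auto simp: lookup_sum lookup_smult of_path_def lookup_single when_def intro!: sum.neutral)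

lemma reduction_choice_exists:
  fixes G :: "('v, 'e) pre_digraph"
  assumes fin: "fin_digraph G" and adm: "admissible_order G ord" and T: "T \<subseteq> paths G"
  shows "\<exists>red :: ('v, 'e, 'k::field) generic_elem \<Rightarrow> ('v, 'e, 'k) generic_elem.
    reduction_choice G ord T m red"
proof -
  let ?H = "H_family G ord T :: ('v, 'e, 'k) generic_elem set"
  have A: "0 \<notin> ?H \<and> (\<forall>f\<in>?H. Poly_Mapping.keys f \<subseteq> paths G)"
  proof -
    have "f \<noteq> 0 \<and> Poly_Mapping.keys f \<subseteq> paths G" if "f \<in> ?H" for f
    proof -
      from that obtain t e S where t: "t \<in> T" and f: "f = e - S" and e: "e = of_path t"
        and S_eq: "S = (\<Sum>n\<in>{n \<in> normal_below G ord T t. 2 \<le> path_length n}.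
          path_smult (to_fract (mpoly_var (t, n))) (of_path n))"
        unfolding H_family_def by blast
      let ?A = "{n \<in> normal_below G ord T t. 2 \<le> path_length n}"
      have A: "t \<notin> ?A" "?A \<subseteq> paths G"
        by (auto simp: normal_below_def path_gt_def normal_paths_def)
      have S: "Poly_Mapping.lookup S k = 0" if "k \<notin> ?A" for k
      proof (cases "finite ?A")
        case True
        from sum_keys_aux[OF this that] show ?thesis unfolding S_eq .
      next
        case False
        then show ?thesis by (simp only: S_eq sum.infinite lookup_zero not_False_eq_True)
      qed
      have "Poly_Mapping.lookup f t = 1"
        by (simp add: f lookup_minus S[OF A(1)] e of_path_def lookup_single)
      moreover have "Poly_Mapping.lookup f k = 0" if "k \<notin> paths G" for k
      proof -
        have "k \<notin> ?A" "k \<noteq> t" using that A(2) t T by blast+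
        from S[OF this(1)] this(2) show ?thesis by (simp add: f lookup_minus e of_path_def lookup_single)
      qed
      ultimately show ?thesis by (auto simp: in_keys_iff)
    qed
    then show ?thesis by blast
  qed
  have "\<exists>y. complete_reduction G ord ?H z y" for z
    using complete_reduction_exists[OF fin adm, of ?H z] A by blast
  then have "\<forall>z. \<exists>y. complete_reduction G ord ?H z y" by blast
  from choice[OF this] show ?thesis by (auto simp: reduction_choice_def)
qed

end

theory Submission
  imports Defs
begin

text \<open>
  The proof has two halves: a Groebner basis criterion for path algebras, and the remark that
  reduction commutes with specialising the variables.

  Groebner side. For \<open>t\<close> in a tip-reduced set \<open>T\<close> let \<open>g t = t - (smaller parallel paths)\<close>.  The ideal
  generated by the \<open>g t\<close> is the linear span of the elements \<open>r * g t * s\<close>, and such an element is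
  monic with leading path \<open>w = r t s\<close>.  Suppose that the overlap relation of any \<open>g t\<close>, \<open>g u\<close> with
  overlap path \<open>w\<close> is a combination of elements \<open>r * g t * s\<close> with leading path smaller than \<open>w\<close>.
  Then two such elements with the same leading path \<open>w\<close> differ by a combination of those with smaller
  leading path: the two occurrences in \<open>w\<close> are equal, disjoint or overlapping, since \<open>T\<close> is
  tip-reduced (\<open>occurrences_resolvable\<close>).  By induction along the order no nonzero element of the
  ideal is supported on normal paths (\<open>diamond\<close>), so the paths divisible by an element of \<open>T\<close> are
  exactly the tips of the ideal, and the \<open>g t\<close> form the reduced Groebner basis
  (\<open>tips_genideal\<close>, \<open>reduced_groebner_basis_genideal\<close>).

  Specialisation side. All elements of the generic family have leading coefficient one, so its
  reductions never divide: every coefficient that occurs is a polynomial in the variables.  Evaluating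
  these polynomials at a point \<open>c\<close> turns each simple reduction into the subtraction of a multiple of
  some \<open>r * g t * s\<close>, where \<open>g t\<close> now has the coefficients \<open>c\<close> and \<open>r t s\<close> is at most the largest path
  of the element reduced (\<open>specialize_reduction\<close>).  Let \<open>c\<close> vanish on the coordinates of paths of length at
  most one.
  If all the polynomials \<open>f\<^sub>i\<close> and \<open>f\<^sub>j\<^sup>*\<close> vanish at \<open>c\<close>, the complete reductions specialise to zero;
  hence the overlap relations satisfy the criterion and every path of length \<open>m\<close> lies in the ideal
  (\<open>vanishing_imp_resolvable\<close>).  Conversely, if the \<open>g t\<close> lie in an ideal with tip set generated by
  \<open>T\<close> that contains the paths of length \<open>m\<close>, then the specialised complete reductions lie in
  this ideal and are supported on normal paths, so they are zero (\<open>ideal_imp_vanishing\<close>).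

  The correspondence follows.  An ideal is the zero element of its quotient algebra, and \<open>c\<close> can be
  read off from the reduced Groebner basis, so the map is injective.  An admissible
  ideal with the given tips has a reduced Groebner basis of the shape \<open>g t\<close>, since each basis element
  is the path \<open>t\<close> minus its normal form, and this normal form consists of paths that are parallel to
  \<open>t\<close>, smaller, and of length at least two when the ideal lies in the square of the arrow ideal.
  The normal paths are finite in number because those of length at least \<open>m\<close> are not normal; they span every
  quotient.
\<close>

section \<open>Paths and the product of the path algebra\<close>

lemma poly_mapping_sum_singles:
  "(\<Sum>p\<in>Poly_Mapping.keys x. Poly_Mapping.single p (Poly_Mapping.lookup x p)) = x"
  by (rule poly_mapping_eqI) (simp add: lookup_sum lookup_single when_def in_keys_iff)

lemma poly_mapping_induct_on [consumes 1, case_names zero add]: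
  fixes x :: "'a \<Rightarrow>\<^sub>0 'b::comm_monoid_add"
  assumes "Poly_Mapping.keys x \<subseteq> A"
    and zero: "P 0"
    and add: "\<And>p a y. p \<in> A \<Longrightarrow> P y \<Longrightarrow> P (Poly_Mapping.single p a + y)"
  shows "P x"
proof -
  have "P (\<Sum>p\<in>B. Poly_Mapping.single p (Poly_Mapping.lookup x p))" if "finite B" "B \<subseteq> A" for B
    using that by (induction rule: finite_induct) (auto intro: zero add)
  from this[of "Poly_Mapping.keys x"] assms(1) show ?thesis
    by (simp add: poly_mapping_sum_singles)
qed

lemma poly_mapping_induct_single [case_names zero add]:
  fixes x :: "'a \<Rightarrow>\<^sub>0 'b::comm_monoid_add"
  assumes "P 0" and "\<And>p a y. P y \<Longrightarrow> P (Poly_Mapping.single p a + y)"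
  shows "P x"
  by (rule poly_mapping_induct_on[OF subset_UNIV]) (use assms in blast)+

text \<open>
  Composability compares end vertices only, so concatenation obeys the laws of a category on
  arbitrary lists of arrows, and the product is associative on all formal combinations of them.
\<close>

lemma terminus_append:
  assumes "composable G p q"
  shows "terminus G (path_append p q) = terminus G q"
proof (cases "snd q = []")
  case True
  then show ?thesis
    using assms
    by (cases q) (simp add: terminus_def path_append_def composable_def origin_def pre_digraph.awalk_verts_conv)
next
  case False
  then show ?thesis
    by (simp add: terminus_def path_append_def pre_digraph.awalk_verts_conv)
qed

lemma origin_append: "origin (path_append p q) = origin p"
  by (simp add: origin_def path_append_def)

lemma path_length_append: "path_length (path_append p q) = path_length p + path_length q"
  by (simp add: path_length_def path_append_def)

lemma path_append_assoc: "path_append (path_append p q) r = path_append p (path_append q r)"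
  by (simp add: path_append_def)

lemma composable_append_left: "composable G p q \<Longrightarrow> composable G (path_append p q) r \<longleftrightarrow> composable G q r"
  by (simp add: composable_def terminus_append)

lemma composable_append_right: "composable G p (path_append q r) \<longleftrightarrow> composable G p q"
  by (simp add: composable_def origin_append)

lemmas path_simps = terminus_append origin_append path_length_append path_append_assoc
  composable_append_left composable_append_right

lemma path_mult_superset:
  assumes "finite A" "finite B" "Poly_Mapping.keys x \<subseteq> A" "Poly_Mapping.keys y \<subseteq> B"
  shows "path_mult G x y = (\<Sum>p\<in>A. \<Sum>q\<in>B. if composable G p q
     then Poly_Mapping.single (path_append p q) (Poly_Mapping.lookup x p * Poly_Mapping.lookup y q) else 0)"
proof -
  have "path_mult G x y = (\<Sum>p\<in>Poly_Mapping.keys x. \<Sum>q\<in>B. if composable G p q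
     then Poly_Mapping.single (path_append p q) (Poly_Mapping.lookup x p * Poly_Mapping.lookup y q) else 0)"
    unfolding path_mult_def
    by (intro sum.cong refl sum.mono_neutral_left) (use assms in \<open>auto simp: in_keys_iff\<close>)
  also have "\<dots> = (\<Sum>p\<in>A. \<Sum>q\<in>B. if composable G p q
     then Poly_Mapping.single (path_append p q) (Poly_Mapping.lookup x p * Poly_Mapping.lookup y q) else 0)"
    by (intro sum.mono_neutral_left) (use assms in \<open>auto simp: in_keys_iff intro!: sum.neutral\<close>)
  finally show ?thesis .
qed

lemma path_mult_add_left: "path_mult G (x + y) z = path_mult G x z + path_mult G y z"
proof -
  let ?A = "Poly_Mapping.keys x \<union> Poly_Mapping.keys y" and ?B = "Poly_Mapping.keys z"
  have *: "path_mult G w z = (\<Sum>p\<in>?A. \<Sum>q\<in>?B. if composable G p q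
     then Poly_Mapping.single (path_append p q) (Poly_Mapping.lookup w p * Poly_Mapping.lookup z q) else 0)"
    if "Poly_Mapping.keys w \<subseteq> ?A" for w
    using that by (intro path_mult_superset) auto
  have "Poly_Mapping.keys (x + y) \<subseteq> ?A" by (rule keys_add)
  then show ?thesis
    by (simp add: * flip: sum.distrib)
       (auto simp: lookup_add single_add algebra_simps intro!: sum.cong)
qed

lemma path_mult_add_right: "path_mult G z (x + y) = path_mult G z x + path_mult G z y"
proof -
  let ?A = "Poly_Mapping.keys x \<union> Poly_Mapping.keys y" and ?B = "Poly_Mapping.keys z"
  have *: "path_mult G z w = (\<Sum>p\<in>?B. \<Sum>q\<in>?A. if composable G p q
     then Poly_Mapping.single (path_append p q) (Poly_Mapping.lookup z p * Poly_Mapping.lookup w q) else 0)"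
    if "Poly_Mapping.keys w \<subseteq> ?A" for w
    using that by (intro path_mult_superset) auto
  have "Poly_Mapping.keys (x + y) \<subseteq> ?A" by (rule keys_add)
  then show ?thesis
    by (simp add: * flip: sum.distrib)
       (auto simp: lookup_add single_add algebra_simps intro!: sum.cong)
qed

lemma path_mult_zero [simp]: "path_mult G 0 x = 0" "path_mult G x 0 = 0"
  by (simp_all add: path_mult_def)

lemma path_mult_single:
  "path_mult G (Poly_Mapping.single p a) (Poly_Mapping.single q b) =
    (if composable G p q then Poly_Mapping.single (path_append p q) (a * b) else 0)"
  by (subst path_mult_superset[of "{p}" "{q}"]) auto

text \<open>
  By bilinearity it is enough to compare the products of three scaled paths.
\<close>

lemma path_mult_assoc: "path_mult G (path_mult G x y) z = path_mult G x (path_mult G y z)"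
proof (induction x rule: poly_mapping_induct_single)
  case (add p a x)
  have "path_mult G (path_mult G (Poly_Mapping.single p a) y) z =
    path_mult G (Poly_Mapping.single p a) (path_mult G y z)"
  proof (induction y rule: poly_mapping_induct_single)
    case (add q b y)
    have "path_mult G (path_mult G (Poly_Mapping.single p a) (Poly_Mapping.single q b)) z =
      path_mult G (Poly_Mapping.single p a) (path_mult G (Poly_Mapping.single q b) z)"
    proof (induction z rule: poly_mapping_induct_single)
      case (add r c z)
      have "path_mult G (path_mult G (Poly_Mapping.single p a) (Poly_Mapping.single q b)) (Poly_Mapping.single r c) =
        path_mult G (Poly_Mapping.single p a) (path_mult G (Poly_Mapping.single q b) (Poly_Mapping.single r c))"
        by (simp add: path_mult_single path_simps mult.assoc)
      with add show ?case by (simp add: path_mult_add_left path_mult_add_right)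
    qed simp
    with add show ?case by (simp add: path_mult_add_left path_mult_add_right)
  qed simp
  with add show ?case by (simp add: path_mult_add_left path_mult_add_right)
qed simp

lemma path_smult_simps:
  "path_smult a (x + y) = path_smult a x + path_smult a y"
  "path_smult (a + b) x = path_smult a x + path_smult b x"
  "path_smult a (path_smult b x) = path_smult (a * b) x"
  "path_smult 1 x = x"
  "path_smult a (Poly_Mapping.single p b) = Poly_Mapping.single p (a * b)"
  by (auto intro!: poly_mapping_eqI simp: lookup_smult lookup_add algebra_simps lookup_single when_def)

lemma path_smult_zero [simp]: "path_smult a 0 = 0" "path_smult 0 x = 0"
  by (auto intro!: poly_mapping_eqI simp: lookup_smult)

interpretation pv: vector_space "path_smult :: 'k::field \<Rightarrow> ('v, 'e, 'k) path_elem \<Rightarrow> ('v, 'e, 'k) path_elem"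
  by unfold_locales (simp_all add: path_smult_simps)

lemma path_mult_smult_left: "path_mult G (path_smult a x) y = path_smult a (path_mult G x y)"
proof (induction x rule: poly_mapping_induct_single)
  case (add p b x)
  have "path_mult G (path_smult a (Poly_Mapping.single p b)) y = path_smult a (path_mult G (Poly_Mapping.single p b) y)"
  proof (induction y rule: poly_mapping_induct_single)
    case (add q c y)
    have "path_mult G (path_smult a (Poly_Mapping.single p b)) (Poly_Mapping.single q c) =
        path_smult a (path_mult G (Poly_Mapping.single p b) (Poly_Mapping.single q c))"
      by (simp add: path_mult_single path_smult_simps(5) mult.assoc)
    with add show ?case by (simp only: path_mult_add_right path_smult_simps(1))
  qed simp
  with add show ?case by (simp only: path_mult_add_left path_smult_simps(1))
qed simp

lemma path_mult_smult_right: "path_mult G y (path_smult a x) = path_smult a (path_mult G y x)"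
proof (induction x rule: poly_mapping_induct_single)
  case (add p b x)
  have "path_mult G y (path_smult a (Poly_Mapping.single p b)) = path_smult a (path_mult G y (Poly_Mapping.single p b))"
  proof (induction y rule: poly_mapping_induct_single)
    case (add q c y)
    have "path_mult G (Poly_Mapping.single q c) (path_smult a (Poly_Mapping.single p b)) =
        path_smult a (path_mult G (Poly_Mapping.single q c) (Poly_Mapping.single p b))"
      by (simp add: path_mult_single path_smult_simps(5) mult.left_commute)
    with add show ?case by (simp only: path_mult_add_left path_smult_simps(1))
  qed simp
  with add show ?case by (simp only: path_mult_add_right path_smult_simps(1))
qed simp

lemma path_mult_diff_left: "path_mult G (x - y) z = path_mult G x z - path_mult G y z"
  using path_mult_add_left[of G "x - y" y z] by (simp add: eq_diff_eq)

lemma path_mult_diff_right: "path_mult G z (x - y) = path_mult G z x - path_mult G z y"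
  using path_mult_add_right[of G z "x - y" y] by (simp add: eq_diff_eq)

lemma path_mult_of_path:
  "path_mult G (of_path p) (of_path q) = (if composable G p q then of_path (path_append p q) else 0)"
  by (simp add: of_path_def path_mult_single)

lemma single_eq_smult_of_path: "Poly_Mapping.single p a = path_smult a (of_path p)"
  by (simp add: of_path_def path_smult_simps)

lemma keys_of_path [simp]: "Poly_Mapping.keys (of_path p :: ('v, 'e, 'k::comm_ring_1) path_elem) = {p}"
  by (simp add: of_path_def)

lemma keys_smult: "Poly_Mapping.keys (path_smult a x) \<subseteq> Poly_Mapping.keys x"
  by (auto simp: in_keys_iff lookup_smult)

lemma keys_path_mult:
  "Poly_Mapping.keys (path_mult G x y) \<subseteq>
    {path_append p q |p q. p \<in> Poly_Mapping.keys x \<and> q \<in> Poly_Mapping.keys y \<and> composable G p q}"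
proof
  fix k assume k: "k \<in> Poly_Mapping.keys (path_mult G x y)"
  show "k \<in> {path_append p q |p q. p \<in> Poly_Mapping.keys x \<and> q \<in> Poly_Mapping.keys y \<and> composable G p q}"
  proof (rule ccontr)
    assume not: "\<not> ?thesis"
    have "Poly_Mapping.lookup (path_mult G x y) k = 0"
      unfolding path_mult_def lookup_sum
    proof (intro sum.neutral ballI)
      fix p q assume "p \<in> Poly_Mapping.keys x" "q \<in> Poly_Mapping.keys y"
      with not have "\<not> (composable G p q \<and> k = path_append p q)" by blast
      then show "Poly_Mapping.lookup (if composable G p q then Poly_Mapping.single (path_append p q)
          (Poly_Mapping.lookup x p * Poly_Mapping.lookup y q) else 0) k = 0"
        by (auto simp: lookup_single when_def)
    qed
    with k show False by (simp add: in_keys_iff)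
  qed
qed

definition supported_on :: "'a set \<Rightarrow> ('a \<Rightarrow>\<^sub>0 'b::zero) set" where
  "supported_on A = {x. Poly_Mapping.keys x \<subseteq> A}"

lemma supported_on_eq_span:
  "supported_on A = pv.span (of_path ` A :: ('v, 'e, 'k::field) path_elem set)"
proof (intro subset_antisym subsetI)
  fix x :: "('v, 'e, 'k) path_elem" assume "x \<in> supported_on A"
  then have "Poly_Mapping.keys x \<subseteq> A" by (simp add: supported_on_def)
  then show "x \<in> pv.span (of_path ` A)"
  proof (induction x rule: poly_mapping_induct_on)
    case (add p a y)
    then show ?case
      unfolding single_eq_smult_of_path by (intro pv.span_add pv.span_scale) (auto intro: pv.span_base)
  qed (rule pv.span_zero)
next
  fix x :: "('v, 'e, 'k) path_elem" assume "x \<in> pv.span (of_path ` A)"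
  then show "x \<in> supported_on A"
  proof (rule pv.span_induct_alt)
    fix c and x y :: "('v, 'e, 'k) path_elem" assume "x \<in> of_path ` A" "y \<in> supported_on A"
    then show "path_smult c x + y \<in> supported_on A"
      unfolding supported_on_def using keys_add[of "path_smult c x" y] keys_smult[of c x] by fastforce
  qed (simp add: supported_on_def)
qed

lemma subspace_supported_on: "pv.subspace (supported_on A :: ('v, 'e, 'k::field) path_elem set)"
  by (simp add: supported_on_eq_span pv.subspace_span)

lemma span_map:
  assumes add: "\<And>x y. f (x + y) = f x + f y" and smult: "\<And>a x. f (path_smult a x) = path_smult a (f x)"
    and B: "\<And>b. b \<in> B \<Longrightarrow> f b \<in> pv.span C" and x: "x \<in> pv.span B"
  shows "f x \<in> pv.span C"
  using x
proof (rule pv.span_induct_alt)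
  show "f 0 \<in> pv.span C" using smult[of 0 0] by (simp add: pv.span_zero)
next
  fix c x y assume "x \<in> B" "f y \<in> pv.span C"
  then show "f (path_smult c x + y) \<in> pv.span C"
    using B by (auto simp: add smult intro: pv.span_add pv.span_scale)
qed

definition sandwich ::
  "('v, 'e) pre_digraph \<Rightarrow> ('v, 'e) path \<Rightarrow> ('v, 'e, 'k::comm_ring_1) path_elem \<Rightarrow> ('v, 'e) path \<Rightarrow>
    ('v, 'e, 'k) path_elem" where
  "sandwich G r f s = path_mult G (path_mult G (of_path r) f) (of_path s)"

section \<open>The path algebra as a ring\<close>

lemma path_algebra_simps [simp]:
  "carrier (path_algebra G) = supported_on (paths G)"
  "monoid.mult (path_algebra G) = path_mult G"
  "one (path_algebra G) = (\<Sum>v\<in>verts G. of_path (v, []))"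
  "zero (path_algebra G) = 0"
  "add (path_algebra G) = (+)"
  "module.smult (path_algebra G) = path_smult"
  by (simp_all add: path_algebra_def supported_on_def)

lemma path_mult_sum_left: "path_mult G (\<Sum>i\<in>A. f i) x = (\<Sum>i\<in>A. path_mult G (f i) x)"
  by (induction A rule: infinite_finite_induct) (simp_all add: path_mult_add_left)

lemma path_mult_sum_right: "path_mult G x (\<Sum>i\<in>A. f i) = (\<Sum>i\<in>A. path_mult G x (f i))"
  by (induction A rule: infinite_finite_induct) (simp_all add: path_mult_add_right)

context fin_digraph begin

lemma trivial_path: "v \<in> verts G \<Longrightarrow> (v, []) \<in> paths G"
  by (auto simp: paths_def awalk_Nil_iff)

lemma terminus_trivial [simp]: "terminus G (v, []) = v"
  by (simp add: terminus_def)

lemma origin_in_verts: "p \<in> paths G \<Longrightarrow> origin p \<in> verts G"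
  by (auto simp: paths_def origin_def dest: awalk_hd_in_verts)

lemma terminus_in_verts: "p \<in> paths G \<Longrightarrow> terminus G p \<in> verts G"
  by (auto simp: paths_def terminus_def dest: awalk_last_in_verts)

lemma append_in_paths: "p \<in> paths G \<Longrightarrow> q \<in> paths G \<Longrightarrow> composable G p q \<Longrightarrow> path_append p q \<in> paths G"
  using path_append_paths fin_digraph_axioms by blast

lemma path_mult_closed:
  "x \<in> supported_on (paths G) \<Longrightarrow> y \<in> supported_on (paths G) \<Longrightarrow> path_mult G x y \<in> supported_on (paths G)"
  unfolding supported_on_def using keys_path_mult[of G x y] append_in_paths by fastforce

lemma one_path_mult:
  assumes "x \<in> supported_on (paths G)"
  shows "path_mult G (\<Sum>v\<in>verts G. of_path (v, [])) x = x"
proof -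
  have "Poly_Mapping.keys x \<subseteq> paths G" using assms by (simp add: supported_on_def)
  then show ?thesis
  proof (induction x rule: poly_mapping_induct_on)
    case (add p a x)
    have "path_mult G (of_path (v, [])) (Poly_Mapping.single p a) =
        (if v = origin p then Poly_Mapping.single p a else 0)" for v
      by (auto simp: of_path_def path_mult_single composable_def path_append_def origin_def)
    then have "path_mult G (\<Sum>v\<in>verts G. of_path (v, [])) (Poly_Mapping.single p a) = Poly_Mapping.single p a"
      using origin_in_verts[OF add.hyps] by (simp add: path_mult_sum_left)
    with add show ?case by (simp add: path_mult_add_right)
  qed simp
qed

lemma path_mult_one:
  assumes "x \<in> supported_on (paths G)"
  shows "path_mult G x (\<Sum>v\<in>verts G. of_path (v, [])) = x"
proof -
  have "Poly_Mapping.keys x \<subseteq> paths G" using assms by (simp add: supported_on_def)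
  then show ?thesis
  proof (induction x rule: poly_mapping_induct_on)
    case (add p a x)
    have "path_mult G (Poly_Mapping.single p a) (of_path (v, [])) =
        (if v = terminus G p then Poly_Mapping.single p a else 0)" for v
      by (auto simp: of_path_def path_mult_single composable_def path_append_def origin_def)
    then have "path_mult G (Poly_Mapping.single p a) (\<Sum>v\<in>verts G. of_path (v, [])) = Poly_Mapping.single p a"
      using terminus_in_verts[OF add.hyps] by (simp add: path_mult_sum_right)
    with add show ?case by (simp add: path_mult_add_left)
  qed simp
qed

lemma ring_path_algebra: "ring (path_algebra G :: ('k::field, ('a, 'b, 'k) path_elem) module)"
proof (rule ringI)
  note sub = subspace_supported_on[of "paths G"]
  show "abelian_group (path_algebra G :: ('k::field, ('a, 'b, 'k) path_elem) module)"
  proof (rule abelian_groupI)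
    fix x :: "('a, 'b, 'k) path_elem" assume "x \<in> carrier (path_algebra G)"
    then show "\<exists>y\<in>carrier (path_algebra G). y \<oplus>\<^bsub>path_algebra G\<^esub> x = \<zero>\<^bsub>path_algebra G\<^esub>"
      by (intro bexI[of _ "- x"]) (simp_all add: pv.subspace_neg sub)
  qed (simp_all add: add_ac pv.subspace_add pv.subspace_0 sub)
  show "monoid (path_algebra G :: ('k::field, ('a, 'b, 'k) path_elem) module)"
  proof (rule monoidI)
    have "(\<Sum>v\<in>verts G. of_path (v, [])) \<in> (supported_on (paths G) :: ('a, 'b, 'k) path_elem set)"
      by (intro pv.subspace_sum sub) (simp add: supported_on_def trivial_path)
    then show "\<one>\<^bsub>path_algebra G\<^esub> \<in> carrier (path_algebra G :: ('k::field, ('a, 'b, 'k) path_elem) module)" by simp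
  qed (simp_all add: path_mult_closed path_mult_assoc one_path_mult path_mult_one)
qed (simp_all add: path_mult_add_left path_mult_add_right)

text \<open>
  Ideals are closed under scalars, because scaling an element is the same as multiplying it by a scaled unit.
\<close>

lemma ideal_iff:
  fixes I :: "('a, 'b, 'k::field) path_elem set"
  shows "ideal I (path_algebra G) \<longleftrightarrow> I \<subseteq> supported_on (paths G) \<and> pv.subspace I \<and>
    (\<forall>x\<in>I. \<forall>y\<in>supported_on (paths G). path_mult G x y \<in> I \<and> path_mult G y x \<in> I)"
proof
  assume I: "ideal I (path_algebra G)"
  interpret ideal I "path_algebra G" by fact
  have sub: "I \<subseteq> supported_on (paths G)" using a_subset by simp
  have one: "(\<Sum>v\<in>verts G. of_path (v, [])) \<in> (supported_on (paths G) :: ('a, 'b, 'k) path_elem set)"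
    using one_closed by simp
  have "path_smult a x \<in> I" if "x \<in> I" for a x
  proof -
    have "path_mult G (path_smult a (\<Sum>v\<in>verts G. of_path (v, []))) x \<in> I"
      using I_l_closed[OF that, of "path_smult a (\<Sum>v\<in>verts G. of_path (v, []))"] one
      by (simp add: pv.subspace_scale subspace_supported_on)
    with that sub show ?thesis by (auto simp: path_mult_smult_left one_path_mult subset_iff)
  qed
  then have "pv.subspace I"
    using additive_subgroup.a_closed[OF additive_subgroup_axioms]
      additive_subgroup.zero_closed[OF additive_subgroup_axioms]
    by (auto simp: pv.subspace_def)
  with sub show "I \<subseteq> supported_on (paths G) \<and> pv.subspace I \<and>
    (\<forall>x\<in>I. \<forall>y\<in>supported_on (paths G). path_mult G x y \<in> I \<and> path_mult G y x \<in> I)"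
    using I_l_closed I_r_closed by auto
next
  interpret ring "path_algebra G :: ('k, ('a, 'b, 'k) path_elem) module" by (rule ring_path_algebra)
  assume I: "I \<subseteq> supported_on (paths G) \<and> pv.subspace I \<and>
    (\<forall>x\<in>I. \<forall>y\<in>supported_on (paths G). path_mult G x y \<in> I \<and> path_mult G y x \<in> I)"
  show "ideal I (path_algebra G)"
  proof (rule idealI[OF ring_path_algebra])
    show "subgroup I (add_monoid (path_algebra G))"
    proof (rule add.subgroupI)
      fix a assume a: "a \<in> I"
      then have "a \<in> carrier (path_algebra G)" "- a \<in> carrier (path_algebra G)" "- a \<in> I" 
        using I by (auto simp: pv.subspace_neg subspace_supported_on)
      moreover have "- a \<oplus>\<^bsub>path_algebra G\<^esub> a = \<zero>\<^bsub>path_algebra G\<^esub>" by simp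
      ultimately show "\<ominus>\<^bsub>path_algebra G\<^esub> a \<in> I" using minus_equality by metis
    next
      show "I \<noteq> {}" using I pv.subspace_0 by blast
    next
      show "a \<oplus>\<^bsub>path_algebra G\<^esub> b \<in> I" if "a \<in> I" "b \<in> I" for a b
        using that I by (simp add: pv.subspace_add)
    qed (use I in auto)
  qed (use I in auto)
qed

definition sandwiches :: "('a, 'b, 'k::field) path_elem set \<Rightarrow> ('a, 'b, 'k) path_elem set" where
  "sandwiches S = {sandwich G r f s |r f s. r \<in> paths G \<and> f \<in> S \<and> s \<in> paths G}"

lemma sandwichesI:
  "r \<in> paths G \<Longrightarrow> f \<in> S \<Longrightarrow> s \<in> paths G \<Longrightarrow>
    path_mult G (path_mult G (of_path r) f) (of_path s) \<in> sandwiches S"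
  unfolding sandwiches_def sandwich_def by blast

lemma of_path_supported: "p \<in> A \<Longrightarrow> of_path p \<in> (supported_on A :: ('a, 'b, 'k::field) path_elem set)"
  by (simp add: supported_on_def)

text \<open>
  The span is closed under multiplication by paths on either side, because paths multiply to paths or to
  zero; by bilinearity it is an ideal.  It contains the generators because the unit is the sum
  of the trivial paths.
\<close>

lemma genideal_eq_span:
  fixes S :: "('a, 'b, 'k::field) path_elem set"
  assumes S: "S \<subseteq> supported_on (paths G)"
  shows "genideal (path_algebra G) S = pv.span (sandwiches S)"
proof
  interpret ring "path_algebra G :: ('k, ('a, 'b, 'k) path_elem) module" by (rule ring_path_algebra)
  have right: "path_mult G x (of_path q) \<in> pv.span (sandwiches S)"
    if "x \<in> pv.span (sandwiches S)" "q \<in> paths G" for x q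
  proof (rule span_map[OF _ _ _ that(1)])
    fix b assume "b \<in> sandwiches S"
    then obtain r f s where *: "r \<in> paths G" "f \<in> S" "s \<in> paths G"
      and b: "b = path_mult G (path_mult G (of_path r) f) (of_path s)"
      unfolding sandwiches_def sandwich_def by blast
    have "path_mult G b (of_path q) = (if composable G s q
       then path_mult G (path_mult G (of_path r) f) (of_path (path_append s q)) else 0)"
      unfolding b by (simp add: path_mult_assoc path_mult_of_path)
    moreover have "path_mult G (path_mult G (of_path r) f) (of_path (path_append s q)) \<in> sandwiches S"
      if "composable G s q"
      using * that \<open>q \<in> paths G\<close> append_in_paths unfolding sandwiches_def sandwich_def by blast
    ultimately show "path_mult G b (of_path q) \<in> pv.span (sandwiches S)"
      by (auto intro: pv.span_base pv.span_zero)
  qed (simp_all add: path_mult_add_left path_mult_smult_left)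
  have left: "path_mult G (of_path q) x \<in> pv.span (sandwiches S)"
    if "x \<in> pv.span (sandwiches S)" "q \<in> paths G" for x q
  proof (rule span_map[OF _ _ _ that(1)])
    fix b assume "b \<in> sandwiches S"
    then obtain r f s where *: "r \<in> paths G" "f \<in> S" "s \<in> paths G"
      and b: "b = path_mult G (path_mult G (of_path r) f) (of_path s)"
      unfolding sandwiches_def sandwich_def by blast
    have "path_mult G (of_path q) b = (if composable G q r
       then path_mult G (path_mult G (of_path (path_append q r)) f) (of_path s) else 0)"
      unfolding b by (simp add: path_mult_of_path flip: path_mult_assoc)
    moreover have "path_mult G (path_mult G (of_path (path_append q r)) f) (of_path s) \<in> sandwiches S"
      if "composable G q r"
      using * that \<open>q \<in> paths G\<close> append_in_paths unfolding sandwiches_def sandwich_def by blast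
    ultimately show "path_mult G (of_path q) b \<in> pv.span (sandwiches S)"
      by (auto intro: pv.span_base pv.span_zero)
  qed (simp_all add: path_mult_add_right path_mult_smult_right)
  have "ideal (pv.span (sandwiches S)) (path_algebra G)"
    unfolding ideal_iff
  proof (intro conjI ballI)
    have "sandwiches S \<subseteq> supported_on (paths G)"
      using S unfolding sandwiches_def sandwich_def by (auto intro!: path_mult_closed of_path_supported)
    then show "pv.span (sandwiches S) \<subseteq> supported_on (paths G)"
      by (rule pv.span_minimal[OF _ subspace_supported_on])
    fix x y assume x: "x \<in> pv.span (sandwiches S)"
      and y: "y \<in> (supported_on (paths G) :: ('a, 'b, 'k) path_elem set)"
    from y have y': "y \<in> pv.span (of_path ` paths G)" by (simp add: supported_on_eq_span)
    show "path_mult G x y \<in> pv.span (sandwiches S)"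
      by (rule span_map[OF _ _ _ y']) (auto simp: path_mult_add_right path_mult_smult_right x right)
    show "path_mult G y x \<in> pv.span (sandwiches S)"
      by (rule span_map[OF _ _ _ y']) (auto simp: path_mult_add_left path_mult_smult_left x left)
  qed (rule pv.subspace_span)
  moreover have "S \<subseteq> pv.span (sandwiches S)"
  proof
    fix f assume f: "f \<in> S"
    let ?one = "\<Sum>v\<in>verts G. of_path (v, []) :: ('a, 'b, 'k) path_elem"
    have "f = path_mult G (path_mult G ?one f) ?one"
      using f S by (simp add: one_path_mult path_mult_one subset_iff)
    also have "\<dots> = (\<Sum>u\<in>verts G. \<Sum>v\<in>verts G. path_mult G (path_mult G (of_path (v, [])) f) (of_path (u, [])))"
      by (simp add: path_mult_sum_left path_mult_sum_right)
    also have "\<dots> \<in> pv.span (sandwiches S)"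
      by (intro pv.span_sum pv.span_base sandwichesI trivial_path f)
    finally show "f \<in> pv.span (sandwiches S)" .
  qed
  ultimately show "genideal (path_algebra G) S \<subseteq> pv.span (sandwiches S)"
    by (rule genideal_minimal)
  have Sc: "S \<subseteq> carrier (path_algebra G)" using S by simp
  note G = genideal_ideal[OF Sc, unfolded ideal_iff]
  show "pv.span (sandwiches S) \<subseteq> genideal (path_algebra G) S"
  proof (rule pv.span_minimal)
    show "sandwiches S \<subseteq> genideal (path_algebra G) S"
      using G genideal_self[OF Sc] unfolding sandwiches_def sandwich_def by (auto simp: of_path_supported subset_iff)
  qed (use G in blast)
qed

lemma path_split:
  assumes "p \<in> paths G" "path_length p = i + j"
  shows "\<exists>a b. a \<in> paths G \<and> b \<in> paths G \<and> composable G a b \<and> p = path_append a b \<and>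
    path_length a = i \<and> path_length b = j"
proof -
  obtain u es v where p: "p = (u, es)" and w: "awalk u es v" using assms(1) by (auto simp: paths_def)
  from w have "awalk u (take i es @ drop i es) v" by simp
  then have *: "awalk u (take i es) (awlast u (take i es))" "awalk (awlast u (take i es)) (drop i es) v"
    unfolding awalk_append_iff by blast+
  show ?thesis
    by (rule exI[of _ "(u, take i es)"], rule exI[of _ "(awlast u (take i es), drop i es)"])
      (use * assms(2) in \<open>auto simp: p paths_def composable_def terminus_def origin_def path_append_def path_length_def\<close>)
qed

lemma subpath_in_paths: "subpath G p q \<Longrightarrow> p \<in> paths G \<and> q \<in> paths G"
  unfolding subpath_def path_factor_def by (metis append_in_paths composable_append_left)

lemma subpathI: "path_factor G q r p s \<Longrightarrow> subpath G p q"
  unfolding subpath_def by blast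

lemma subpath_refl: "p \<in> paths G \<Longrightarrow> subpath G p p"
  unfolding subpath_def path_factor_def
  by (rule exI[of _ "(origin p, [])"], rule exI[of _ "(terminus G p, [])"])
    (auto simp: trivial_path origin_in_verts terminus_in_verts composable_def origin_append,
     auto simp: path_append_def origin_def)

lemma subpath_trans: 
  assumes "subpath G p q" "subpath G q w"
  shows "subpath G p w"
proof -
  obtain r s r' s' where 1: "path_factor G q r p s" "path_factor G w r' q s'"
    using assms by (auto simp: subpath_def)
  then have "path_factor G w (path_append r' r) p (path_append s s')"
    by (auto simp: path_factor_def path_simps append_in_paths composable_append_right)
  then show ?thesis by (rule subpathI)
qed

lemma subpath_length: "subpath G p q \<Longrightarrow> path_length p \<le> path_length q"
  by (auto simp: subpath_def path_factor_def path_length_append)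

lemma subpath_eq: 
  assumes "subpath G p q" "path_length q \<le> path_length p"
  shows "p = q"
proof -
  obtain r s where *: "composable G r p" "q = path_append (path_append r p) s"
    using assms by (auto simp: subpath_def path_factor_def)
  with assms(2) have "snd r = []" "snd s = []" by (auto simp: path_length_def path_append_def)
  with * show ?thesis
    by (cases r; cases p; cases s) (auto simp: composable_def origin_def path_append_def)
qed

text \<open>
  The paths that lie in the monomial ideal generated by \<open>S\<close>.
\<close>

definition above :: "('a, 'b) path set \<Rightarrow> ('a, 'b) path set" where
  "above S = {p \<in> paths G. \<exists>t\<in>S. subpath G t p}"

text \<open>
  A product of paths around a generator is zero or a path above that generator.
\<close>

lemma path_ideal_eq:
  assumes "S \<subseteq> paths G"
  shows "path_ideal G S = (supported_on (above S) :: ('a, 'b, 'k::field) path_elem set)"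
proof -
  have "of_path ` S \<subseteq> (supported_on (paths G) :: ('a, 'b, 'k) path_elem set)"
    using assms by (auto simp: supported_on_def)
  from genideal_eq_span[OF this]
  have "path_ideal G S = pv.span (sandwiches (of_path ` S :: ('a, 'b, 'k) path_elem set))"
    by (simp add: path_ideal_def)
  also have "\<dots> = pv.span (of_path ` above S)"
  proof (intro subset_antisym pv.span_minimal pv.subspace_span subsetI)
    fix x :: "('a, 'b, 'k) path_elem" assume "x \<in> of_path ` above S"
    then obtain p where p: "p \<in> above S" and x: "x = of_path p" by blast
    from p obtain t r s where t: "t \<in> S" and pf: "path_factor G p r t s"
      by (auto simp: above_def subpath_def)
    then have "x = path_mult G (path_mult G (of_path r) (of_path t)) (of_path s)"
      by (simp add: x path_factor_def path_mult_of_path path_simps)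
    moreover have "r \<in> paths G" "s \<in> paths G" using pf by (auto simp: path_factor_def)
    ultimately show "x \<in> pv.span (sandwiches (of_path ` S))"
      using t by (auto intro!: pv.span_base sandwichesI)
  next
    fix x :: "('a, 'b, 'k) path_elem" assume "x \<in> sandwiches (of_path ` S)"
    then obtain r t s where rts: "r \<in> paths G" "t \<in> S" "s \<in> paths G"
      and x: "x = path_mult G (path_mult G (of_path r) (of_path t)) (of_path s)"
      unfolding sandwiches_def sandwich_def by blast
    show "x \<in> pv.span (of_path ` above S)"
    proof (cases "composable G r t \<and> composable G t s")
      case True
      let ?p = "path_append (path_append r t) s"
      have "path_factor G ?p r t s" using True rts assms by (auto simp: path_factor_def)
      then have "subpath G t ?p" by (rule subpathI)
      then have "?p \<in> above S" using rts subpath_in_paths by (auto simp: above_def)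
      moreover have "x = of_path ?p" using True by (simp add: x path_mult_of_path path_simps)
      ultimately show ?thesis by (intro pv.span_base) simp
    next
      case False
      then have "x = 0" by (auto simp: x path_mult_of_path path_simps)
      then show ?thesis by (simp add: pv.span_zero)
    qed
  qed
  finally show ?thesis by (simp add: supported_on_eq_span)
qed

lemma arrow_ideal_eq:
  "arrow_ideal G = (supported_on {p \<in> paths G. 1 \<le> path_length p} :: ('a, 'b, 'k::field) path_elem set)"
proof -
  let ?A = "{(tail G e, [e]) |e. e \<in> arcs G}"
  have A: "?A \<subseteq> paths G" by (auto simp: paths_def intro: arc_implies_awalk)
  have "arrow_ideal G = (path_ideal G ?A :: ('a, 'b, 'k) path_elem set)"
    unfolding arrow_ideal_def path_ideal_def by (rule arg_cong[of _ _ "genideal _"]) auto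
  also have "\<dots> = supported_on (above ?A)" by (rule path_ideal_eq[OF A])
  also have "above ?A = {p \<in> paths G. 1 \<le> path_length p}"
  proof (intro subset_antisym subsetI)
    fix p assume "p \<in> above ?A"
    then show "p \<in> {p \<in> paths G. 1 \<le> path_length p}"
      by (auto simp: above_def path_length_def dest!: subpath_length)
  next
    fix p assume p: "p \<in> {p \<in> paths G. 1 \<le> path_length p}"
    then have "p \<in> paths G" "path_length p = 1 + (path_length p - 1)" by auto
    from path_split[OF this]
    obtain a b where ab: "a \<in> paths G" "b \<in> paths G" "composable G a b" "p = path_append a b" "path_length a = 1"
      by blast
    have "path_append (origin a, []) a = a" by (simp add: path_append_def origin_def)
    with ab have "path_factor G p (origin a, []) a b"
      by (auto simp: path_factor_def trivial_path origin_in_verts composable_def)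
    then have "subpath G a p" by (rule subpathI)
    moreover have "a \<in> ?A"
      using ab by (cases a; cases "snd a") (auto simp: path_length_def paths_def awalk_Cons_iff)
    ultimately show "p \<in> above ?A" using p by (auto simp: above_def)
  qed
  finally show ?thesis .
qed

text \<open>
  A path of length at least \<open>k + 1\<close> is the product of a path of length at least \<open>k\<close> and its last arrow.
\<close>

lemma arrow_ideal_power_eq:
  "ideal_power (path_algebra G) (arrow_ideal G) k =
    (supported_on {p \<in> paths G. k \<le> path_length p} :: ('a, 'b, 'k::field) path_elem set)"
proof (induction k)
  case 0
  show ?case by simp
next
  case (Suc k)
  let ?P = "\<lambda>k. {p \<in> paths G. k \<le> path_length p}"
  let ?R = "path_algebra G :: ('k, ('a, 'b, 'k) path_elem) module"
  have "ideal_prod ?R (supported_on (?P k)) (supported_on (?P 1)) = supported_on (?P (Suc k))"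
  proof (intro subset_antisym subsetI)
    fix x assume "x \<in> ideal_prod ?R (supported_on (?P k)) (supported_on (?P 1))"
    then show "x \<in> supported_on (?P (Suc k))"
    proof (induction rule: ideal_prod.induct)
      case (prod i j)
      then have "path_append p q \<in> ?P (Suc k)"
        if "p \<in> Poly_Mapping.keys i" "q \<in> Poly_Mapping.keys j" "composable G p q" for p q
        using subsetD[OF prod(1)[unfolded supported_on_def mem_Collect_eq] that(1)]
          subsetD[OF prod(2)[unfolded supported_on_def mem_Collect_eq] that(2)] append_in_paths that(3)
        by (auto simp: path_length_append)
      then show ?case using keys_path_mult[of G i j] by (auto simp: supported_on_def)
    qed (simp add: pv.subspace_add subspace_supported_on)
  next
    fix x assume "x \<in> (supported_on (?P (Suc k)) :: ('a, 'b, 'k) path_elem set)"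
    then have "Poly_Mapping.keys x \<subseteq> ?P (Suc k)" by (simp add: supported_on_def)
    then show "x \<in> ideal_prod ?R (supported_on (?P k)) (supported_on (?P 1))"
    proof (induction x rule: poly_mapping_induct_on)
      case zero
      show ?case using ideal_prod.prod[of 0 "supported_on (?P k)" 0 "supported_on (?P 1)" ?R]
        by (simp add: supported_on_def)
    next
      case (add p a x)
      from add.hyps have "p \<in> paths G" "path_length p = (path_length p - 1) + 1" by auto
      from path_split[OF this]
      obtain q e where qe: "q \<in> paths G" "e \<in> paths G" "composable G q e" "p = path_append q e"
        "path_length e = 1" "path_length q = path_length p - 1"
        by blast
      then have "Poly_Mapping.single p a = path_mult G (path_smult a (of_path q)) (of_path e)"
        by (simp add: path_mult_smult_left path_mult_of_path single_eq_smult_of_path)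
      moreover have "of_path e \<in> (supported_on (?P 1) :: ('a, 'b, 'k) path_elem set)"
        "path_smult a (of_path q) \<in> (supported_on (?P k) :: ('a, 'b, 'k) path_elem set)"
        using qe add.hyps by (auto intro!: pv.subspace_scale subspace_supported_on of_path_supported)
      ultimately have "Poly_Mapping.single p a \<in> ideal_prod ?R (supported_on (?P k)) (supported_on (?P 1))"
        using ideal_prod.prod[of "path_smult a (of_path q)" _ "of_path e" _ ?R] by simp
      from ideal_prod.sum[OF this add.IH] show ?case by simp
    qed
  qed
  then show ?case unfolding ideal_power.simps Suc by (simp only: arrow_ideal_eq)
qed

end

lemma sandwich_linear:
  "sandwich G r (x + y) s = sandwich G r x s + sandwich G r y s"
  "sandwich G r (x - y) s = sandwich G r x s - sandwich G r y s"
  "sandwich G r (path_smult a x) s = path_smult a (sandwich G r x s)"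
  "sandwich G r 0 s = 0"
  by (simp_all add: sandwich_def path_mult_add_left path_mult_add_right path_mult_diff_left
    path_mult_diff_right path_mult_smult_left path_mult_smult_right)

lemma keys_sandwich:
  assumes "k \<in> Poly_Mapping.keys (sandwich G r f s)"
  shows "\<exists>q\<in>Poly_Mapping.keys f. composable G r q \<and> composable G q s \<and> k = path_append (path_append r q) s"
proof -
  from keys_of_path_right[OF assms[unfolded sandwich_def]]
  obtain q' where q': "q' \<in> Poly_Mapping.keys (path_mult G (of_path r) f)" "composable G q' s" "k = path_append q' s"
    by blast
  from keys_of_path_left[OF q'(1)] obtain q where "q \<in> Poly_Mapping.keys f" "composable G r q" "q' = path_append r q"
    by blast
  with q' show ?thesis by (auto simp: composable_append_left)
qed

lemma lookup_sandwich:
  assumes "composable G r q" "composable G q s"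
  shows "Poly_Mapping.lookup (sandwich G r f s) (path_append (path_append r q) s) = Poly_Mapping.lookup f q"
  using assms by (simp add: sandwich_def lookup_of_path_right lookup_of_path_left composable_append_left)

lemma sandwich_sandwich:
  "sandwich G a (sandwich G r f s) c =
    (if composable G a r \<and> composable G s c then sandwich G (path_append a r) f (path_append s c) else 0)"
proof -
  have "sandwich G a (sandwich G r f s) c =
    path_mult G (path_mult G (path_mult G (of_path a) (of_path r)) f) (path_mult G (of_path s) (of_path c))"
    by (simp add: sandwich_def path_mult_assoc)
  then show ?thesis by (simp add: path_mult_of_path sandwich_def)
qed

lemma path_eqI: "origin p = origin q \<Longrightarrow> snd p = snd q \<Longrightarrow> p = q"
  by (simp add: origin_def prod_eq_iff)

section \<open>Admissible orders\<close>

locale ordered_quiver = fin_digraph G for G :: "('a, 'b) pre_digraph" +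
  fixes ord :: "('a, 'b) path rel"
  assumes admissible: "admissible_order G ord"
begin

definition below :: "('a, 'b) path \<Rightarrow> ('a, 'b) path set" where
  "below w = {q \<in> paths G. path_gt ord w q}"

abbreviation upto_path :: "('a, 'b) path \<Rightarrow> ('a, 'b) path set" where
  "upto_path w \<equiv> insert w (below w)"

lemma linear_ord: "linear_order_on (paths G) ord"
  using admissible by (simp add: admissible_order_def well_order_on_def)

lemma ord_trans: "trans ord" and ord_antisym: "antisym ord" and ord_total: "total_on (paths G) ord"
  and ord_refl: "refl_on (paths G) ord"
  using linear_ord by (auto simp: linear_order_on_def partial_order_on_def preorder_on_def)

lemma path_gt_trans: "path_gt ord p q \<Longrightarrow> path_gt ord q r \<Longrightarrow> path_gt ord p r"
  unfolding path_gt_def using transD[OF ord_trans] antisymD[OF ord_antisym] by metis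

lemma path_gt_total: "p \<in> paths G \<Longrightarrow> q \<in> paths G \<Longrightarrow> p = q \<or> path_gt ord p q \<or> path_gt ord q p"
  using ord_total by (auto simp: total_on_def path_gt_def)

lemma wf_path_gt: "wf {(q, p). path_gt ord p q}"
proof -
  have "wf (ord - Id)" using admissible by (simp add: admissible_order_def well_order_on_def)
  moreover have "{(q, p). path_gt ord p q} = ord - Id" by (auto simp: path_gt_def)
  ultimately show ?thesis by simp
qed

lemma path_gt_sandwich:
  assumes "path_gt ord p q" "p \<in> paths G" "q \<in> paths G" "a \<in> paths G" "c \<in> paths G"
    and "composable G a p" "composable G a q" "composable G p c" "composable G q c"
  shows "path_gt ord (path_append (path_append a p) c) (path_append (path_append a q) c)"
proof -
  have "path_gt ord (path_append a p) (path_append a q)"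
    using admissible assms unfolding admissible_order_def by blast
  moreover have "path_append a p \<in> paths G" "path_append a q \<in> paths G"
    using assms append_in_paths by blast+
  ultimately show ?thesis
    using admissible assms unfolding admissible_order_def by (simp add: composable_append_left)
qed

lemma below_mono: "path_gt ord w v \<Longrightarrow> upto_path v \<inter> paths G \<subseteq> below w"
  unfolding below_def using path_gt_trans by blast

lemma not_in_below: "w \<notin> below w"
  by (simp add: below_def path_gt_def)

lemma tip_eqI:
  assumes "w \<in> Poly_Mapping.keys x" "Poly_Mapping.keys x \<subseteq> upto_path w" "w \<in> paths G"
  shows "tip ord x = w"
  unfolding tip_def
proof (rule the_equality)
  have *: "(q, w) \<in> ord" if "q \<in> Poly_Mapping.keys x" for q
    using assms(2,3) that refl_onD[OF ord_refl, of w] unfolding below_def path_gt_def by blast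
  then show "w \<in> Poly_Mapping.keys x \<and> (\<forall>q\<in>Poly_Mapping.keys x. (q, w) \<in> ord)" using assms(1) by blast
  fix p assume "p \<in> Poly_Mapping.keys x \<and> (\<forall>q\<in>Poly_Mapping.keys x. (q, p) \<in> ord)"
  then show "p = w" using * assms(1) antisymD[OF ord_antisym] by blast
qed

lemma tip_in_keys: "x \<noteq> 0 \<Longrightarrow> x \<in> supported_on (paths G) \<Longrightarrow> tip ord x \<in> Poly_Mapping.keys x"
  using tip_props(1)[OF admissible] by (auto simp: supported_on_def)

lemma keys_upto_tip:
  assumes "x \<noteq> 0" "x \<in> supported_on (paths G)"
  shows "Poly_Mapping.keys x \<subseteq> upto_path (tip ord x)"
  using tip_props(2)[OF admissible assms(1)] assms(2) unfolding supported_on_def below_def path_gt_def by blast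

text \<open>
  By admissibility of the order, all lower terms stay lower when an element is enclosed between two
  paths; distinct paths stay distinct, so the coefficient at the leading path is kept.
\<close>

lemma supported_sandwich:
  assumes "f \<in> supported_on (upto_path t)" "path_factor G w r t s"
  shows "sandwich G r f s \<in> supported_on (upto_path w)"
    and "Poly_Mapping.lookup (sandwich G r f s) w = Poly_Mapping.lookup f t"
proof -
  have pf: "r \<in> paths G" "t \<in> paths G" "s \<in> paths G" "composable G r t" "composable G t s"
    "w = path_append (path_append r t) s"
    using assms(2) by (auto simp: path_factor_def)
  show "Poly_Mapping.lookup (sandwich G r f s) w = Poly_Mapping.lookup f t"
    using pf by (simp add: lookup_sandwich)
  show "sandwich G r f s \<in> supported_on (upto_path w)"
    unfolding supported_on_def
  proof (rule CollectI, rule subsetI)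
    fix k assume "k \<in> Poly_Mapping.keys (sandwich G r f s)"
    from keys_sandwich[OF this] obtain q where q: "q \<in> Poly_Mapping.keys f" "composable G r q" "composable G q s"
      "k = path_append (path_append r q) s" by blast
    show "k \<in> upto_path w"
    proof (cases "q = t")
      case False
      then have *: "q \<in> paths G" "path_gt ord t q" using assms(1) q by (auto simp: supported_on_def below_def)
      have "path_gt ord w k" unfolding q(4) pf(6) by (rule path_gt_sandwich) (use * pf q in auto)
      moreover have "k \<in> paths G"
        unfolding q(4) by (intro append_in_paths) (use * pf q in \<open>auto simp: composable_append_left\<close>)
      ultimately show ?thesis by (simp add: below_def)
    qed (use q pf in auto)
  qed
qed

section \<open>Normal forms\<close>

lemma normal_form_extend:
  fixes I :: "('a, 'b, 'k::field) path_elem set"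
  assumes I: "pv.subspace I" and B: "\<And>q. q \<in> B \<Longrightarrow> \<exists>n\<in>supported_on A. of_path q - n \<in> I"
    and y: "y \<in> supported_on B"
  shows "\<exists>n\<in>supported_on A. y - n \<in> I"
proof -
  note subA = subspace_supported_on[of A]
  from y have "Poly_Mapping.keys y \<subseteq> B" by (simp add: supported_on_def)
  then show ?thesis
  proof (induction y rule: poly_mapping_induct_on)
    case zero
    show ?case using pv.subspace_0[OF I] pv.subspace_0[OF subA] by (intro bexI[of _ 0]) simp_all
  next
    case (add p a y)
    from B[OF add.hyps] add.IH obtain m n where m: "m \<in> supported_on A" "of_path p - m \<in> I"
      and n: "n \<in> supported_on A" "y - n \<in> I" by blast
    have "path_smult a m + n \<in> supported_on A"
      by (intro pv.subspace_add pv.subspace_scale subA m n)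
    moreover have "path_smult a (of_path p - m) + (y - n) \<in> I"
      using m(2) n(2) I by (intro pv.subspace_add pv.subspace_scale) auto
    ultimately show ?case
      by (intro bexI[of _ "path_smult a m + n"])
        (simp_all add: single_eq_smult_of_path pv.scale_right_diff_distrib algebra_simps)
  qed
qed

text \<open>
  The elements of \<open>I\<close> suffice to rewrite every path outside \<open>N\<close> in terms of smaller paths.  For an ideal
  this holds when \<open>N\<close> consists of the paths that are not tips; for the span of a rewriting family
  when \<open>N\<close> consists of the paths without a subpath among the tips of the family.
\<close>

definition reduces :: "('a, 'b, 'k::field) path_elem set \<Rightarrow> ('a, 'b) path set \<Rightarrow> bool" where
  "reduces I N \<longleftrightarrow> (\<forall>p\<in>paths G - N. \<exists>x\<in>I. p \<in> Poly_Mapping.keys x \<and> x \<in> supported_on (upto_path p))"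

text \<open>
  By induction along the order: an element of \<open>I\<close> with leading path \<open>p\<close> replaces \<open>p\<close> by smaller paths,
  which have normal forms.  The normal form involves no path above \<open>p\<close>.
\<close>

lemma normal_form_path:
  fixes I :: "('a, 'b, 'k::field) path_elem set"
  assumes I: "pv.subspace I" and red: "reduces I N" and p: "p \<in> paths G"
  shows "\<exists>n\<in>supported_on (N \<inter> upto_path p). of_path p - n \<in> I"
  using p
proof (induction p rule: wf_induct_rule[OF wf_path_gt])
  case (1 p)
  show ?case
  proof (cases "p \<in> N")
    case True
    then show ?thesis using pv.subspace_0[OF I] by (intro bexI[of _ "of_path p"]) (simp_all add: of_path_supported)
  next
    case False
    then obtain x where x: "x \<in> I" "p \<in> Poly_Mapping.keys x" "x \<in> supported_on (upto_path p)"
      using red 1(2) unfolding reduces_def by blast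
    let ?x = "path_smult (1 / Poly_Mapping.lookup x p) x"
    let ?y = "of_path p - ?x"
    have "Poly_Mapping.lookup ?y p = 0" using x(2) by (simp add: lookup_minus lookup_smult of_path_def in_keys_iff)
    moreover have "?y \<in> supported_on (upto_path p)"
      using x(3) by (intro pv.subspace_diff pv.subspace_scale subspace_supported_on of_path_supported) auto
    ultimately have y: "?y \<in> supported_on (below p)" by (auto simp: supported_on_def in_keys_iff)
    have "\<exists>n\<in>supported_on (N \<inter> below p). of_path q - n \<in> I" if "q \<in> below p" for q
    proof -
      from that have q: "path_gt ord p q" "q \<in> paths G" by (auto simp: below_def)
      from 1(1)[of q] q obtain n where "n \<in> supported_on (N \<inter> upto_path q)" "of_path q - n \<in> I" by auto
      moreover have "N \<inter> upto_path q \<subseteq> N \<inter> below p"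
        using below_mono[OF q(1)] q(2) by (auto simp: below_def)
      ultimately show ?thesis unfolding supported_on_def by blast
    qed
    from normal_form_extend[OF I this y] obtain n where n: "n \<in> supported_on (N \<inter> below p)" "?y - n \<in> I" by blast
    have "?x + (?y - n) \<in> I" using n(2) x(1) I by (intro pv.subspace_add pv.subspace_scale) auto
    then have "of_path p - n \<in> I" by simp
    with n(1) show ?thesis by (intro bexI[of _ n]) (auto simp: supported_on_def)
  qed
qed

text \<open>
  Replacing the lower terms of an element by their normal forms does not disturb its tip.  If the tip
  were in \<open>N\<close>, the result would be a nonzero element of \<open>I\<close> supported on \<open>N\<close>.
\<close>

lemma tip_not_normal:
  fixes I :: "('a, 'b, 'k::field) path_elem set"
  assumes I: "pv.subspace I" "I \<subseteq> supported_on (paths G)" and red: "reduces I N"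
    and triv: "I \<inter> supported_on N \<subseteq> {0}" and x: "x \<in> I" "x \<noteq> 0"
  shows "tip ord x \<notin> N"
proof
  let ?w = "tip ord x"
  assume w: "?w \<in> N"
  have xs: "x \<in> supported_on (paths G)" using x I by blast
  note tk = tip_in_keys[OF x(2) xs] keys_upto_tip[OF x(2) xs]
  let ?a = "Poly_Mapping.lookup x ?w"
  let ?y = "x - path_smult ?a (of_path ?w)"
  have "Poly_Mapping.lookup ?y ?w = 0" by (simp add: lookup_minus lookup_smult of_path_def)
  moreover have "?y \<in> supported_on (upto_path ?w)"
    using tk(2) by (intro pv.subspace_diff pv.subspace_scale subspace_supported_on of_path_supported)
      (auto simp: supported_on_def)
  ultimately have y: "?y \<in> supported_on (below ?w)" by (auto simp: supported_on_def in_keys_iff)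
  have "\<exists>n\<in>supported_on (N \<inter> below ?w). of_path q - n \<in> I" if "q \<in> below ?w" for q
  proof -
    from that have q: "path_gt ord ?w q" "q \<in> paths G" by (auto simp: below_def)
    from normal_form_path[OF I(1) red q(2)] obtain n where "n \<in> supported_on (N \<inter> upto_path q)" "of_path q - n \<in> I" by auto
    moreover have "N \<inter> upto_path q \<subseteq> N \<inter> below ?w"
      using below_mono[OF q(1)] q(2) by (auto simp: below_def)
    ultimately show ?thesis unfolding supported_on_def by blast
  qed
  from normal_form_extend[OF I(1) this y] obtain n where n: "n \<in> supported_on (N \<inter> below ?w)" "?y - n \<in> I" by blast
  have "x - (?y - n) \<in> I" by (rule pv.subspace_diff[OF I(1) x(1) n(2)])
  then have "path_smult ?a (of_path ?w) + n \<in> I" by (simp add: algebra_simps)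
  moreover have "path_smult ?a (of_path ?w) + n \<in> supported_on N"
    using n(1) w by (intro pv.subspace_add pv.subspace_scale subspace_supported_on of_path_supported)
      (auto simp: supported_on_def)
  ultimately have "path_smult ?a (of_path ?w) + n = 0" using triv by blast
  moreover have "?w \<notin> Poly_Mapping.keys n" using n(1) not_in_below[of ?w] unfolding supported_on_def by blast
  then have "Poly_Mapping.lookup (path_smult ?a (of_path ?w) + n) ?w = ?a"
    by (simp add: lookup_add lookup_smult of_path_def in_keys_iff)
  ultimately show False using tk(1) by (simp add: in_keys_iff)
qed

section \<open>Tips of ideals\<close>

definition nontips :: "('a, 'b, 'k::field) path_elem set \<Rightarrow> ('a, 'b) path set" where
  "nontips I = paths G - tips ord I"

lemma ideal_sandwich:
  fixes I :: "('a, 'b, 'k::field) path_elem set"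
  assumes "ideal I (path_algebra G)" "x \<in> I" "r \<in> paths G" "s \<in> paths G"
  shows "sandwich G r x s \<in> I"
  using assms unfolding ideal_iff sandwich_def by (simp add: of_path_supported)

lemma tips_in_paths: "I \<subseteq> supported_on (paths G) \<Longrightarrow> tips ord I \<subseteq> paths G"
  using tip_in_keys by (fastforce simp: tips_def supported_on_def)

lemma tips_subpath_closed:
  fixes I :: "('a, 'b, 'k::field) path_elem set"
  assumes I: "ideal I (path_algebra G)" and p: "p \<in> tips ord I" and q: "subpath G p q"
  shows "q \<in> tips ord I"
proof -
  from p obtain x where x: "x \<in> I" "x \<noteq> 0" "p = tip ord x" by (auto simp: tips_def)
  have xs: "x \<in> supported_on (paths G)" using I x by (auto simp: ideal_iff)
  from q obtain r s where pf: "path_factor G q r p s" by (auto simp: subpath_def)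
  have "x \<in> supported_on (upto_path p)"
    using keys_upto_tip[OF x(2) xs] x(3) by (simp add: supported_on_def)
  note z = supported_sandwich[OF this pf]
  have qk: "q \<in> Poly_Mapping.keys (sandwich G r x s)"
    using z(2) tip_in_keys[OF x(2) xs] x(3) by (simp add: in_keys_iff)
  have "q \<in> paths G" using subpath_in_paths[OF q] by simp
  then have "tip ord (sandwich G r x s) = q"
    using z(1) qk by (intro tip_eqI) (simp_all add: supported_on_def)
  moreover have "sandwich G r x s \<in> I"
    using pf by (intro ideal_sandwich[OF I x(1)]) (auto simp: path_factor_def)
  moreover have "sandwich G r x s \<noteq> 0" using qk by auto
  ultimately show ?thesis unfolding tips_def by blast
qed

lemma ideal_reduces:
  fixes I :: "('a, 'b, 'k::field) path_elem set"
  assumes "ideal I (path_algebra G)"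
  shows "reduces I (nontips I)"
  unfolding reduces_def
proof
  fix p assume "p \<in> paths G - nontips I"
  then have "p \<in> tips ord I" by (simp add: nontips_def)
  then obtain x where x: "x \<in> I" "x \<noteq> 0" "p = tip ord x" by (auto simp: tips_def)
  have xs: "x \<in> supported_on (paths G)" using assms x by (auto simp: ideal_iff)
  show "\<exists>x\<in>I. p \<in> Poly_Mapping.keys x \<and> x \<in> supported_on (upto_path p)"
    using x(1) tip_in_keys[OF x(2) xs] keys_upto_tip[OF x(2) xs] x(3) unfolding supported_on_def by blast
qed

lemma ideal_nontips_trivial:
  fixes I :: "('a, 'b, 'k::field) path_elem set"
  assumes "ideal I (path_algebra G)" "x \<in> I" "x \<in> supported_on (nontips I)"
  shows "x = 0"
proof (rule ccontr)
  assume x: "x \<noteq> 0"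
  have xs: "x \<in> supported_on (paths G)" using assms by (auto simp: ideal_iff)
  have "tip ord x \<in> tips ord I" using x assms(2) unfolding tips_def by blast
  moreover have "tip ord x \<in> nontips I" using tip_in_keys[OF x xs] assms(3) unfolding supported_on_def by blast
  ultimately show False by (simp add: nontips_def)
qed

lemma gb_element_eqI:
  fixes I :: "('a, 'b, 'k::field) path_elem set"
  assumes I: "ideal I (path_algebra G)" and g: "g \<in> I" "of_path p - g \<in> supported_on (nontips I)"
  shows "gb_element G ord I p = g"
  unfolding gb_element_def
proof (rule the_equality)
  show "g \<in> I \<and> Poly_Mapping.keys (of_path p - g) \<subseteq> paths G - tips ord I"
    using g by (simp add: supported_on_def nontips_def)
  fix g' assume "g' \<in> I \<and> Poly_Mapping.keys (of_path p - g') \<subseteq> paths G - tips ord I"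
  then have g': "g' \<in> I" "of_path p - g' \<in> supported_on (nontips I)"
    by (simp_all add: supported_on_def nontips_def)
  have "pv.subspace I" using I by (simp add: ideal_iff)
  then have "g' - g \<in> I" using g(1) g'(1) by (intro pv.subspace_diff)
  moreover have "(of_path p - g) - (of_path p - g') \<in> supported_on (nontips I)"
    by (intro pv.subspace_diff subspace_supported_on g(2) g'(2))
  then have "g' - g \<in> supported_on (nontips I)" by simp
  ultimately show "g' = g" using ideal_nontips_trivial[OF I, of "g' - g"] by simp
qed

lemma sandwich_trivial_paths:
  "sandwich G (origin p, []) (of_path p :: ('a, 'b, 'k::comm_ring_1) path_elem) (terminus G p, []) = of_path p"
  by (cases p) (simp add: sandwich_def path_mult_of_path composable_def origin_append terminus_append origin_def path_append_def)

text \<open>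
  The Groebner basis element at \<open>p\<close> is \<open>p\<close> minus its normal form.  Enclosing \<open>p - n\<close> between the
  trivial paths at the ends of \<open>p\<close> gives another such element of the ideal, whose tail is parallel to
  \<open>p\<close>; by uniqueness it is the same.
\<close>

lemma gb_element_props:
  fixes I :: "('a, 'b, 'k::field) path_elem set"
  assumes I: "ideal I (path_algebra G)" and p: "p \<in> tips ord I"
  shows "gb_element G ord I p \<in> I"
    and "of_path p - gb_element G ord I p \<in> supported_on {n \<in> nontips I \<inter> below p. parallel G n p}"
proof -
  have sub: "pv.subspace I" "I \<subseteq> supported_on (paths G)" using I by (simp_all add: ideal_iff)
  have pp: "p \<in> paths G" using tips_in_paths[OF sub(2)] p by blast
  from normal_form_path[OF sub(1) ideal_reduces[OF I] pp]
  obtain n where n: "n \<in> supported_on (nontips I \<inter> upto_path p)" "of_path p - n \<in> I" by blast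
  let ?s = "\<lambda>x. sandwich G (origin p, []) x (terminus G p, [])"
  have "?s (of_path p - n) \<in> I"
    using n(2) by (intro ideal_sandwich[OF I] trivial_path origin_in_verts terminus_in_verts pp)
  then have s: "of_path p - ?s n \<in> I" by (simp add: sandwich_linear sandwich_trivial_paths)
  have "k \<in> nontips I \<inter> below p \<and> parallel G k p" if "k \<in> Poly_Mapping.keys (?s n)" for k
  proof -
    from keys_sandwich[OF that] obtain q where q: "q \<in> Poly_Mapping.keys n" "composable G (origin p, []) q"
      "composable G q (terminus G p, [])" "k = path_append (path_append (origin p, []) q) (terminus G p, [])" by blast
    have "k = q" using q(2) by (intro path_eqI) (auto simp: q(4) path_append_def composable_def origin_def)
    moreover have "parallel G q p" using q(2,3) by (simp add: parallel_def composable_def origin_def)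
    moreover have "q \<in> nontips I \<inter> upto_path p" using n(1) q(1) unfolding supported_on_def by blast
    moreover have "p \<notin> nontips I" using p by (simp add: nontips_def)
    ultimately show ?thesis by blast
  qed
  then have t: "?s n \<in> supported_on {n \<in> nontips I \<inter> below p. parallel G n p}"
    unfolding supported_on_def by blast
  then have "?s n \<in> supported_on (nontips I)" unfolding supported_on_def by blast
  then have "gb_element G ord I p = of_path p - ?s n" using s by (intro gb_element_eqI[OF I]) simp_all
  with s t show "gb_element G ord I p \<in> I"
    "of_path p - gb_element G ord I p \<in> supported_on {n \<in> nontips I \<inter> below p. parallel G n p}" by simp_all
qed

lemma path_ideal_eq_iff:
  assumes "S \<subseteq> paths G" "U \<subseteq> paths G"
  shows "(path_ideal G S :: ('a, 'b, 'k::field) path_elem set) = path_ideal G U \<longleftrightarrow> above S = above U"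
proof
  assume *: "(path_ideal G S :: ('a, 'b, 'k) path_elem set) = path_ideal G U"
  have "p \<in> A \<longleftrightarrow> of_path p \<in> (supported_on A :: ('a, 'b, 'k) path_elem set)" for p :: "('a, 'b) path" and A
    by (simp add: supported_on_def)
  then have "p \<in> above S \<longleftrightarrow> p \<in> above U" for p
    using *[unfolded path_ideal_eq[OF assms(1)] path_ideal_eq[OF assms(2)]] by simp
  then show "above S = above U" by blast
qed (simp add: path_ideal_eq assms)

lemma subset_above: "S \<subseteq> paths G \<Longrightarrow> S \<subseteq> above S"
  using subpath_refl unfolding above_def by blast

lemma above_subpath_closed: "p \<in> above U \<Longrightarrow> subpath G p q \<Longrightarrow> q \<in> above U"
  using subpath_trans[of _ p q] subpath_in_paths[of p q] by (auto simp: above_def)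

text \<open>
  Every path above \<open>U\<close> has a minimal subpath above \<open>U\<close>, since lengths decrease, and a minimal path is
  contained in each set that generates the same monomial ideal.
\<close>

lemma minimal_generators:
  fixes U :: "('a, 'b) path set"
  defines "M \<equiv> {p \<in> above U. \<forall>q\<in>above U. subpath G q p \<longrightarrow> q = p}"
  assumes U: "U \<subseteq> paths G"
  shows "above M = above U" and "S \<subseteq> paths G \<and> above S = above U \<and> (\<forall>S'. S' \<subset> S \<longrightarrow> above S' \<noteq> above U) \<longleftrightarrow> S = M"
proof -
  have MU: "M \<subseteq> above U" by (auto simp: M_def)
  have Up: "above S \<subseteq> paths G" for S by (auto simp: above_def)
  have min: "\<exists>q\<in>M. subpath G q p" if "p \<in> above U" for p
    using that
  proof (induction "path_length p" arbitrary: p rule: less_induct)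
    case less
    show ?case
    proof (cases "p \<in> M")
      case True
      moreover have "subpath G p p" using less.prems Up by (intro subpath_refl) blast
      ultimately show ?thesis by blast
    next
      case False
      then obtain q where q: "q \<in> above U" "subpath G q p" "q \<noteq> p" using less.prems unfolding M_def by blast
      have "path_length q < path_length p" using subpath_eq[OF q(2)] q(3) by linarith
      from less.hyps[OF this q(1)] obtain u where "u \<in> M" "subpath G u q" by blast
      then show ?thesis using subpath_trans[OF _ q(2)] by blast
    qed
  qed
  show aM: "above M = above U"
  proof (intro subset_antisym subsetI)
    fix p assume "p \<in> above M"
    then obtain q where "q \<in> M" "subpath G q p" unfolding above_def by blast
    then show "p \<in> above U" using MU above_subpath_closed[of q U p] by blast
  next
    fix p assume p: "p \<in> above U"
    with min obtain q where "q \<in> M" "subpath G q p" by blast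
    with p Up show "p \<in> above M" unfolding above_def by blast
  qed
  have gen: "M \<subseteq> S" if S: "S \<subseteq> paths G" "above S = above U" for S
  proof
    fix p assume p: "p \<in> M"
    then have "p \<in> above S" using MU S by blast
    then obtain q where q: "q \<in> S" "subpath G q p" by (auto simp: above_def)
    then have "q \<in> above U" using subset_above[OF S(1)] S(2) by blast
    then have "q = p" using p q(2) by (auto simp: M_def)
    then show "p \<in> S" using q by simp
  qed
  show "S \<subseteq> paths G \<and> above S = above U \<and> (\<forall>S'. S' \<subset> S \<longrightarrow> above S' \<noteq> above U) \<longleftrightarrow> S = M"
  proof
    assume "S \<subseteq> paths G \<and> above S = above U \<and> (\<forall>S'. S' \<subset> S \<longrightarrow> above S' \<noteq> above U)"
    then show "S = M" using gen aM by blast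
  next
    assume S: "S = M"
    have "M \<subseteq> paths G" using MU Up by blast
    moreover have "above S' \<noteq> above U" if "S' \<subset> M" for S'
      using gen[of S'] that \<open>M \<subseteq> paths G\<close> by blast
    ultimately show "S \<subseteq> paths G \<and> above S = above U \<and> (\<forall>S'. S' \<subset> S \<longrightarrow> above S' \<noteq> above U)"
      using S aM by blast
  qed
qed

lemma min_tips_eq:
  fixes I :: "('a, 'b, 'k::field) path_elem set"
  assumes I: "ideal I (path_algebra G)"
  shows "min_tips G ord I = {p \<in> tips ord I. \<forall>q\<in>tips ord I. subpath G q p \<longrightarrow> q = p}"
    and "above (min_tips G ord I) = tips ord I"
proof -
  have U: "tips ord I \<subseteq> paths G" using I by (intro tips_in_paths) (simp add: ideal_iff)
  have aU: "above (tips ord I) = tips ord I"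
    using subset_above[OF U] tips_subpath_closed[OF I] unfolding above_def by blast
  let ?M = "{p \<in> tips ord I. \<forall>q\<in>tips ord I. subpath G q p \<longrightarrow> q = p}"
  note mg = minimal_generators[OF U, unfolded aU]
  have "(S \<subseteq> paths G \<and> (path_ideal G S :: ('a, 'b, 'k) path_elem set) = path_ideal G (tips ord I) \<and>
    (\<forall>S'. S' \<subset> S \<longrightarrow> (path_ideal G S' :: ('a, 'b, 'k) path_elem set) \<noteq> path_ideal G (tips ord I))) \<longleftrightarrow> S = ?M" for S
  proof -
    have "(S \<subseteq> paths G \<and> (path_ideal G S :: ('a, 'b, 'k) path_elem set) = path_ideal G (tips ord I) \<and>
    (\<forall>S'. S' \<subset> S \<longrightarrow> (path_ideal G S' :: ('a, 'b, 'k) path_elem set) \<noteq> path_ideal G (tips ord I))) \<longleftrightarrow>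
      S \<subseteq> paths G \<and> above S = tips ord I \<and> (\<forall>S'. S' \<subset> S \<longrightarrow> above S' \<noteq> tips ord I)"
    proof (cases "S \<subseteq> paths G")
      case True
      have "(path_ideal G S' :: ('a, 'b, 'k) path_elem set) = path_ideal G (tips ord I) \<longleftrightarrow> above S' = tips ord I"
        if "S' \<subseteq> S" for S'
        using path_ideal_eq_iff[OF _ U, of S'] that True unfolding aU by blast
      then show ?thesis by (simp add: psubset_imp_subset)
    qed simp
    then show ?thesis using mg(2) by simp
  qed
  then show *: "min_tips G ord I = ?M" by (simp add: min_tips_def)
  then show "above (min_tips G ord I) = tips ord I" using mg(1) by simp
qed

lemma min_tips_of_antichain:
  fixes I :: "('a, 'b, 'k::field) path_elem set"
  assumes I: "ideal I (path_algebra G)" and T: "T \<subseteq> paths G" "above T = tips ord I"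
    and anti: "\<And>t u. t \<in> T \<Longrightarrow> u \<in> T \<Longrightarrow> subpath G t u \<Longrightarrow> t = u"
  shows "min_tips G ord I = T"
proof -
  have sub: "T \<subseteq> tips ord I" using subset_above[OF T(1)] T(2) by simp
  have min: "q = t" if t: "t \<in> T" "q \<in> tips ord I" "subpath G q t" for q t
  proof -
    obtain u where u: "u \<in> T" "subpath G u q" using t(2) unfolding T(2)[symmetric] by (auto simp: above_def)
    have "u = t" by (rule anti[OF u(1) t(1) subpath_trans[OF u(2) t(3)]])
    with subpath_length[OF u(2)] show ?thesis by (intro subpath_eq[OF t(3)]) simp
  qed
  show ?thesis
    unfolding min_tips_eq(1)[OF I]
  proof (intro subset_antisym subsetI CollectI conjI ballI impI)
    fix p assume p: "p \<in> {p \<in> tips ord I. \<forall>q\<in>tips ord I. subpath G q p \<longrightarrow> q = p}"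
    then have "p \<in> above T" using T(2) by simp
    then obtain t where t: "t \<in> T" "subpath G t p" by (auto simp: above_def)
    with p sub have "t = p" by blast
    with t show "p \<in> T" by simp
  qed (use sub min in blast)+
qed

lemma tips_reduced_groebner_basis:
  fixes I :: "('a, 'b, 'k::field) path_elem set"
  assumes I: "ideal I (path_algebra G)"
  shows "tips ord (reduced_groebner_basis G ord I) = min_tips G ord I"
proof -
  have *: "tip ord (gb_element G ord I t) = t \<and> gb_element G ord I t \<noteq> 0" if "t \<in> min_tips G ord I" for t
  proof -
    have t: "t \<in> tips ord I" using that unfolding min_tips_eq(1)[OF I] by simp
    have tp: "t \<in> paths G" using I t tips_in_paths[of I] by (auto simp: ideal_iff)
    let ?g = "gb_element G ord I t"
    have n: "of_path t - ?g \<in> supported_on (below t)"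
      using gb_element_props(2)[OF I t] unfolding supported_on_def by blast
    have "t \<notin> Poly_Mapping.keys (of_path t - ?g)"
      using n not_in_below[of t] unfolding supported_on_def by blast
    then have tk: "t \<in> Poly_Mapping.keys ?g" by (simp add: in_keys_iff lookup_minus of_path_def)
    from n have "of_path t - ?g \<in> supported_on (upto_path t)" unfolding supported_on_def by blast
    from pv.subspace_diff[OF subspace_supported_on of_path_supported[OF insertI1] this]
    have "?g \<in> supported_on (upto_path t)" by simp
    then have "tip ord ?g = t" using tip_eqI[OF tk _ tp] by (simp add: supported_on_def)
    with tk show ?thesis by auto
  qed
  show ?thesis
  proof (intro subset_antisym subsetI)
    fix p assume "p \<in> tips ord (reduced_groebner_basis G ord I)"
    then show "p \<in> min_tips G ord I"
      unfolding tips_def reduced_groebner_basis_def using * by auto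
  next
    fix t assume t: "t \<in> min_tips G ord I"
    then have "gb_element G ord I t \<in> reduced_groebner_basis G ord I"
      by (simp add: reduced_groebner_basis_def)
    with *[OF t] show "t \<in> tips ord (reduced_groebner_basis G ord I)"
      unfolding tips_def by (intro CollectI exI[of _ "gb_element G ord I t"]) simp
  qed
qed

end

section \<open>The diamond lemma\<close>

text \<open>
  A family of relations \<open>t = (combination of smaller paths parallel to t)\<close> whose left-hand sides do
  not divide each other.  The coefficient field is arbitrary, so that the family may be generic or
  specialised.
\<close>

locale reduction_system = ordered_quiver G ord
  for G :: "('a, 'b) pre_digraph" and ord +
  fixes T :: "('a, 'b) path set" and g :: "('a, 'b) path \<Rightarrow> ('a, 'b, 'k::field) path_elem"
  assumes T_paths: "T \<subseteq> paths G"
    and antichain: "\<And>t u. t \<in> T \<Longrightarrow> u \<in> T \<Longrightarrow> subpath G t u \<Longrightarrow> t = u"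
    and tail: "\<And>t. t \<in> T \<Longrightarrow> of_path t - g t \<in> supported_on {n \<in> below t. parallel G n t}"
begin

text \<open>
  The multiples of the relations, sorted by leading path; \<open>W\<close> restricts the leading paths that are used.
  Spans over \<open>below w\<close> record that an element can be rewritten to zero strictly under \<open>w\<close>.
\<close>

definition rewriters :: "('a, 'b) path set \<Rightarrow> ('a, 'b, 'k) path_elem set" where
  "rewriters W = {sandwich G r (g t) s |r t s w. t \<in> T \<and> w \<in> W \<and> path_factor G w r t s}"

abbreviation "rewrite_span W \<equiv> pv.span (rewriters W)"

lemma rewritersI: "t \<in> T \<Longrightarrow> w \<in> W \<Longrightarrow> path_factor G w r t s \<Longrightarrow> sandwich G r (g t) s \<in> rewriters W"
  unfolding rewriters_def by blast

lemma rewriters_mono: "V \<subseteq> W \<Longrightarrow> rewriters V \<subseteq> rewriters W"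
  unfolding rewriters_def by blast

lemma rewrite_span_mono: "V \<subseteq> W \<Longrightarrow> rewrite_span V \<subseteq> rewrite_span W"
  by (intro pv.span_mono rewriters_mono)

lemma g_supported: "t \<in> T \<Longrightarrow> g t \<in> supported_on {n \<in> upto_path t. parallel G n t}"
proof -
  assume t: "t \<in> T"
  have "of_path t - g t \<in> supported_on {n \<in> upto_path t. parallel G n t}"
    using tail[OF t] unfolding supported_on_def by blast
  from pv.subspace_diff[OF subspace_supported_on of_path_supported this, of t] show ?thesis
    by (simp add: parallel_def)
qed

lemma g_lookup: "t \<in> T \<Longrightarrow> Poly_Mapping.lookup (g t) t = 1"
proof -
  assume t: "t \<in> T"
  have "t \<notin> Poly_Mapping.keys (of_path t - g t)"
    using tail[OF t] not_in_below[of t] unfolding supported_on_def by blast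
  then show ?thesis by (simp add: in_keys_iff lookup_minus of_path_def)
qed

lemma g_upto: "t \<in> T \<Longrightarrow> g t \<in> supported_on (upto_path t)"
  using g_supported[of t] unfolding supported_on_def by blast

lemma g_tip: "t \<in> T \<Longrightarrow> tip ord (g t) = t"
  using g_upto[of t] g_lookup[of t] T_paths by (intro tip_eqI) (auto simp: supported_on_def in_keys_iff)

lemma g_paths: "t \<in> T \<Longrightarrow> g t \<in> supported_on (paths G)"
  using g_upto[of t] T_paths unfolding supported_on_def below_def by blast

text \<open>
  The terms of \<open>g t\<close> are parallel to \<open>t\<close>, so they are composable with the same paths.
\<close>

lemma sandwich_g_zero:
  assumes "t \<in> T" "\<not> (composable G r t \<and> composable G t s)"
  shows "sandwich G r (g t) s = 0"
proof (rule ccontr)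
  assume "sandwich G r (g t) s \<noteq> 0"
  then have "Poly_Mapping.keys (sandwich G r (g t) s) \<noteq> {}" by simp
  then obtain k where "k \<in> Poly_Mapping.keys (sandwich G r (g t) s)" by blast
  from keys_sandwich[OF this] obtain q where q: "q \<in> Poly_Mapping.keys (g t)" "composable G r q" "composable G q s"
    by blast
  then have "parallel G q t" using g_supported[OF assms(1)] unfolding supported_on_def by blast
  with q assms(2) show False by (simp add: parallel_def composable_def)
qed

lemma genideal_eq_rewrite_span: "genideal (path_algebra G) (g ` T) = rewrite_span (paths G)"
proof -
  have "g ` T \<subseteq> supported_on (paths G)" using g_paths by blast
  note genideal_eq_span[OF this]
  also have "pv.span (sandwiches (g ` T)) = rewrite_span (paths G)"
  proof (intro subset_antisym pv.span_minimal pv.subspace_span subsetI)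
    fix x assume "x \<in> sandwiches (g ` T)"
    then obtain r t s where *: "r \<in> paths G" "t \<in> T" "s \<in> paths G" "x = sandwich G r (g t) s"
      unfolding sandwiches_def sandwich_def by blast
    show "x \<in> rewrite_span (paths G)"
    proof (cases "composable G r t \<and> composable G t s")
      case True
      then have "path_factor G (path_append (path_append r t) s) r t s"
        using * T_paths by (auto simp: path_factor_def)
      moreover from subpath_in_paths[OF subpathI[OF this]]
      have "path_append (path_append r t) s \<in> paths G" by simp
      ultimately show ?thesis unfolding *(4) by (intro pv.span_base rewritersI) (use * in auto)
    next
      case False
      then show ?thesis using sandwich_g_zero[OF *(2)] *(4) by (simp add: pv.span_zero)
    qed
  next
    fix x assume "x \<in> rewriters (paths G)"
    then obtain r t s w where *: "t \<in> T" "path_factor G w r t s" "x = sandwich G r (g t) s"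
      unfolding rewriters_def by blast
    then show "x \<in> pv.span (sandwiches (g ` T))"
      unfolding *(3) sandwich_def by (intro pv.span_base sandwichesI) (auto simp: path_factor_def)
  qed
  finally show ?thesis .
qed

lemma rewrite_span_supported:
  assumes "W \<subseteq> paths G" "\<And>w v. w \<in> W \<Longrightarrow> v \<in> below w \<Longrightarrow> v \<in> W"
  shows "rewrite_span W \<subseteq> supported_on W"
proof (rule pv.span_minimal[OF _ subspace_supported_on])
  show "rewriters W \<subseteq> supported_on W"
  proof
    fix x assume "x \<in> rewriters W"
    then obtain r t s w where *: "t \<in> T" "w \<in> W" "path_factor G w r t s" "x = sandwich G r (g t) s"
      unfolding rewriters_def by blast
    have "upto_path w \<subseteq> W" using *(2) assms(2) by blast
    with supported_sandwich(1)[OF g_upto[OF *(1)] *(3)] show "x \<in> supported_on W"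
      unfolding *(4) supported_on_def by blast
  qed
qed

lemma rewrite_span_sandwich:
  assumes x: "x \<in> rewrite_span (below w)" and a: "path_factor G v a w c"
  shows "sandwich G a x c \<in> rewrite_span (below v)"
proof (rule span_map[OF _ _ _ x])
  fix b assume "b \<in> rewriters (below w)"
  then obtain r t s u where *: "t \<in> T" "u \<in> below w" "path_factor G u r t s" "b = sandwich G r (g t) s"
    unfolding rewriters_def by blast
  have ac: "a \<in> paths G" "w \<in> paths G" "c \<in> paths G" "composable G a w" "composable G w c"
    "v = path_append (path_append a w) c"
    using a by (auto simp: path_factor_def)
  have rs: "r \<in> paths G" "t \<in> paths G" "s \<in> paths G" "composable G r t" "composable G t s"
    "u = path_append (path_append r t) s"
    using *(3) by (auto simp: path_factor_def)
  have u: "u \<in> paths G" "path_gt ord w u" using *(2) by (auto simp: below_def)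
  show "sandwich G a b c \<in> rewrite_span (below v)"
  proof (cases "composable G a r \<and> composable G s c")
    case True
    then have au: "composable G a u" "composable G u c"
      using rs by (simp_all add: path_simps)
    have "path_gt ord v (path_append (path_append a u) c)"
      unfolding ac(6) by (rule path_gt_sandwich) (use u ac au in auto)
    moreover have "path_append (path_append a u) c \<in> paths G"
      by (intro append_in_paths) (use ac u au in \<open>auto simp: composable_append_left\<close>)
    ultimately have "path_append (path_append a u) c \<in> below v" by (simp add: below_def)
    moreover have "path_factor G (path_append (path_append a u) c) (path_append a r) t (path_append s c)"
      using True ac rs by (auto simp: path_factor_def path_simps append_in_paths)
    ultimately show ?thesis
      using *(1) True unfolding *(4) sandwich_sandwich by (auto intro: pv.span_base rewritersI)
  next
    case False
    then show ?thesis unfolding *(4) sandwich_sandwich by (auto simp: pv.span_zero)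
  qed
qed (simp_all add: sandwich_linear)

lemma path_prefix_eq:
  assumes "path_append p q = path_append p' q'" "path_length p = path_length p'"
  shows "p = p'" "snd q = snd q'"
  using assms by (auto simp: path_append_def path_length_def prod_eq_iff)

text \<open>
  Subtracting and adding \<open>r * g t * b * g u * s\<close> turns the difference into
  \<open>r * g t * b * (u - g u) * s - r * (t - g t) * b * g u * s\<close>, where the bracketed tails are
  combinations of smaller paths.
\<close>

lemma disjoint_resolvable:
  assumes t: "t \<in> T" "u \<in> T" and pf: "path_factor G w r t (path_append b (path_append u s))"
    "path_factor G w (path_append (path_append r t) b) u s" and b: "b \<in> paths G" "composable G t b" "composable G b u"
  shows "sandwich G r (g t) (path_append b (path_append u s)) - sandwich G (path_append (path_append r t) b) (g u) s
    \<in> rewrite_span (below w)"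
proof -
  have P: "r \<in> paths G" "t \<in> paths G" "u \<in> paths G" "s \<in> paths G" "composable G r t" "composable G u s"
    "w = path_append r (path_append t (path_append b (path_append u s)))"
    using pf by (auto simp: path_factor_def path_append_assoc)
  have wp: "w \<in> paths G" using subpath_in_paths[OF subpathI[OF pf(1)]] by simp
  let ?x = "of_path t - g t" and ?y = "of_path u - g u"
  let ?M = "\<lambda>x y. path_mult G (of_path r) (path_mult G x (path_mult G (of_path b) (path_mult G y (of_path s))))"
  have 1: "?M (g t) ?y \<in> rewrite_span (below w)"
  proof (rule span_map[where B = "of_path ` {n \<in> below u. parallel G n u}" and f = "?M (g t)"])
    fix z assume "z \<in> (of_path ` {n \<in> below u. parallel G n u} :: ('a, 'b, 'k) path_elem set)"
    then obtain n where n: "n \<in> below u" "parallel G n u" "z = of_path n" by blast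
    have n': "n \<in> paths G" "path_gt ord u n" "composable G b n" "composable G n s"
      using n b P by (auto simp: below_def parallel_def composable_def)
    let ?v = "path_append (path_append (path_append (path_append r t) b) n) s"
    have "path_gt ord (path_append (path_append (path_append (path_append r t) b) u) s) ?v"
      by (rule path_gt_sandwich) (use n' P b in \<open>auto intro!: append_in_paths simp: path_simps\<close>)
    then have "path_gt ord w ?v" by (simp add: P(7) path_append_assoc)
    moreover have "?v \<in> paths G"
      by (intro append_in_paths) (use n' P b in \<open>auto simp: path_simps\<close>)
    moreover have "path_factor G ?v r t (path_append b (path_append n s))"
      using n' P b by (auto simp: path_factor_def path_simps append_in_paths)
    moreover have "?M (g t) z = sandwich G r (g t) (path_append b (path_append n s))"
      using n' b by (simp add: sandwich_def n(3) path_mult_of_path composable_append_right path_mult_assoc)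
    ultimately show "?M (g t) z \<in> rewrite_span (below w)"
      using t(1) by (auto simp: below_def intro!: pv.span_base rewritersI)
  next
    show "?y \<in> pv.span (of_path ` {n \<in> below u. parallel G n u})"
      using tail[OF t(2)] by (simp add: supported_on_eq_span)
  qed (simp_all add: path_mult_add_left path_mult_add_right path_mult_smult_left path_mult_smult_right)
  have 2: "?M ?x (g u) \<in> rewrite_span (below w)"
  proof (rule span_map[where B = "of_path ` {n \<in> below t. parallel G n t}" and f = "\<lambda>x. ?M x (g u)"])
    fix z assume "z \<in> (of_path ` {n \<in> below t. parallel G n t} :: ('a, 'b, 'k) path_elem set)"
    then obtain n where n: "n \<in> below t" "parallel G n t" "z = of_path n" by blast
    have n': "n \<in> paths G" "path_gt ord t n" "composable G r n" "composable G n b"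
      using n b P by (auto simp: below_def parallel_def composable_def)
    let ?c = "path_append b (path_append u s)"
    let ?v = "path_append (path_append r n) ?c"
    have "path_gt ord (path_append (path_append r t) ?c) ?v"
      by (rule path_gt_sandwich) (use n' P b in \<open>auto intro!: append_in_paths simp: path_simps\<close>)
    then have "path_gt ord w ?v" by (simp add: P(7) path_append_assoc)
    moreover have "?v \<in> paths G"
      by (intro append_in_paths) (use n' P b in \<open>auto simp: path_simps\<close>)
    moreover have "path_factor G ?v (path_append (path_append r n) b) u s"
      using n' P b by (auto simp: path_factor_def path_simps append_in_paths)
    moreover have "?M z (g u) = sandwich G (path_append (path_append r n) b) (g u) s"
    proof -
      have "of_path (path_append (path_append r n) b) =
        path_mult G (of_path r) (path_mult G (of_path n) (of_path b :: ('a, 'b, 'k) path_elem))"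
        using n' by (simp add: path_mult_of_path composable_append_right path_append_assoc)
      then show ?thesis by (simp only: sandwich_def n(3) path_mult_assoc)
    qed
    ultimately show "?M z (g u) \<in> rewrite_span (below w)"
      using t(2) by (auto simp: below_def intro!: pv.span_base rewritersI)
  next
    show "?x \<in> pv.span (of_path ` {n \<in> below t. parallel G n t})"
      using tail[OF t(1)] by (simp add: supported_on_eq_span)
  qed (simp_all add: path_mult_add_left path_mult_add_right path_mult_smult_left path_mult_smult_right)
  have "sandwich G r (g t) (path_append b (path_append u s)) = ?M (g t) (of_path u)"
    using b P by (simp add: sandwich_def path_mult_of_path composable_append_right path_mult_assoc)
  moreover have "sandwich G (path_append (path_append r t) b) (g u) s = ?M (of_path t) (g u)"
  proof -
    have "of_path (path_append (path_append r t) b) =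
        path_mult G (of_path r) (path_mult G (of_path t) (of_path b :: ('a, 'b, 'k) path_elem))"
      using b P by (simp add: path_mult_of_path composable_append_right path_append_assoc)
    then show ?thesis by (simp only: sandwich_def path_mult_assoc)
  qed
  moreover have "?M (g t) (of_path u) - ?M (of_path t) (g u) = ?M (g t) ?y - ?M ?x (g u)"
    by (simp add: path_mult_diff_left path_mult_diff_right)
  ultimately show ?thesis using pv.span_diff[OF 1 2] by simp
qed

text \<open>
  The S-polynomial condition for proper overlaps \<open>t p = q u\<close>, expressed without choosing reductions.
\<close>

definition overlaps_resolvable :: bool where
  "overlaps_resolvable \<longleftrightarrow> (\<forall>t\<in>T. \<forall>u\<in>T. \<forall>p\<in>paths G. \<forall>q\<in>paths G.
     composable G t p \<longrightarrow> composable G q u \<longrightarrow> path_append t p = path_append q u \<longrightarrow>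
     1 \<le> path_length q \<longrightarrow> 1 \<le> path_length p \<longrightarrow> path_length p < path_length u \<longrightarrow>
     path_mult G (g t) (of_path p) - path_mult G (of_path q) (g u) \<in> rewrite_span (below (path_append t p)))"

text \<open>
  Let \<open>q\<close> be the piece of \<open>w\<close> between the starting points of the two occurrences.  If \<open>q\<close> contains \<open>t\<close>,
  the occurrences are disjoint; if \<open>u\<close> ends inside \<open>t\<close>, the antichain condition makes them equal;
  otherwise they overlap properly, because an empty \<open>q\<close> would make \<open>t\<close> a proper prefix of \<open>u\<close>.
\<close>

lemma ordered_occurrences_resolvable:
  assumes res: overlaps_resolvable and tu: "t \<in> T" "u \<in> T"
    and pf: "path_factor G w r t s" "path_factor G w r' u s'" and le: "path_length r \<le> path_length r'"
  shows "sandwich G r (g t) s - sandwich G r' (g u) s' \<in> rewrite_span (below w)"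
proof -
  have P: "r \<in> paths G" "t \<in> paths G" "s \<in> paths G" "composable G r t" "composable G t s"
    "w = path_append r (path_append t s)"
    using pf(1) by (auto simp: path_factor_def path_append_assoc)
  have P': "r' \<in> paths G" "u \<in> paths G" "s' \<in> paths G" "composable G r' u" "composable G u s'"
    "w = path_append r' (path_append u s')"
    using pf(2) by (auto simp: path_factor_def path_append_assoc)
  have "path_length r' = path_length r + (path_length r' - path_length r)" using le by simp
  from path_split[OF P'(1) this] obtain r0 q where q: "q \<in> paths G" "composable G r0 q" "r' = path_append r0 q"
    "path_length r0 = path_length r" by blast
  \<comment> \<open>The part of \<open>r'\<close> before \<open>q\<close> has the length of \<open>r\<close>, and both are prefixes of \<open>w\<close>.\<close>
  have w: "path_append r (path_append t s) = path_append r0 (path_append q (path_append u s'))"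
    using P(6) P'(6) q(3) by (simp add: path_append_assoc)
  have r0: "r0 = r" using path_prefix_eq(1)[OF w q(4)[symmetric]] by simp
  have qr: "composable G r q" "r' = path_append r q" using q r0 by simp_all
  have qu: "composable G q u" using P'(4) qr by (simp add: composable_append_left)
  have org: "origin q = origin t" using qr(1) P(4) by (simp add: composable_def)
  have ts: "path_append t s = path_append q (path_append u s')"
    using path_prefix_eq(2)[OF w q(4)[symmetric]] org by (intro path_eqI) (simp_all add: origin_append)
  consider (disjoint) "path_length t \<le> path_length q" |
    (inside) "path_length q < path_length t" "path_length q + path_length u \<le> path_length t" |
    (overlap) "path_length q < path_length t" "path_length t < path_length q + path_length u"
    by linarith
  then show ?thesis
  proof cases
    case disjoint
    then have "path_length q = path_length t + (path_length q - path_length t)" by simp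
    from path_split[OF q(1) this] obtain t0 b where b: "b \<in> paths G" "composable G t0 b" "q = path_append t0 b"
      "path_length t0 = path_length t" by blast
    have e: "path_append t s = path_append t0 (path_append b (path_append u s'))"
      using ts b(3) by (simp add: path_append_assoc)
    have t0: "t0 = t" using path_prefix_eq(1)[OF e b(4)[symmetric]] by simp
    have bt: "composable G t b" using b t0 by simp
    have bu: "composable G b u" using qu b(3) bt t0 by (simp add: composable_append_left)
    have s: "s = path_append b (path_append u s')"
      using path_prefix_eq(2)[OF e b(4)[symmetric]] P(5) bt
      by (intro path_eqI) (simp_all add: origin_append composable_def)
    have r': "r' = path_append (path_append r t) b" using qr b(3) t0 by (simp add: path_append_assoc)
    show ?thesis
      unfolding s r' by (rule disjoint_resolvable[OF tu pf[unfolded s r'] b(1) bt bu])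
  next
    case inside
    then have "path_length t = (path_length q + path_length u) + (path_length t - (path_length q + path_length u))" by simp
    from path_split[OF P(2) this] obtain a c where c: "a \<in> paths G" "c \<in> paths G" "composable G a c"
      "t = path_append a c" "path_length a = path_length q + path_length u" by blast
    have e: "path_append a (path_append c s) = path_append (path_append q u) s'"
      using ts c(4) by (simp add: path_append_assoc)
    have a: "a = path_append q u" using path_prefix_eq(1)[OF e] c(5) by (simp add: path_length_append)
    have "path_factor G t q u c"
      using c a q(1) P'(2) qu by (auto simp: path_factor_def composable_append_left)
    then have ut: "u = t" using antichain[OF tu(2,1)] subpathI by blast
    then have "path_length q = 0" using inside by simp
    then have "r' = r" using qr(2) by (intro path_eqI) (auto simp: path_append_def path_length_def origin_def)
    moreover have "s' = s"
    proof (rule path_eqI)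
      show "origin s' = origin s" using P(5) P'(5) ut by (simp add: composable_def)
      show "snd s' = snd s"
        using ts ut \<open>path_length q = 0\<close> by (simp add: path_append_def path_length_def)
    qed
    ultimately show ?thesis using ut by (simp add: pv.span_zero)
  next
    case overlap
    let ?l = "path_length q + path_length u - path_length t"
    have "path_length (path_append t s) = path_length (path_append q (path_append u s'))" using ts by simp
    then have "path_length s = ?l + path_length s'" using overlap by (simp add: path_length_append)
    from path_split[OF P(3) this] obtain p s0 where p: "p \<in> paths G" "s0 \<in> paths G" "composable G p s0"
      "s = path_append p s0" "path_length p = ?l" by blast
    have tp: "composable G t p" using P(5) p(4) by (simp add: composable_append_right)
    have e: "path_append (path_append t p) s0 = path_append (path_append q u) s'"
      using ts p(4) by (simp add: path_append_assoc)
    have len: "path_length (path_append t p) = path_length (path_append q u)"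
      using p(5) overlap by (simp add: path_length_append)
    have eq: "path_append t p = path_append q u" using path_prefix_eq(1)[OF e len] .
    have s0: "s0 = s'"
    proof (rule path_eqI)
      have "terminus G p = terminus G u"
        using arg_cong[OF eq, of "terminus G"] tp qu by (simp add: terminus_append)
      then show "origin s0 = origin s'" using p(3) P'(5) by (simp add: composable_def)
      show "snd s0 = snd s'" using path_prefix_eq(2)[OF e len] .
    qed
    have ql: "1 \<le> path_length q"
    proof (rule ccontr)
      assume "\<not> 1 \<le> path_length q"
      then have q0: "path_length q = 0" by simp
      have "u = path_append t p"
        using eq q0 org qu by (intro path_eqI) (auto simp: path_append_def path_length_def origin_def composable_def terminus_def pre_digraph.awalk_verts_conv)
      moreover have "path_factor G (path_append t p) (origin t, []) t p"
        using P(2) p(1) tp by (auto simp: path_factor_def trivial_path origin_in_verts composable_def)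
          (simp add: path_append_def origin_def)
      ultimately have "t = u" using antichain[OF tu] subpathI by blast
      then show False using overlap q0 by simp
    qed
    have "path_mult G (g t) (of_path p) - path_mult G (of_path q) (g u) \<in> rewrite_span (below (path_append t p))"
      using res tu p(1) q(1) tp qu eq ql p(5) overlap unfolding overlaps_resolvable_def by auto
    moreover have "path_factor G w r (path_append t p) s'"
      using P p s0 tp append_in_paths[OF P(2) p(1) tp]
      by (auto simp: path_factor_def path_simps)
    ultimately have "sandwich G r (path_mult G (g t) (of_path p) - path_mult G (of_path q) (g u)) s' \<in> rewrite_span (below w)"
      by (rule rewrite_span_sandwich)
    moreover have "sandwich G r (path_mult G (g t) (of_path p)) s' = sandwich G r (g t) s"
      using p(3,4) s0 by (simp add: sandwich_def path_mult_assoc path_mult_of_path)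
    moreover have "sandwich G r (path_mult G (of_path q) (g u)) s' = sandwich G r' (g u) s'"
      using qr by (simp add: sandwich_def path_mult_of_path flip: path_mult_assoc)
    ultimately show ?thesis by (simp add: sandwich_linear)
  qed
qed

lemma occurrences_resolvable:
  assumes overlaps_resolvable "t \<in> T" "u \<in> T" "path_factor G w r t s" "path_factor G w r' u s'"
  shows "sandwich G r (g t) s - sandwich G r' (g u) s' \<in> rewrite_span (below w)"
proof (cases "path_length r \<le> path_length r'")
  case True
  then show ?thesis using ordered_occurrences_resolvable assms by blast
next
  case False
  then have "sandwich G r' (g u) s' - sandwich G r (g t) s \<in> rewrite_span (below w)"
    using ordered_occurrences_resolvable[OF assms(1,3,2,5,4)] by simp
  from pv.span_neg[OF this] show ?thesis by simp
qed

lemma below_trans: "v \<in> below w \<Longrightarrow> u \<in> below v \<Longrightarrow> u \<in> below w"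
  unfolding below_def using path_gt_trans by blast

lemma rewrite_span_bounded:
  assumes "x \<in> rewrite_span W" "W \<subseteq> paths G"
  shows "x = 0 \<or> (\<exists>w\<in>W. x \<in> rewrite_span (upto_path w))"
  using assms(1)
proof (rule pv.span_induct_alt)
  fix c x y assume x: "x \<in> rewriters W" and y: "y = 0 \<or> (\<exists>w\<in>W. y \<in> rewrite_span (upto_path w))"
  from x obtain r t s v where *: "t \<in> T" "v \<in> W" "path_factor G v r t s" "x = sandwich G r (g t) s"
    unfolding rewriters_def by blast
  have xv: "x \<in> rewrite_span (upto_path v)"
    unfolding *(4) by (rule pv.span_base[OF rewritersI[OF *(1) insertI1 *(3)]])
  show "path_smult c x + y = 0 \<or> (\<exists>w\<in>W. path_smult c x + y \<in> rewrite_span (upto_path w))"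
  proof (cases "y = 0")
    case True
    then have "path_smult c x + y \<in> rewrite_span (upto_path v)" using xv by (simp add: pv.span_scale)
    then show ?thesis using *(2) by blast
  next
    case False
    then obtain w where w: "w \<in> W" "y \<in> rewrite_span (upto_path w)" using y by blast
    have mono: "upto_path a \<subseteq> upto_path b" if "a = b \<or> path_gt ord b a" "a \<in> W" for a b
      using that assms(2) below_mono[of b a] by (auto simp: below_def)
    consider "v = w \<or> path_gt ord w v" | "path_gt ord v w"
      using path_gt_total *(2) w(1) assms(2) by blast
    then have "\<exists>z\<in>{v, w}. upto_path v \<subseteq> upto_path z \<and> upto_path w \<subseteq> upto_path z"
      using mono[of v w] mono[of w v] *(2) w(1) by cases auto
    then obtain z where z: "z \<in> W" "upto_path v \<subseteq> upto_path z" "upto_path w \<subseteq> upto_path z" using *(2) w(1) by blast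
    have "x \<in> rewrite_span (upto_path z)" using xv rewrite_span_mono[OF z(2)] by blast
    moreover have "y \<in> rewrite_span (upto_path z)" using w(2) rewrite_span_mono[OF z(3)] by blast
    ultimately show ?thesis using z(1) pv.span_add[OF pv.span_scale[of x _ c]] by blast
  qed
qed simp

lemma not_normal_iff: "p \<in> paths G \<Longrightarrow> p \<notin> normal_paths G T \<longleftrightarrow> (\<exists>t\<in>T. \<exists>r s. path_factor G p r t s)"
  by (auto simp: normal_paths_def subpath_def)

lemma paths_minus_normal: "paths G - normal_paths G T = above T"
  by (auto simp: normal_paths_def above_def)

text \<open>
  By induction on a bound \<open>w\<close> for the leading paths.  Modulo multiples with smaller leading path
  all multiples of relations with leading path \<open>w\<close> agree.  They are monic at \<open>w\<close>, which is not
  normal, so in a combination supported on normal paths they cancel and a smaller bound suffices.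
\<close>

theorem diamond:
  assumes res: overlaps_resolvable
    and x: "x \<in> rewrite_span (paths G)" "x \<in> supported_on (normal_paths G T)"
  shows "x = 0"
proof -
  have *: "y = 0" if "w \<in> paths G" "y \<in> rewrite_span (upto_path w)" "y \<in> supported_on (normal_paths G T)" for w y
    using that
  proof (induction w arbitrary: y rule: wf_induct_rule[OF wf_path_gt])
    case (1 w)
    have "y \<in> rewrite_span (below w)"
    proof (cases "w \<in> normal_paths G T")
      case True
      then have "rewriters (upto_path w) \<subseteq> rewriters (below w)"
        using not_normal_iff[OF 1(2)] unfolding rewriters_def by blast
      with pv.span_mono 1(3) show ?thesis by blast
    next
      case False
      then obtain t r s where t: "t \<in> T" "path_factor G w r t s" using not_normal_iff[OF 1(2)] by blast
      let ?b = "sandwich G r (g t) s"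
      \<comment> \<open>One chosen multiple with leading path \<open>w\<close> represents all of them modulo smaller ones.\<close>
      have "rewriters (upto_path w) \<subseteq> pv.span (insert ?b (rewriters (below w)))"
      proof
        fix z assume "z \<in> rewriters (upto_path w)"
        then obtain r' u s' v where z: "u \<in> T" "v \<in> upto_path w" "path_factor G v r' u s'" "z = sandwich G r' (g u) s'"
          unfolding rewriters_def by blast
        show "z \<in> pv.span (insert ?b (rewriters (below w)))"
        proof (cases "v = w")
          case True
          then have "z - ?b \<in> rewrite_span (below w)"
            using occurrences_resolvable[OF res z(1) t(1)] z t(2) by blast
          then have "z - ?b \<in> pv.span (insert ?b (rewriters (below w)))"
            using pv.span_mono[of "rewriters (below w)" "insert ?b (rewriters (below w))"] by blast
          from pv.span_add[OF this pv.span_base[of ?b]] show ?thesis by simp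
        next
          case False
          then have "z \<in> rewriters (below w)" using z by (auto intro: rewritersI)
          then show ?thesis by (intro pv.span_base) simp
        qed
      qed
      from pv.span_minimal[OF this pv.subspace_span] 1(3)
      have "y \<in> pv.span (insert ?b (rewriters (below w)))" by blast
      then obtain a where a: "y - path_smult a ?b \<in> rewrite_span (below w)"
        unfolding pv.span_breakdown_eq by blast
      have "rewrite_span (below w) \<subseteq> supported_on (below w)"
        using below_trans by (intro rewrite_span_supported) (auto simp: below_def)
      with a have "w \<notin> Poly_Mapping.keys (y - path_smult a ?b)" using not_in_below[of w] unfolding supported_on_def by blast
      moreover have "w \<notin> Poly_Mapping.keys y" using 1(4) False unfolding supported_on_def by blast
      moreover have "Poly_Mapping.lookup ?b w = 1"
        using supported_sandwich(2)[OF g_upto[OF t(1)] t(2)] g_lookup[OF t(1)] by simp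
      ultimately have "a = 0" by (simp add: in_keys_iff lookup_minus lookup_smult)
      with a show ?thesis by simp
    qed
    moreover have "below w \<subseteq> paths G" by (auto simp: below_def)
    ultimately have "y = 0 \<or> (\<exists>v\<in>below w. y \<in> rewrite_span (upto_path v))" by (rule rewrite_span_bounded)
    then show ?case using 1(1)[OF _ _ _ 1(4)] by (auto simp: below_def)
  qed
  from rewrite_span_bounded[OF x(1)] show ?thesis using *[OF _ _ x(2)] by blast
qed

lemma rewrite_span_reduces: "reduces (rewrite_span (paths G)) (normal_paths G T)"
  unfolding reduces_def
proof
  fix p assume "p \<in> paths G - normal_paths G T"
  then obtain t r s where t: "p \<in> paths G" "t \<in> T" "path_factor G p r t s" using not_normal_iff by blast
  note z = supported_sandwich[OF g_upto[OF t(2)] t(3)]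
  show "\<exists>x\<in>rewrite_span (paths G). p \<in> Poly_Mapping.keys x \<and> x \<in> supported_on (upto_path p)"
    by (rule bexI[OF _ pv.span_base[OF rewritersI[OF t(2,1,3)]]])
      (use z g_lookup[OF t(2)] in \<open>simp add: in_keys_iff\<close>)
qed

lemma tips_genideal:
  assumes overlaps_resolvable
  shows "tips ord (genideal (path_algebra G) (g ` T)) = above T"
proof
  let ?I = "genideal (path_algebra G) (g ` T)"
  have sub: "g ` T \<subseteq> carrier (path_algebra G)" using g_paths by auto
  have I: "ideal ?I (path_algebra G)" by (rule ring.genideal_ideal[OF ring_path_algebra sub])
  have I': "pv.subspace ?I" "?I \<subseteq> supported_on (paths G)" using I by (simp_all add: ideal_iff)
  show "tips ord ?I \<subseteq> above T"
  proof
    fix p assume p: "p \<in> tips ord ?I"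
    then obtain x where x: "x \<in> ?I" "x \<noteq> 0" "p = tip ord x" by (auto simp: tips_def)
    have "p \<notin> normal_paths G T"
      unfolding x(3)
    proof (rule tip_not_normal[OF I' _ _ x(1,2)])
      show "reduces ?I (normal_paths G T)"
        unfolding genideal_eq_rewrite_span by (rule rewrite_span_reduces)
      show "?I \<inter> supported_on (normal_paths G T) \<subseteq> {0}"
        unfolding genideal_eq_rewrite_span using diamond[OF assms] by blast
    qed
    moreover have "p \<in> paths G" using p tips_in_paths[OF I'(2)] by blast
    ultimately show "p \<in> above T" unfolding paths_minus_normal[symmetric] by blast
  qed
  show "above T \<subseteq> tips ord ?I"
  proof
    fix p assume "p \<in> above T"
    then obtain t where t: "t \<in> T" "subpath G t p" by (auto simp: above_def)
    have "g t \<noteq> 0" using g_lookup[OF t(1)] by auto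
    moreover have "g t \<in> ?I" using ring.genideal_self[OF ring_path_algebra sub] t(1) by blast
    ultimately have "t \<in> tips ord ?I" using g_tip[OF t(1)] unfolding tips_def by force
    then show "p \<in> tips ord ?I" by (rule tips_subpath_closed[OF I _ t(2)])
  qed
qed

lemma reduced_groebner_basis_genideal:
  assumes res: overlaps_resolvable and normal: "\<And>t. t \<in> T \<Longrightarrow> of_path t - g t \<in> supported_on (normal_paths G T)"
  shows "reduced_groebner_basis G ord (genideal (path_algebra G) (g ` T)) = g ` T"
    and "min_tips G ord (genideal (path_algebra G) (g ` T)) = T"
proof -
  let ?I = "genideal (path_algebra G) (g ` T)"
  have sub: "g ` T \<subseteq> carrier (path_algebra G)" using g_paths by auto
  have I: "ideal ?I (path_algebra G)" by (rule ring.genideal_ideal[OF ring_path_algebra sub])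
  show M: "min_tips G ord ?I = T"
    using min_tips_of_antichain[OF I T_paths tips_genideal[OF res, symmetric]] antichain by blast
  have "nontips ?I = normal_paths G T"
    unfolding nontips_def tips_genideal[OF res] by (auto simp: above_def normal_paths_def)
  then have "gb_element G ord ?I t = g t" if "t \<in> T" for t
    using ring.genideal_self[OF ring_path_algebra sub] that normal by (intro gb_element_eqI[OF I]) auto
  then show "reduced_groebner_basis G ord ?I = g ` T"
    unfolding reduced_groebner_basis_def M by (intro image_cong) auto
qed

end

lemma path_mult_trivial_left:
  assumes "\<And>k. k \<in> Poly_Mapping.keys f \<Longrightarrow> origin k = v"
  shows "path_mult G (of_path (v, [])) f = f"
proof -
  have "Poly_Mapping.keys f \<subseteq> {k. origin k = v}" using assms by blast
  then show ?thesis
  proof (induction f rule: poly_mapping_induct_on)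
    case (add p a f)
    then have "path_mult G (of_path (v, [])) (Poly_Mapping.single p a) = Poly_Mapping.single p a"
      by (auto simp: of_path_def path_mult_single composable_def terminus_def path_append_def origin_def
        pre_digraph.awalk_verts_conv)
    with add show ?case by (simp add: path_mult_add_right)
  qed simp
qed

lemma path_mult_trivial_right:
  assumes "\<And>k. k \<in> Poly_Mapping.keys f \<Longrightarrow> terminus G k = v"
  shows "path_mult G f (of_path (v, [])) = f"
proof -
  have "Poly_Mapping.keys f \<subseteq> {k. terminus G k = v}" using assms by blast
  then show ?thesis
  proof (induction f rule: poly_mapping_induct_on)
    case (add p a f)
    then have "path_mult G (Poly_Mapping.single p a) (of_path (v, [])) = Poly_Mapping.single p a"
      by (auto simp: of_path_def path_mult_single composable_def path_append_def origin_def)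
    with add show ?case by (simp add: path_mult_add_left)
  qed simp
qed

context reduction_system begin

text \<open>
  The two leading terms both equal the overlap path with coefficient one and cancel.
\<close>

lemma overlap_supported:
  assumes t: "t \<in> T" and u: "u \<in> T" and pq: "p \<in> paths G" "q \<in> paths G" "composable G t p" "composable G q u"
    and eq: "path_append t p = path_append q u"
  shows "path_mult G (g t) (of_path p) - path_mult G (of_path q) (g u) \<in> supported_on (below (path_append t p))"
proof -
  let ?w = "path_append t p"
  have tu: "t \<in> paths G" "u \<in> paths G" using t u T_paths by auto
  have 1: "path_mult G (g t) (of_path p) = sandwich G (origin t, []) (g t) p"
    unfolding sandwich_def
    by (subst path_mult_trivial_left)
      (use g_supported[OF t] in \<open>auto simp: supported_on_def parallel_def\<close>)
  have 2: "path_mult G (of_path q) (g u) = sandwich G q (g u) (terminus G u, [])"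
    unfolding sandwich_def path_mult_assoc
    by (subst path_mult_trivial_right)
      (use g_supported[OF u] in \<open>auto simp: supported_on_def parallel_def\<close>)
  have pf1: "path_factor G ?w (origin t, []) t p"
    using tu pq by (auto simp: path_factor_def trivial_path origin_in_verts composable_def)
      (simp add: path_append_def origin_def)
  have pf2: "path_factor G ?w q u (terminus G u, [])"
    using tu pq by (auto simp: path_factor_def trivial_path terminus_in_verts composable_def origin_def eq)
      (simp add: path_append_def)
  note z1 = supported_sandwich[OF g_upto[OF t] pf1, folded 1]
  note z2 = supported_sandwich[OF g_upto[OF u] pf2, folded 2]
  have "path_mult G (g t) (of_path p) - path_mult G (of_path q) (g u) \<in> supported_on (upto_path ?w)"
    by (rule pv.subspace_diff[OF subspace_supported_on z1(1) z2(1)])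
  moreover have "?w \<notin> Poly_Mapping.keys (path_mult G (g t) (of_path p) - path_mult G (of_path q) (g u))"
    by (simp add: in_keys_iff lookup_minus z1(2) z2(2) g_lookup t u)
  ultimately show ?thesis unfolding supported_on_def by blast
qed

text \<open>
  All relations are monic, so the coefficients in overlap relations are one.
\<close>

lemma overlap_relations_eq:
  "overlap_relations G ord (g ` T) = {path_mult G (g t) (of_path p) - path_mult G (of_path q) (g u) |t u p q.
    t \<in> T \<and> u \<in> T \<and> p \<in> paths G \<and> q \<in> paths G \<and> composable G t p \<and> composable G q u \<and>
    path_append t p = path_append q u \<and> 1 \<le> path_length q \<and> 1 \<le> path_length p \<and> path_length p < path_length u}"
  (is "?L = ?R")
proof (intro subset_antisym subsetI)
  fix z assume "z \<in> ?L"
  then obtain x y p q where xy: "x \<in> g ` T" "y \<in> g ` T"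
    and z: "z = path_smult (Poly_Mapping.lookup y (tip ord y)) (path_mult G x (of_path p))
      - path_smult (Poly_Mapping.lookup x (tip ord x)) (path_mult G (of_path q) y)"
    and c: "p \<in> paths G" "q \<in> paths G" "composable G (tip ord x) p" "composable G q (tip ord y)"
        "path_append (tip ord x) p = path_append q (tip ord y)"
        "1 \<le> path_length q" "1 \<le> path_length p" "path_length p < path_length (tip ord y)"
    unfolding overlap_relations_def by blast
  from xy obtain t u where tu: "t \<in> T" "u \<in> T" "x = g t" "y = g u" by blast
  have tips: "tip ord x = t" "tip ord y = u" using tu g_tip by auto
  have "z = path_mult G (g t) (of_path p) - path_mult G (of_path q) (g u)"
    unfolding z tips by (simp add: tu g_lookup path_smult_simps)
  then show "z \<in> ?R" using tu(1,2) c unfolding tips by blast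
next
  fix z assume "z \<in> ?R"
  then obtain t u p q where tu: "t \<in> T" "u \<in> T" and z: "z = path_mult G (g t) (of_path p) - path_mult G (of_path q) (g u)"
    and c: "p \<in> paths G" "q \<in> paths G" "composable G t p" "composable G q u" "path_append t p = path_append q u"
      "1 \<le> path_length q" "1 \<le> path_length p" "path_length p < path_length u" by blast
  have z: "z = path_smult (Poly_Mapping.lookup (g u) (tip ord (g u))) (path_mult G (g t) (of_path p))
      - path_smult (Poly_Mapping.lookup (g t) (tip ord (g t))) (path_mult G (of_path q) (g u))"
    unfolding z by (simp add: tu g_tip g_lookup path_smult_simps)
  have "g t \<noteq> 0" "g u \<noteq> 0" using g_lookup[OF tu(1)] g_lookup[OF tu(2)] by auto
  then show "z \<in> ?L"
    unfolding overlap_relations_def using tu c z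
    by (intro CollectI exI[of _ "g t"] exI[of _ "g u"] exI[of _ p] exI[of _ q]) (simp add: g_tip)
qed

end

section \<open>Evaluation of polynomials\<close>

definition monomial_value :: "('x \<Rightarrow> 'k::comm_semiring_1) \<Rightarrow> ('x \<Rightarrow>\<^sub>0 nat) \<Rightarrow> 'k" where
  "monomial_value c m = (\<Prod>v\<in>Poly_Mapping.keys m. c v ^ Poly_Mapping.lookup m v)"

lemma monomial_value_superset:
  assumes "finite A" "Poly_Mapping.keys m \<subseteq> A"
  shows "monomial_value c m = (\<Prod>v\<in>A. c v ^ Poly_Mapping.lookup m v)"
  unfolding monomial_value_def
  by (rule prod.mono_neutral_left) (use assms in \<open>auto simp: in_keys_iff\<close>)

lemma monomial_value_add: "monomial_value c (m + n) = monomial_value c m * monomial_value c n"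
proof -
  let ?A = "Poly_Mapping.keys m \<union> Poly_Mapping.keys n"
  have "monomial_value c (m + n) = (\<Prod>v\<in>?A. c v ^ Poly_Mapping.lookup (m + n) v)"
    using keys_add[of m n] by (intro monomial_value_superset) auto
  also have "\<dots> = (\<Prod>v\<in>?A. c v ^ Poly_Mapping.lookup m v) * (\<Prod>v\<in>?A. c v ^ Poly_Mapping.lookup n v)"
    by (simp add: lookup_add power_add prod.distrib)
  also have "\<dots> = monomial_value c m * monomial_value c n"
    using monomial_value_superset[of ?A m c] monomial_value_superset[of ?A n c] by simp
  finally show ?thesis .
qed

definition monomials_eval :: "('x \<Rightarrow> 'k::comm_semiring_1) \<Rightarrow> (('x \<Rightarrow>\<^sub>0 nat) \<Rightarrow>\<^sub>0 'k) \<Rightarrow> 'k" where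
  "monomials_eval c f = (\<Sum>m\<in>Poly_Mapping.keys f. Poly_Mapping.lookup f m * monomial_value c m)"

lemma monomials_eval_superset:
  assumes "finite A" "Poly_Mapping.keys f \<subseteq> A"
  shows "monomials_eval c f = (\<Sum>m\<in>A. Poly_Mapping.lookup f m * monomial_value c m)"
  unfolding monomials_eval_def
  by (rule sum.mono_neutral_left) (use assms in \<open>auto simp: in_keys_iff\<close>)

lemma monomials_eval_add: "monomials_eval c (f + g) = monomials_eval c f + monomials_eval c g"
proof -
  let ?A = "Poly_Mapping.keys f \<union> Poly_Mapping.keys g"
  have "monomials_eval c (f + g) = (\<Sum>m\<in>?A. Poly_Mapping.lookup (f + g) m * monomial_value c m)"
    using keys_add[of f g] by (intro monomials_eval_superset) auto
  also have "\<dots> = (\<Sum>m\<in>?A. Poly_Mapping.lookup f m * monomial_value c m) + (\<Sum>m\<in>?A. Poly_Mapping.lookup g m * monomial_value c m)"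
    by (simp add: lookup_add distrib_right sum.distrib)
  also have "\<dots> = monomials_eval c f + monomials_eval c g"
    using monomials_eval_superset[of ?A f c] monomials_eval_superset[of ?A g c] by simp
  finally show ?thesis .
qed

lemma monomials_eval_single: "monomials_eval c (Poly_Mapping.single m a) = a * monomial_value c m"
  using monomials_eval_superset[of "{m}" "Poly_Mapping.single m a" c] by simp

lemma monomials_eval_zero [simp]: "monomials_eval c 0 = 0"
  by (simp add: monomials_eval_def)

lemma monomials_eval_mult:
  fixes f g :: "('x \<Rightarrow>\<^sub>0 nat) \<Rightarrow>\<^sub>0 'k::comm_semiring_1"
  shows "monomials_eval c (f * g) = monomials_eval c f * monomials_eval c g"
proof (induction f rule: poly_mapping_induct_single)
  case (add m a f)
  have "monomials_eval c (Poly_Mapping.single m a * g) = a * monomial_value c m * monomials_eval c g"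
  proof (induction g rule: poly_mapping_induct_single)
    case (add n b g)
    then show ?case
      by (simp add: distrib_left monomials_eval_add monomials_eval_single mult_single monomial_value_add mult_ac)
  qed simp
  with add show ?case
    by (simp add: distrib_right monomials_eval_add monomials_eval_single)
qed simp

lemma mpoly_eval_eq: "mpoly_eval c f = monomials_eval c (Rep_mpoly f)"
  by (simp add: mpoly_eval_def monomials_eval_def monomial_value_def)

lemma mpoly_eval_simps [simp]:
  fixes f g :: "('x, 'k::comm_ring_1) mpoly"
  shows "mpoly_eval c 0 = (0 :: 'k)" "mpoly_eval c 1 = (1 :: 'k)"
    "mpoly_eval c (f + g) = mpoly_eval c f + mpoly_eval c g"
    "mpoly_eval c (f * g) = mpoly_eval c f * mpoly_eval c g"
    "mpoly_eval c (mpoly_var v) = c v"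
proof -
  show "mpoly_eval c 0 = (0 :: 'k)" by (simp add: mpoly_eval_eq zero_mpoly.rep_eq)
  show "mpoly_eval c 1 = (1 :: 'k)"
    by (simp add: mpoly_eval_eq one_mpoly.rep_eq monomials_eval_single monomial_value_def flip: single_one)
  show "mpoly_eval c (f + g) = mpoly_eval c f + mpoly_eval c g"
    by (simp add: mpoly_eval_eq plus_mpoly.rep_eq monomials_eval_add)
  show "mpoly_eval c (f * g) = mpoly_eval c f * mpoly_eval c g"
    by (simp add: mpoly_eval_eq times_mpoly.rep_eq monomials_eval_mult)
  show "mpoly_eval c (mpoly_var v) = c v"
    by (simp add: mpoly_eval_eq mpoly_var_def Abs_mpoly_inverse monomials_eval_single monomial_value_def)
qed

lemma mpoly_eval_diff [simp]:
  fixes f g :: "('x, 'k::comm_ring_1) mpoly"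
  shows "mpoly_eval c (f - g) = mpoly_eval c f - mpoly_eval c g"
  using mpoly_eval_simps(3)[of c "f - g" g] by (simp add: eq_diff_eq)

lemma mpoly_eval_cong:
  assumes "f \<in> polys_in X" "\<And>v. v \<in> X \<Longrightarrow> c v = d v"
  shows "mpoly_eval c f = mpoly_eval d f"
  unfolding mpoly_eval_def
proof (intro sum.cong refl arg_cong2[of _ _ _ _ "(*)"] prod.cong)
  fix m v assume "m \<in> Poly_Mapping.keys (Rep_mpoly f)" "v \<in> Poly_Mapping.keys m"
  then have "v \<in> X" using assms(1) unfolding polys_in_def by blast
  then show "c v ^ Poly_Mapping.lookup m v = d v ^ Poly_Mapping.lookup m v" using assms(2) by simp
qed

lemma polys_in_mono: "X \<subseteq> Y \<Longrightarrow> polys_in X \<subseteq> polys_in Y"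
  by (auto simp: polys_in_def)

lemma polys_in_closed:
  fixes f g :: "('x, 'k::comm_ring_1) mpoly"
  shows "0 \<in> (polys_in X :: ('x, 'k) mpoly set)" "1 \<in> (polys_in X :: ('x, 'k) mpoly set)"
    "v \<in> X \<Longrightarrow> mpoly_var v \<in> (polys_in X :: ('x, 'k) mpoly set)"
    "f \<in> polys_in X \<Longrightarrow> g \<in> polys_in X \<Longrightarrow> f - g \<in> polys_in X"
    "f \<in> polys_in X \<Longrightarrow> g \<in> polys_in X \<Longrightarrow> f * g \<in> polys_in X"
proof -
  show "0 \<in> (polys_in X :: ('x, 'k) mpoly set)" by (simp add: polys_in_def zero_mpoly.rep_eq)
  show "1 \<in> (polys_in X :: ('x, 'k) mpoly set)"
    by (simp add: polys_in_def one_mpoly.rep_eq flip: single_one)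
  show "v \<in> X \<Longrightarrow> mpoly_var v \<in> (polys_in X :: ('x, 'k) mpoly set)"
    by (simp add: polys_in_def mpoly_var_def Abs_mpoly_inverse)
  show "f - g \<in> polys_in X" if "f \<in> polys_in X" "g \<in> polys_in X"
    unfolding polys_in_def
  proof (intro CollectI ballI)
    fix m assume "m \<in> Poly_Mapping.keys (Rep_mpoly (f - g))"
    then have "m \<in> Poly_Mapping.keys (Rep_mpoly f) \<or> m \<in> Poly_Mapping.keys (Rep_mpoly g)"
      by (auto simp: in_keys_iff minus_mpoly.rep_eq lookup_minus)
    then show "Poly_Mapping.keys m \<subseteq> X" using that unfolding polys_in_def by blast
  qed
  show "f * g \<in> polys_in X" if "f \<in> polys_in X" "g \<in> polys_in X"
    unfolding polys_in_def
  proof (intro CollectI ballI)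
    fix m assume "m \<in> Poly_Mapping.keys (Rep_mpoly (f * g))"
    then obtain a b where ab: "m = a + b" "a \<in> Poly_Mapping.keys (Rep_mpoly f)" "b \<in> Poly_Mapping.keys (Rep_mpoly g)"
      using subsetD[OF keys_mult, of m "Rep_mpoly f" "Rep_mpoly g"] by (auto simp: times_mpoly.rep_eq)
    then have "Poly_Mapping.keys a \<subseteq> X" "Poly_Mapping.keys b \<subseteq> X" using that unfolding polys_in_def by blast+
    then show "Poly_Mapping.keys m \<subseteq> X" using keys_add[of a b] ab(1) by blast
  qed
qed

section \<open>Specialisation of generic elements\<close>

text \<open>
  A relation rather than a map, because evaluation at a point is defined only on polynomials and not
  on the whole fraction field.
\<close>

definition specializes ::
  "(('v, 'e) path \<times> ('v, 'e) path \<Rightarrow> 'k::field) \<Rightarrow> (('v, 'e) path \<times> ('v, 'e) path) set \<Rightarrow>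
    ('v, 'e, 'k) generic_elem \<Rightarrow> ('v, 'e, 'k) path_elem \<Rightarrow> bool" where
  "specializes c X z y \<longleftrightarrow> (\<forall>p. \<exists>f\<in>polys_in X.
     Poly_Mapping.lookup z p = to_fract f \<and> Poly_Mapping.lookup y p = mpoly_eval c f)"

lemma specializesD:
  "specializes c X z y \<Longrightarrow> \<exists>f\<in>polys_in X. Poly_Mapping.lookup z p = to_fract f \<and> Poly_Mapping.lookup y p = mpoly_eval c f"
  unfolding specializes_def by blast

lemma specializes_diff:
  assumes "specializes c X z y" "specializes c X z' y'"
  shows "specializes c X (z - z') (y - y')"
  unfolding specializes_def
proof
  fix p
  from assms obtain f f' where "f \<in> polys_in X" "Poly_Mapping.lookup z p = to_fract f" "Poly_Mapping.lookup y p = mpoly_eval c f"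
    "f' \<in> polys_in X" "Poly_Mapping.lookup z' p = to_fract f'" "Poly_Mapping.lookup y' p = mpoly_eval c f'"
    unfolding specializes_def by meson
  then show "\<exists>f\<in>polys_in X. Poly_Mapping.lookup (z - z') p = to_fract f \<and> Poly_Mapping.lookup (y - y') p = mpoly_eval c f"
    by (intro bexI[of _ "f - f'"]) (simp_all add: lookup_minus polys_in_closed)
qed

lemma specializes_smult:
  assumes "specializes c X z y" "a \<in> polys_in X"
  shows "specializes c X (path_smult (to_fract a) z) (path_smult (mpoly_eval c a) y)"
  unfolding specializes_def
proof
  fix p
  from assms obtain f where "f \<in> polys_in X" "Poly_Mapping.lookup z p = to_fract f" "Poly_Mapping.lookup y p = mpoly_eval c f"
    unfolding specializes_def by meson
  then show "\<exists>f\<in>polys_in X. Poly_Mapping.lookup (path_smult (to_fract a) z) p = to_fract f \<and>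
      Poly_Mapping.lookup (path_smult (mpoly_eval c a) y) p = mpoly_eval c f"
    using assms(2) by (intro bexI[of _ "a * f"]) (simp_all add: lookup_smult polys_in_closed)
qed

lemma specializes_zero_coeff:
  assumes "specializes c X z y" "Poly_Mapping.lookup z p = 0"
  shows "Poly_Mapping.lookup y p = 0"
proof -
  from assms(1) obtain f where "Poly_Mapping.lookup z p = to_fract f" "Poly_Mapping.lookup y p = mpoly_eval c f"
    unfolding specializes_def by meson
  then show ?thesis using assms(2) by simp
qed

lemma specializes_left:
  assumes "specializes c X z y"
  shows "specializes c X (path_mult G (of_path r) z) (path_mult G (of_path r) y)"
  unfolding specializes_def
proof
  fix k
  show "\<exists>f\<in>polys_in X. Poly_Mapping.lookup (path_mult G (of_path r) z) k = to_fract f \<and>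
    Poly_Mapping.lookup (path_mult G (of_path r) y) k = mpoly_eval c f"
  proof (cases "\<exists>q. composable G r q \<and> k = path_append r q")
    case True
    then obtain q where "composable G r q" "k = path_append r q" by blast
    then show ?thesis using specializesD[OF assms, of q] by (simp add: lookup_of_path_left)
  next
    case False
    then have "k \<notin> Poly_Mapping.keys (path_mult G (of_path r) z)" "k \<notin> Poly_Mapping.keys (path_mult G (of_path r) y)"
      using keys_of_path_left by blast+
    then show ?thesis by (intro bexI[of _ 0]) (simp_all add: in_keys_iff polys_in_closed)
  qed
qed

lemma specializes_right:
  assumes "specializes c X z y"
  shows "specializes c X (path_mult G z (of_path s)) (path_mult G y (of_path s))"
  unfolding specializes_def
proof
  fix k
  show "\<exists>f\<in>polys_in X. Poly_Mapping.lookup (path_mult G z (of_path s)) k = to_fract f \<and>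
    Poly_Mapping.lookup (path_mult G y (of_path s)) k = mpoly_eval c f"
  proof (cases "\<exists>q. composable G q s \<and> k = path_append q s")
    case True
    then obtain q where "composable G q s" "k = path_append q s" by blast
    then show ?thesis using specializesD[OF assms, of q] by (simp add: lookup_of_path_right)
  next
    case False
    then have "k \<notin> Poly_Mapping.keys (path_mult G z (of_path s))" "k \<notin> Poly_Mapping.keys (path_mult G y (of_path s))"
      using keys_of_path_right by blast+
    then show ?thesis by (intro bexI[of _ 0]) (simp_all add: in_keys_iff polys_in_closed)
  qed
qed

lemma specializes_sandwich:
  "specializes c X z y \<Longrightarrow> specializes c X (sandwich G r z s) (sandwich G r y s)"
  unfolding sandwich_def by (intro specializes_left specializes_right)

lemma specializes_of_path: "specializes c X (of_path p) (of_path p)"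
  unfolding specializes_def
proof
  fix q
  show "\<exists>f\<in>polys_in X. Poly_Mapping.lookup (of_path p) q = to_fract f \<and> Poly_Mapping.lookup (of_path p) q = mpoly_eval c f"
    by (cases "q = p") (auto simp: of_path_def lookup_single polys_in_closed intro: bexI[of _ 0] bexI[of _ 1])
qed

lemma lookup_sum_smult_of_path:
  assumes "finite A"
  shows "Poly_Mapping.lookup (\<Sum>n\<in>A. path_smult (f n) (of_path n)) k = (if k \<in> A then f k else 0)"
  using assms by (simp add: lookup_sum lookup_smult of_path_def lookup_single when_def if_distrib cong: if_cong)

section \<open>Quotient algebras\<close>

lemma quotient_algebra_simps:
  "carrier (quotient_algebra A I) = carrier (A Quot I)" "add (quotient_algebra A I) = add (A Quot I)"
  "zero (quotient_algebra A I) = I"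
  "module.smult (quotient_algebra A I) k X = (\<Union>x\<in>X. I +>\<^bsub>A\<^esub> (k \<odot>\<^bsub>A\<^esub> x))"
  by (simp_all add: quotient_algebra_def ring.extend_def module.fields_def FactRing_def)

text \<open>
  Finite sums in a ring depend on its additive structure only, which the quotient algebra shares with
  the quotient ring.
\<close>

lemma finsum_quotient_algebra: "finsum (quotient_algebra A I) = finsum (A Quot I)"
  by (simp add: finsum_def quotient_algebra_simps FactRing_def fun_eq_iff finprod_def)

context ordered_quiver begin

lemma coset_path_algebra: "I +>\<^bsub>path_algebra G\<^esub> x = (\<lambda>h. h + x) ` I"
  by (auto simp: a_r_coset_def')

text \<open>
  The cosets of the paths in \<open>N\<close> span.  Different paths may give the same coset, so the coefficient
  function is built up one path at a time, adding the new coefficient at the coset of that path.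
\<close>

lemma finite_dim_quotient:
  fixes I :: "('a, 'b, 'k::field) path_elem set"
  assumes I: "ideal I (path_algebra G)" and N: "finite N" "N \<subseteq> paths G"
    and nf: "\<And>p. p \<in> paths G \<Longrightarrow> \<exists>n\<in>supported_on N. of_path p - n \<in> I"
  shows "finite_dim (quotient_algebra (path_algebra G) I)"
proof -
  let ?R = "path_algebra G :: ('k, ('a, 'b, 'k) path_elem) module"
  let ?Q = "quotient_algebra ?R I"
  let ?c = "\<lambda>x. I +>\<^bsub>?R\<^esub> x"
  interpret I: ideal I ?R by fact
  interpret Q: ring "?R Quot I" by (rule I.quotient_is_ring)
  have sub: "pv.subspace I" using I by (simp add: ideal_iff)
  have smult: "k \<odot>\<^bsub>?Q\<^esub> ?c x = ?c (path_smult k x)" for k x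
  proof -
    have "(\<lambda>h. h + path_smult k (h0 + x)) ` I = (\<lambda>h. h + path_smult k x) ` I" if "h0 \<in> I" for h0
    proof -
      have k: "path_smult k h0 \<in> I" using that sub by (intro pv.subspace_scale)
      show ?thesis
      proof (intro subset_antisym subsetI)
        fix y assume "y \<in> (\<lambda>h. h + path_smult k (h0 + x)) ` I"
        then obtain h where h: "h \<in> I" "y = h + path_smult k (h0 + x)" by blast
        then have "y = (h + path_smult k h0) + path_smult k x" by (simp add: path_smult_simps add.assoc)
        moreover have "h + path_smult k h0 \<in> I" using h k sub by (intro pv.subspace_add)
        ultimately show "y \<in> (\<lambda>h. h + path_smult k x) ` I" by blast
      next
        fix y assume "y \<in> (\<lambda>h. h + path_smult k x) ` I"
        then obtain h where h: "h \<in> I" "y = h + path_smult k x" by blast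
        then have "y = (h - path_smult k h0) + path_smult k (h0 + x)" by (simp add: path_smult_simps)
        moreover have "h - path_smult k h0 \<in> I" using h k sub by (intro pv.subspace_diff)
        ultimately show "y \<in> (\<lambda>h. h + path_smult k (h0 + x)) ` I" by blast
      qed
    qed
    moreover have "I \<noteq> {}" using pv.subspace_0[OF sub] by blast
    ultimately show ?thesis by (simp add: quotient_algebra_simps coset_path_algebra)
  qed
  have Ns: "supported_on N \<subseteq> carrier ?R" using N(2) by (auto simp: supported_on_def)
  have in_c: "?c x \<in> carrier (?R Quot I)" if "x \<in> carrier ?R" for x
    using that I.a_rcosetsI[OF I.a_subset] by (simp add: FactRing_def)
  have c_add: "?c x \<oplus>\<^bsub>?R Quot I\<^esub> ?c y = ?c (x + y)" if "x \<in> carrier ?R" "y \<in> carrier ?R" for x y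
    using I.a_rcos_sum[OF that] by (simp add: FactRing_def)
  have c_zero: "?c 0 = \<zero>\<^bsub>?R Quot I\<^esub>" by (simp add: FactRing_def coset_path_algebra)
  let ?S = "(\<lambda>p. ?c (of_path p)) ` N"
  have S: "finite ?S" "?S \<subseteq> carrier (?R Quot I)"
    using N in_c Ns by (auto simp: of_path_supported subset_iff)
  have smult_S: "k \<odot>\<^bsub>?Q\<^esub> s \<in> carrier (?R Quot I)" if "s \<in> ?S" for k s
  proof -
    from that obtain p where "p \<in> N" "s = ?c (of_path p)" by blast
    then show ?thesis using Ns by (auto simp: smult intro!: in_c pv.subspace_scale subspace_supported_on of_path_supported subsetD[OF Ns, simplified])
  qed
  have span: "x \<in> carrier ?R \<and> (\<exists>f. ?c x = (\<Oplus>\<^bsub>?R Quot I\<^esub>s\<in>?S. f s \<odot>\<^bsub>?Q\<^esub> s))" if "x \<in> supported_on N" for x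
  proof -
    have zero_smult: "0 \<odot>\<^bsub>?Q\<^esub> s = \<zero>\<^bsub>?R Quot I\<^esub>" if "s \<in> ?S" for s
    proof -
      from that obtain p where "s = ?c (of_path p)" by blast
      then show ?thesis by (simp only: smult path_smult_zero c_zero)
    qed
    from that have "Poly_Mapping.keys x \<subseteq> N" by (simp add: supported_on_def)
    then show ?thesis
    proof (induction x rule: poly_mapping_induct_on)
      case zero
      have "(\<Oplus>\<^bsub>?R Quot I\<^esub>s\<in>?S. 0 \<odot>\<^bsub>?Q\<^esub> s) = (\<Oplus>\<^bsub>?R Quot I\<^esub>s\<in>?S. \<zero>\<^bsub>?R Quot I\<^esub>)"
        by (rule Q.add.finprod_cong') (auto simp: zero_smult)
      also have "\<dots> = ?c 0" by (simp only: Q.finsum_zero c_zero)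
      finally have e: "(\<Oplus>\<^bsub>?R Quot I\<^esub>s\<in>?S. 0 \<odot>\<^bsub>?Q\<^esub> s) = ?c 0" .
      have "0 \<in> carrier ?R" by (simp add: supported_on_def)
      then show ?case by (intro conjI exI[of _ "\<lambda>_. 0"] e[symmetric])
    next
      case (add p a x)
      then obtain f where f: "?c x = (\<Oplus>\<^bsub>?R Quot I\<^esub>s\<in>?S. f s \<odot>\<^bsub>?Q\<^esub> s)" by blast
      let ?s = "?c (of_path p)"
      let ?d = "\<lambda>s. if ?s = s then a \<odot>\<^bsub>?Q\<^esub> s else \<zero>\<^bsub>?R Quot I\<^esub>"
      let ?f = "\<lambda>s. if ?s = s then a + f s else f s"
      have s: "?s \<in> ?S" using add.hyps by blast
      have pN: "Poly_Mapping.single p a \<in> carrier ?R"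
        using add.hyps N(2) by (simp add: supported_on_def) blast
      have xN: "x \<in> carrier ?R" using add.IH by simp
      have *: "?f s \<odot>\<^bsub>?Q\<^esub> s = ?d s \<oplus>\<^bsub>?R Quot I\<^esub> (f s \<odot>\<^bsub>?Q\<^esub> s)" if "s \<in> ?S" for s
      proof -
        from that obtain q where q: "q \<in> N" "s = ?c (of_path q)" by blast
        have oq: "path_smult k (of_path q) \<in> carrier ?R" for k
          using q(1) N(2) by (auto intro!: pv.subspace_scale subspace_supported_on of_path_supported)
        have "(a + f s) \<odot>\<^bsub>?Q\<^esub> s = (a \<odot>\<^bsub>?Q\<^esub> s) \<oplus>\<^bsub>?R Quot I\<^esub> (f s \<odot>\<^bsub>?Q\<^esub> s)"
          unfolding q(2) smult c_add[OF oq oq] by (simp only: path_smult_simps(2))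
        moreover have "\<zero>\<^bsub>?R Quot I\<^esub> \<oplus>\<^bsub>?R Quot I\<^esub> (f s \<odot>\<^bsub>?Q\<^esub> s) = f s \<odot>\<^bsub>?Q\<^esub> s"
          by (rule Q.l_zero[OF smult_S[OF that]])
        ultimately show ?thesis by simp
      qed
      have d: "?d s \<in> carrier (?R Quot I)" if "s \<in> ?S" for s using smult_S[OF that] by simp
      have "(\<Oplus>\<^bsub>?R Quot I\<^esub>s\<in>?S. ?f s \<odot>\<^bsub>?Q\<^esub> s) = (\<Oplus>\<^bsub>?R Quot I\<^esub>s\<in>?S. ?d s \<oplus>\<^bsub>?R Quot I\<^esub> (f s \<odot>\<^bsub>?Q\<^esub> s))"
        by (rule Q.add.finprod_cong') (use * d smult_S in auto)
      also have "\<dots> = (\<Oplus>\<^bsub>?R Quot I\<^esub>s\<in>?S. ?d s) \<oplus>\<^bsub>?R Quot I\<^esub> (\<Oplus>\<^bsub>?R Quot I\<^esub>s\<in>?S. f s \<odot>\<^bsub>?Q\<^esub> s)"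
        by (rule Q.finsum_addf) (use d smult_S in blast)+
      also have "(\<Oplus>\<^bsub>?R Quot I\<^esub>s\<in>?S. ?d s) = a \<odot>\<^bsub>?Q\<^esub> ?s"
        by (rule Q.finsum_singleton[OF s S(1)]) (use smult_S in blast)
      also have "\<dots> = ?c (Poly_Mapping.single p a)" by (simp only: smult single_eq_smult_of_path)
      also have "\<dots> \<oplus>\<^bsub>?R Quot I\<^esub> (\<Oplus>\<^bsub>?R Quot I\<^esub>s\<in>?S. f s \<odot>\<^bsub>?Q\<^esub> s) = ?c (Poly_Mapping.single p a + x)"
        unfolding f[symmetric] by (rule c_add[OF pN xN])
      finally have e: "(\<Oplus>\<^bsub>?R Quot I\<^esub>s\<in>?S. ?f s \<odot>\<^bsub>?Q\<^esub> s) = ?c (Poly_Mapping.single p a + x)" .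
      have "Poly_Mapping.single p a + x \<in> carrier ?R"
        using pN xN by (simp add: pv.subspace_add subspace_supported_on)
      then show ?case by (intro conjI exI[of _ ?f] e[symmetric])
    qed
  qed
  show ?thesis
    unfolding finite_dim_def
  proof (intro exI[of _ ?S] conjI ballI)
    fix X assume "X \<in> carrier ?Q"
    then obtain x where x: "x \<in> carrier ?R" "X = ?c x"
      by (auto simp: quotient_algebra_simps FactRing_def A_RCOSETS_def')
    have "x \<in> supported_on (paths G)" using x by simp
    from normal_form_extend[OF sub nf this] obtain n where n: "n \<in> supported_on N" "x - n \<in> I" by blast
    have "n - x \<in> I" using pv.subspace_neg[OF sub n(2)] by simp
    then have "(n - x) + x \<in> ?c x" unfolding coset_path_algebra by blast
    then have "X = ?c n" unfolding x(2) using x(1) by (intro I.a_repr_independence') simp_all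
    with span[OF n(1)] show "\<exists>f. X = (\<Oplus>\<^bsub>?Q\<^esub>s\<in>?S. f s \<odot>\<^bsub>?Q\<^esub> s)" by (simp only: finsum_quotient_algebra)
  qed (use S in \<open>simp_all only: quotient_algebra_simps\<close>)
qed

end

section \<open>Points of the variety and their ideals\<close>

text \<open>
  The combinatorial content of the hypotheses on \<open>T\<close>: all paths of length at least \<open>m\<close> lie in the
  monomial ideal of \<open>T\<close>.
\<close>

locale truncated_tips = ordered_quiver G ord for G :: "('a, 'b) pre_digraph" and ord +
  fixes T :: "('a, 'b) path set" and m :: nat
  assumes T_paths: "T \<subseteq> paths G"
    and antichain: "\<And>t u. t \<in> T \<Longrightarrow> u \<in> T \<Longrightarrow> subpath G t u \<Longrightarrow> t = u"
    and T_length: "\<And>t. t \<in> T \<Longrightarrow> 2 \<le> path_length t"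
    and long_not_normal: "\<And>p. p \<in> paths G \<Longrightarrow> m \<le> path_length p \<Longrightarrow> p \<in> above T"
begin

abbreviation "N \<equiv> normal_paths G T"
abbreviation "X \<equiv> ad_coords G ord T"

lemma finite_paths_upto: "finite {p \<in> paths G. path_length p \<le> k}"
proof (rule finite_subset)
  show "{p \<in> paths G. path_length p \<le> k} \<subseteq> verts G \<times> {xs. set xs \<subseteq> arcs G \<and> length xs \<le> k}"
    by (auto simp: paths_def path_length_def awalk_def)
  show "finite (verts G \<times> {xs. set xs \<subseteq> arcs G \<and> length xs \<le> k})"
    by (intro finite_cartesian_product finite_lists_length_le) auto
qed

lemma normal_in_paths: "N \<subseteq> paths G"
  by (auto simp: normal_paths_def)

lemma finite_normal: "finite N"
proof (rule finite_subset[OF _ finite_paths_upto[of m]])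
  show "N \<subseteq> {p \<in> paths G. path_length p \<le> m}"
    using long_not_normal by (force simp: normal_paths_def above_def)
qed

text \<open>
  A path of length greater than \<open>m\<close> has a proper subpath of length \<open>m\<close>, which has a subpath in \<open>T\<close>; so
  it cannot lie in the antichain \<open>T\<close>.
\<close>

lemma finite_T: "finite T"
proof (rule finite_subset[OF _ finite_paths_upto[of m]])
  have "path_length t \<le> m" if t: "t \<in> T" for t
  proof (rule ccontr)
    assume "\<not> path_length t \<le> m"
    then have len: "path_length t = m + (path_length t - m)" "m < path_length t" by simp_all
    from path_split[OF _ len(1)] t T_paths obtain a b where ab: "a \<in> paths G" "b \<in> paths G" "composable G a b"
      "t = path_append a b" "path_length a = m" by blast
    have "a \<in> above T" using long_not_normal ab by simp
    then obtain u where u: "u \<in> T" "subpath G u a" by (auto simp: above_def)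
    have "path_factor G t (origin a, []) a b"
      using ab by (auto simp: path_factor_def trivial_path origin_in_verts composable_def)
        (simp add: path_append_def origin_def)
    from antichain[OF u(1) t subpath_trans[OF u(2) subpathI[OF this]]] have "u = t" .
    with subpath_length[OF u(2)] ab(5) len(2) show False by simp
  qed
  then show "T \<subseteq> {p \<in> paths G. path_length p \<le> m}" using T_paths by blast
qed

lemma normal_below_iff: "t \<in> T \<Longrightarrow> normal_below G ord T t = {n \<in> N \<inter> below t. parallel G n t}"
  by (auto simp: normal_below_def below_def normal_paths_def)

lemma finite_normal_below: "finite (normal_below G ord T t)"
  by (rule finite_subset[OF _ finite_normal]) (auto simp: normal_below_def)

lemma finite_coords: "finite (coords G ord T)"
  unfolding coords_def using finite_T finite_normal_below by blast

lemma ad_coords_subset: "X \<subseteq> coords G ord T"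
  by (auto simp: ad_coords_def)

definition g :: "(('a, 'b) path \<times> ('a, 'b) path \<Rightarrow> 'k::field) \<Rightarrow> ('a, 'b) path \<Rightarrow> ('a, 'b, 'k) path_elem" where
  "g c t = of_path t - (\<Sum>n\<in>normal_below G ord T t. path_smult (c (t, n)) (of_path n))"

text \<open>
  The generic relation at \<open>t\<close>.  Its specialisation at \<open>c\<close> is \<open>g c t\<close>, provided that \<open>c\<close>
  vanishes at the coordinates that carry no variable.
\<close>

definition h :: "('a, 'b) path \<Rightarrow> ('a, 'b, 'k::field) generic_elem" where
  "h t = of_path t - (\<Sum>n\<in>{n \<in> normal_below G ord T t. 2 \<le> path_length n}.
     path_smult (to_fract (mpoly_var (t, n))) (of_path n))"

lemma G_family_eq: "G_family G ord T c = g c ` T"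
  by (auto simp: G_family_def g_def)

lemma H_family_eq: "H_family G ord T = h ` T"
  by (auto simp: H_family_def h_def)

lemma lookup_g: "Poly_Mapping.lookup (g c t) k = (if k = t then 1 else 0) - (if k \<in> normal_below G ord T t then c (t, k) else 0)"
  unfolding g_def lookup_minus lookup_sum_smult_of_path[OF finite_normal_below]
  by (simp add: of_path_def lookup_single when_def)

lemma lookup_h: "Poly_Mapping.lookup (h t) k = (if k = t then 1 else 0) -
    (if k \<in> normal_below G ord T t \<and> 2 \<le> path_length k then to_fract (mpoly_var (t, k)) else 0)"
  unfolding h_def lookup_minus
  by (subst lookup_sum_smult_of_path) (simp_all add: finite_normal_below of_path_def lookup_single when_def)

lemma g_tail: "t \<in> T \<Longrightarrow> of_path t - g c t \<in> supported_on (normal_below G ord T t)"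
  unfolding supported_on_def
  by (auto simp: in_keys_iff lookup_minus lookup_g of_path_def lookup_single when_def split: if_splits)

lemma reduction_system_g: "reduction_system G ord T (g c)"
proof
  fix t assume t: "t \<in> T"
  show "of_path t - g c t \<in> supported_on {n \<in> below t. parallel G n t}"
    using g_tail[OF t, of c] unfolding normal_below_iff[OF t] supported_on_def by blast
qed (use T_paths antichain in auto)

lemma reduction_system_h: "reduction_system G ord T h"
proof
  fix t assume t: "t \<in> T"
  have "of_path t - h t \<in> supported_on (normal_below G ord T t)"
    unfolding supported_on_def
    by (auto simp: in_keys_iff lookup_minus lookup_h of_path_def lookup_single when_def split: if_splits)
  then show "of_path t - h t \<in> supported_on {n \<in> below t. parallel G n t}"
    unfolding normal_below_iff[OF t] supported_on_def by blast
qed (use T_paths antichain in auto)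

lemma specializes_h:
  fixes c :: "('a, 'b) path \<times> ('a, 'b) path \<Rightarrow> 'k::field"
  assumes t: "t \<in> T" and c: "\<forall>i\<in>coords G ord T - X. c i = 0"
  shows "specializes c X (h t) (g c t)"
  unfolding specializes_def
proof
  fix k
  let ?f = "(if k = t then 1 else 0) -
    (if k \<in> normal_below G ord T t \<and> 2 \<le> path_length k then mpoly_var (t, k) else 0)"
  have "?f \<in> polys_in X"
    using t by (intro polys_in_closed(4)) (auto simp: polys_in_closed ad_coords_def coords_def)
  moreover have "Poly_Mapping.lookup (h t) k = to_fract ?f" by (simp add: lookup_h)
  moreover have "Poly_Mapping.lookup (g c t) k = mpoly_eval c ?f"
  proof -
    have "c (t, k) = 0" if "k \<in> normal_below G ord T t" "\<not> 2 \<le> path_length k"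
      using c t that by (simp add: ad_coords_def coords_def)
    moreover have "t \<notin> normal_below G ord T t" by (simp add: normal_below_def path_gt_def)
    ultimately show ?thesis by (auto simp: lookup_g)
  qed
  ultimately show "\<exists>f\<in>polys_in X. Poly_Mapping.lookup (h t) k = to_fract f \<and> Poly_Mapping.lookup (g c t) k = mpoly_eval c f"
    by blast
qed

text \<open>
  The set \<open>W\<close> bounds the paths of the element that is reduced, hence the leading paths of the
  relations that are subtracted.  With \<open>W\<close> the paths below an overlap this yields the criterion
  for overlaps; with all paths it yields membership in the ideal.
\<close>

lemma specialize_reduction_step:
  fixes c :: "('a, 'b) path \<times> ('a, 'b) path \<Rightarrow> 'k::field"
  assumes c: "\<forall>i\<in>coords G ord T - X. c i = 0"
    and W: "W \<subseteq> paths G" "\<forall>w\<in>W. below w \<subseteq> W"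
    and step: "simple_reduction G ord (h ` T) z y" and z: "specializes c X z z'" "z \<in> supported_on W"
  shows "\<exists>y'. specializes c X y y' \<and> y \<in> supported_on W \<and>
    z' - y' \<in> pv.span (reduction_system.rewriters G T (g c) W)"
proof -
  interpret H: reduction_system G ord T "h :: _ \<Rightarrow> ('a, 'b, 'k) generic_elem" by (rule reduction_system_h)
  interpret S: reduction_system G ord T "g c" by (rule reduction_system_g)
  let ?h = "h :: _ \<Rightarrow> ('a, 'b, 'k) generic_elem"
  from step obtain t p r s where t: "t \<in> T" and p: "Poly_Mapping.lookup z p \<noteq> 0"
    and pf: "path_factor G p r (tip ord (?h t)) s"
    and y: "y = path_smult (Poly_Mapping.lookup (?h t) (tip ord (?h t))) z
         - path_smult (Poly_Mapping.lookup z p) (sandwich G r (?h t) s)"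
    unfolding simple_reduction_def sandwich_def by blast
  have pf: "path_factor G p r t s" using pf by (simp add: H.g_tip[OF t])
  have y: "y = z - path_smult (Poly_Mapping.lookup z p) (sandwich G r (?h t) s)"
    using y by (simp add: H.g_tip[OF t] H.g_lookup[OF t] path_smult_simps)
  obtain a where a: "a \<in> polys_in X" "Poly_Mapping.lookup z p = to_fract a" using specializesD[OF z(1), of p] by blast
  let ?y' = "z' - path_smult (mpoly_eval c a) (sandwich G r (g c t) s)"
  have pW: "p \<in> W" using p z(2) by (auto simp: supported_on_def in_keys_iff)
  have "specializes c X y ?y'"
    unfolding y a(2) by (intro specializes_diff specializes_smult specializes_sandwich specializes_h z(1) a(1) t c)
  moreover have "sandwich G r (?h t) s \<in> supported_on W"
    using supported_sandwich(1)[OF H.g_upto[OF t] pf] W(2) pW unfolding supported_on_def by blast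
  then have "y \<in> supported_on W"
    unfolding y using z(2) by (intro pv.subspace_diff pv.subspace_scale subspace_supported_on)
  moreover have "z' - ?y' \<in> S.rewrite_span W"
    using S.rewritersI[OF t pW pf] by (simp add: pv.span_base pv.span_scale)
  ultimately show ?thesis by blast
qed

lemma specialize_reduction:
  fixes c :: "('a, 'b) path \<times> ('a, 'b) path \<Rightarrow> 'k::field"
  assumes c: "\<forall>i\<in>coords G ord T - X. c i = 0"
    and W: "W \<subseteq> paths G" "\<forall>w\<in>W. below w \<subseteq> W"
    and red: "complete_reduction G ord (h ` T) z y" and z: "specializes c X z z'" "z \<in> supported_on W"
  shows "\<exists>y'. specializes c X y y' \<and> y \<in> supported_on N \<and>
    z' - y' \<in> pv.span (reduction_system.rewriters G T (g c) W)"
proof -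
  interpret H: reduction_system G ord T "h :: _ \<Rightarrow> ('a, 'b, 'k) generic_elem" by (rule reduction_system_h)
  interpret S: reduction_system G ord T "g c" by (rule reduction_system_g)
  have "(simple_reduction G ord (h ` T))\<^sup>*\<^sup>* z y" using red by (simp add: complete_reduction_def)
  then have "\<exists>y'. specializes c X y y' \<and> y \<in> supported_on W \<and> z' - y' \<in> S.rewrite_span W"
  proof (induction rule: rtranclp_induct)
    case base
    show ?case using z by (intro exI[of _ z']) (simp add: pv.span_zero)
  next
    case (step x y)
    then obtain x' where x': "specializes c X x x'" "x \<in> supported_on W" "z' - x' \<in> S.rewrite_span W" by blast
    from specialize_reduction_step[OF c W step(2) x'(1,2)] obtain y' where
      y': "specializes c X y y'" "y \<in> supported_on W" "x' - y' \<in> S.rewrite_span W" by blast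
    from pv.span_add[OF x'(3) y'(3)] have "z' - y' \<in> S.rewrite_span W" by simp
    with y' show ?case by blast
  qed
  then obtain y' where y': "specializes c X y y'" "y \<in> supported_on W" "z' - y' \<in> S.rewrite_span W" by blast
  have "p \<in> N" if p: "p \<in> Poly_Mapping.keys y" for p
  proof (rule ccontr)
    assume "p \<notin> N"
    moreover have "p \<in> paths G" using p y'(2) W(1) unfolding supported_on_def by blast
    ultimately obtain t r s where t: "t \<in> T" "path_factor G p r t s" using S.not_normal_iff by blast
    have "\<exists>x. simple_reduction G ord (h ` T) y x"
      unfolding simple_reduction_def
      using t p by (intro exI bexI[of _ "h t"] conjI) (auto simp: H.g_tip[OF t(1)] in_keys_iff)
    moreover have "y \<noteq> 0" using p by auto
    ultimately show False using red by (auto simp: complete_reduction_def)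
  qed
  then have "y \<in> supported_on N" unfolding supported_on_def by blast
  with y' show ?thesis by blast
qed

text \<open>
  The coefficients of each complete reduction at normal paths are among the polynomials, so its
  specialisation is zero and the specialised input is a combination of multiples of the relations.
\<close>

lemma vanishing_imp_resolvable:
  fixes c :: "('a, 'b) path \<times> ('a, 'b) path \<Rightarrow> 'k::field"
  assumes c: "\<forall>i\<in>coords G ord T - X. c i = 0"
    and red: "reduction_choice G ord T k red" and van: "\<forall>f\<in>ad_polys G ord T k red. mpoly_eval c f = 0"
  shows "reduction_system.overlaps_resolvable G ord T (g c)"
    and "\<And>p. p \<in> paths G \<Longrightarrow> path_length p = k \<Longrightarrow> of_path p \<in> genideal (path_algebra G) (g c ` T)"
proof -
  interpret H: reduction_system G ord T "h :: _ \<Rightarrow> ('a, 'b, 'k) generic_elem" by (rule reduction_system_h)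
  interpret S: reduction_system G ord T "g c" by (rule reduction_system_g)
  let ?h = "h :: _ \<Rightarrow> ('a, 'b, 'k) generic_elem"
  have *: "z' \<in> S.rewrite_span W"
    if z: "z \<in> H_inputs G ord T k" "specializes c X z z'" "z \<in> supported_on W"
      and W: "W \<subseteq> paths G" "\<forall>w\<in>W. below w \<subseteq> W" for z z' W
  proof -
    have "complete_reduction G ord (?h ` T) z (red z)"
      using red z(1) unfolding reduction_choice_def H_family_eq by blast
    from specialize_reduction[OF c W this z(2,3)] obtain y' where y': "specializes c X (red z) y'"
      "red z \<in> supported_on N" "z' - y' \<in> S.rewrite_span W" by blast
    have "Poly_Mapping.lookup y' p = 0" for p
    proof (cases "p \<in> N")
      case True
      obtain f where f: "f \<in> polys_in X" "Poly_Mapping.lookup (red z) p = to_fract f"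
        "Poly_Mapping.lookup y' p = mpoly_eval c f" using specializesD[OF y'(1), of p] by blast
      have "f \<in> ad_polys G ord T k red" unfolding ad_polys_def using f(1,2) z(1) True by blast
      with van f(3) show ?thesis by simp
    next
      case False
      then have "Poly_Mapping.lookup (red z) p = 0" using y'(2) by (auto simp: supported_on_def in_keys_iff)
      then show ?thesis by (rule specializes_zero_coeff[OF y'(1)])
    qed
    then have "y' = 0" by (intro poly_mapping_eqI) simp
    with y'(3) show ?thesis by simp
  qed
  show S.overlaps_resolvable
    unfolding S.overlaps_resolvable_def
  proof (intro ballI impI)
    fix t u p q assume a: "t \<in> T" "u \<in> T" "p \<in> paths G" "q \<in> paths G" "composable G t p" "composable G q u"
      "path_append t p = path_append q u" "1 \<le> path_length q" "1 \<le> path_length p" "path_length p < path_length u"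
    have "path_mult G (?h t) (of_path p) - path_mult G (of_path q) (?h u) \<in> H_inputs G ord T k"
      unfolding H_inputs_def H_family_eq H.overlap_relations_eq using a by blast
    moreover have "specializes c X (path_mult G (?h t) (of_path p) - path_mult G (of_path q) (?h u))
        (path_mult G (g c t) (of_path p) - path_mult G (of_path q) (g c u))"
      using a(1,2) c by (intro specializes_diff specializes_left specializes_right specializes_h)
    moreover have "below (path_append t p) \<subseteq> paths G" by (auto simp: below_def)
    moreover have "\<forall>w\<in>below (path_append t p). below w \<subseteq> below (path_append t p)"
      using H.below_trans by blast
    ultimately show "path_mult G (g c t) (of_path p) - path_mult G (of_path q) (g c u)
        \<in> S.rewrite_span (below (path_append t p))"
      using H.overlap_supported[OF a(1-7)] by (intro *)
  qed
  fix p assume p: "p \<in> paths G" "path_length p = k"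
  have "of_path p \<in> (H_inputs G ord T k :: ('a, 'b, 'k) generic_elem set)"
    using p unfolding H_inputs_def by blast
  from *[OF this specializes_of_path, of "paths G"] p
  have "of_path p \<in> S.rewrite_span (paths G)" by (auto simp: supported_on_def below_def)
  then show "of_path p \<in> genideal (path_algebra G) (g c ` T)" unfolding S.genideal_eq_rewrite_span .
qed

text \<open>
  The specialised input lies in \<open>I\<close>, hence so does the specialised complete reduction.  It is supported
  on normal paths, which are not tips of \<open>I\<close>, so it is zero.
\<close>

lemma ideal_imp_vanishing:
  fixes c :: "('a, 'b) path \<times> ('a, 'b) path \<Rightarrow> 'k::field"
  assumes c: "\<forall>i\<in>coords G ord T - X. c i = 0"
    and red: "reduction_choice G ord T k red"
    and I: "ideal I (path_algebra G)" "tips ord I = above T" "g c ` T \<subseteq> I"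
    and k: "\<And>p. p \<in> paths G \<Longrightarrow> path_length p = k \<Longrightarrow> of_path p \<in> I"
    and f: "f \<in> ad_polys G ord T k red"
  shows "mpoly_eval c f = 0"
proof -
  interpret H: reduction_system G ord T "h :: _ \<Rightarrow> ('a, 'b, 'k) generic_elem" by (rule reduction_system_h)
  interpret S: reduction_system G ord T "g c" by (rule reduction_system_g)
  let ?h = "h :: _ \<Rightarrow> ('a, 'b, 'k) generic_elem"
  have sub: "pv.subspace I" and mult: "\<And>x y. x \<in> I \<Longrightarrow> y \<in> supported_on (paths G) \<Longrightarrow> path_mult G x y \<in> I \<and> path_mult G y x \<in> I"
    using I(1) by (auto simp: ideal_iff)
  from f obtain z n where z: "z \<in> H_inputs G ord T k" "n \<in> N" "Poly_Mapping.lookup (red z) n = to_fract f"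
    unfolding ad_polys_def by blast
  have "\<exists>z'. specializes c X z z' \<and> z \<in> supported_on (paths G) \<and> z' \<in> I"
  proof -
    from z(1) consider (overlap) "z \<in> overlap_relations G ord (?h ` T)" | (path) p where "p \<in> paths G" "path_length p = k" "z = of_path p"
      unfolding H_inputs_def H_family_eq by blast
    then show ?thesis
    proof cases
      case overlap
      then obtain t u p q where a: "t \<in> T" "u \<in> T" "p \<in> paths G" "q \<in> paths G" "composable G t p" "composable G q u"
        "path_append t p = path_append q u" and z: "z = path_mult G (?h t) (of_path p) - path_mult G (of_path q) (?h u)"
        unfolding H.overlap_relations_eq by blast
      have "specializes c X z (path_mult G (g c t) (of_path p) - path_mult G (of_path q) (g c u))"
        unfolding z using a(1,2) c by (intro specializes_diff specializes_left specializes_right specializes_h)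
      moreover have "z \<in> supported_on (paths G)"
        using H.overlap_supported[OF a] unfolding z supported_on_def below_def by blast
      moreover have "path_mult G (g c t) (of_path p) - path_mult G (of_path q) (g c u) \<in> I"
        using a I(3) mult of_path_supported by (intro pv.subspace_diff[OF sub]) blast+
      ultimately show ?thesis by blast
    next
      case path
      then show ?thesis using k specializes_of_path of_path_supported by blast
    qed
  qed
  then obtain z' where z': "specializes c X z z'" "z \<in> supported_on (paths G)" "z' \<in> I" by blast
  have "complete_reduction G ord (?h ` T) z (red z)"
    using red z(1) unfolding reduction_choice_def H_family_eq by blast
  from specialize_reduction[OF c subset_refl _ this z'(1,2)] obtain y' where y': "specializes c X (red z) y'"
      "red z \<in> supported_on N" "z' - y' \<in> S.rewrite_span (paths G)" by (auto simp: below_def)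
  have "genideal (path_algebra G) (g c ` T) \<subseteq> I"
    by (rule ring.genideal_minimal[OF ring_path_algebra I(1,3)])
  then have "z' - y' \<in> I" using y'(3) unfolding S.genideal_eq_rewrite_span by blast
  from pv.subspace_diff[OF sub z'(3) this] have "y' \<in> I" by simp
  moreover have "Poly_Mapping.keys y' \<subseteq> N"
  proof
    fix p assume "p \<in> Poly_Mapping.keys y'"
    then have "Poly_Mapping.lookup (red z) p \<noteq> 0"
      using specializes_zero_coeff[OF y'(1), of p] by (auto simp: in_keys_iff)
    then show "p \<in> N" using y'(2) by (auto simp: supported_on_def in_keys_iff)
  qed
  moreover have "nontips I = N" unfolding nontips_def I(2) by (auto simp: above_def normal_paths_def)
  ultimately have "y' = 0" using ideal_nontips_trivial[OF I(1), of y'] by (simp add: supported_on_def)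
  moreover obtain f' where "Poly_Mapping.lookup (red z) n = to_fract f'" "Poly_Mapping.lookup y' n = mpoly_eval c f'"
    using specializesD[OF y'(1), of n] by blast
  ultimately show ?thesis using z(3) by simp
qed

lemma V_ad_iff:
  "c \<in> V_ad G ord T k red \<longleftrightarrow> c \<in> affine_space (coords G ord T) \<and>
    (\<forall>i\<in>coords G ord T - X. c i = 0) \<and> (\<forall>f\<in>ad_polys G ord T k red. mpoly_eval c f = 0)"
proof -
  have "mpoly_eval (restrict c X) f = mpoly_eval c f" if "f \<in> ad_polys G ord T k red" for f
    using that by (intro mpoly_eval_cong[of _ X]) (auto simp: ad_polys_def)
  then show ?thesis by (auto simp: V_ad_def zero_set_def affine_space_def)
qed

text \<open>
  The coordinates that carry no variable are set to zero by adding these variables to the equations.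
\<close>

lemma affine_variety_V_ad: "affine_variety (coords G ord T) (V_ad G ord T k red)"
  unfolding affine_variety_def
proof (intro conjI exI[of _ "ad_polys G ord T k red \<union> mpoly_var ` (coords G ord T - X)"])
  show "ad_polys G ord T k red \<union> mpoly_var ` (coords G ord T - X) \<subseteq> polys_in (coords G ord T)"
    using polys_in_mono[OF ad_coords_subset] by (auto simp: ad_polys_def polys_in_closed)
  show "V_ad G ord T k red = zero_set (coords G ord T) (ad_polys G ord T k red \<union> mpoly_var ` (coords G ord T - X))"
    by (intro subset_antisym subsetI) (auto simp: V_ad_iff zero_set_def ball_Un)
qed (rule finite_coords)

lemma long_supported_subset_iff:
  fixes I :: "('a, 'b, 'k::field) path_elem set"
  assumes I: "ideal I (path_algebra G)"
  shows "supported_on {p \<in> paths G. k \<le> path_length p} \<subseteq> I \<longleftrightarrow>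
    (\<forall>p\<in>paths G. path_length p = k \<longrightarrow> of_path p \<in> I)"
proof
  assume *: "\<forall>p\<in>paths G. path_length p = k \<longrightarrow> of_path p \<in> I"
  have "of_path p \<in> I" if p: "p \<in> paths G" "k \<le> path_length p" for p
  proof -
    have "path_length p = k + (path_length p - k)" using p(2) by simp
    from path_split[OF p(1) this] obtain a b where ab: "a \<in> paths G" "b \<in> paths G" "composable G a b"
      "p = path_append a b" "path_length a = k" by blast
    then have "path_mult G (of_path a) (of_path b) \<in> I"
      using I * of_path_supported unfolding ideal_iff by blast
    with ab show ?thesis by (simp add: path_mult_of_path)
  qed
  then show "supported_on {p \<in> paths G. k \<le> path_length p} \<subseteq> I"
    unfolding supported_on_eq_span by (intro pv.span_minimal) (use I in \<open>auto simp: ideal_iff\<close>)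
qed (auto simp: of_path_supported subset_iff)

lemma G_ideal_eq: "G_ideal G ord T c = genideal (path_algebra G) (g c ` T)"
  by (simp add: G_ideal_def G_family_eq)

lemma V_ad_G_ideal:
  fixes c :: "('a, 'b) path \<times> ('a, 'b) path \<Rightarrow> 'k::field"
  assumes red: "reduction_choice G ord T k red" and c: "c \<in> V_ad G ord T k red"
  shows "ideal (G_ideal G ord T c) (path_algebra G)"
    and "reduced_groebner_basis G ord (G_ideal G ord T c) = g c ` T"
    and "min_tips G ord (G_ideal G ord T c) = T"
    and "supported_on {p \<in> paths G. k \<le> path_length p} \<subseteq> G_ideal G ord T c"
    and "G_ideal G ord T c \<subseteq> supported_on {p \<in> paths G. 2 \<le> path_length p}"
proof -
  interpret S: reduction_system G ord T "g c" by (rule reduction_system_g)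
  from c have low: "\<forall>i\<in>coords G ord T - X. c i = 0" and van: "\<forall>f\<in>ad_polys G ord T k red. mpoly_eval c f = 0"
    by (simp_all add: V_ad_iff)
  note res = vanishing_imp_resolvable[OF low red van]
  have "g c ` T \<subseteq> carrier (path_algebra G)" using S.g_paths by auto
  then show I: "ideal (G_ideal G ord T c) (path_algebra G)"
    unfolding G_ideal_eq by (rule ring.genideal_ideal[OF ring_path_algebra])
  have N: "of_path t - g c t \<in> supported_on N" if "t \<in> T" for t
    using g_tail[OF that, of c] unfolding normal_below_iff[OF that] supported_on_def by blast
  show "reduced_groebner_basis G ord (G_ideal G ord T c) = g c ` T" "min_tips G ord (G_ideal G ord T c) = T"
    unfolding G_ideal_eq by (intro S.reduced_groebner_basis_genideal res N; assumption)+
  show "supported_on {p \<in> paths G. k \<le> path_length p} \<subseteq> G_ideal G ord T c"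
    unfolding long_supported_subset_iff[OF I] using res(2) by (simp add: G_ideal_eq)
  have g2: "g c t \<in> supported_on {p \<in> paths G. 2 \<le> path_length p}" if t: "t \<in> T" for t
    unfolding supported_on_def
  proof (intro CollectI subsetI conjI)
    fix p assume p: "p \<in> Poly_Mapping.keys (g c t)"
    then show "p \<in> paths G" using S.g_paths[OF t] unfolding supported_on_def by blast
    show "2 \<le> path_length p"
    proof (rule ccontr)
      assume short: "\<not> 2 \<le> path_length p"
      then have "p \<noteq> t" using T_length[OF t] by auto
      moreover have "c (t, p) = 0" if "p \<in> normal_below G ord T t"
        using low t that short by (simp add: ad_coords_def coords_def)
      ultimately show False using p by (auto simp: in_keys_iff lookup_g split: if_splits)
    qed
  qed
  have sub: "x \<in> supported_on {p \<in> paths G. 2 \<le> path_length p}" if "x \<in> S.rewriters (paths G)" for x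
  proof -
    from that obtain r t s w where *: "t \<in> T" "path_factor G w r t s" "x = sandwich G r (g c t) s"
      unfolding S.rewriters_def by blast
    show ?thesis
      unfolding supported_on_def
    proof (intro CollectI subsetI conjI)
      fix p assume "p \<in> Poly_Mapping.keys x"
      then obtain q where q: "q \<in> Poly_Mapping.keys (g c t)" "composable G r q" "composable G q s"
        "p = path_append (path_append r q) s" unfolding *(3) using keys_sandwich by blast
      have q2: "q \<in> paths G" "2 \<le> path_length q" using g2[OF *(1)] q(1) by (auto simp: supported_on_def)
      show "p \<in> paths G" unfolding q(4)
        using *(2) q q2 by (auto simp: path_factor_def append_in_paths composable_append_left)
      show "2 \<le> path_length p" using q2 by (simp add: q(4) path_length_append)
    qed
  qed
  show "G_ideal G ord T c \<subseteq> supported_on {p \<in> paths G. 2 \<le> path_length p}"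
    unfolding G_ideal_eq S.genideal_eq_rewrite_span using sub by (intro pv.span_minimal subspace_supported_on subsetI)
qed

text \<open>
  Equal ideals have equal reduced Groebner bases; the tip tells which basis element belongs to \<open>t\<close>, and its
  coefficients are the coordinates.
\<close>

lemma G_ideal_inj:
  fixes c d :: "('a, 'b) path \<times> ('a, 'b) path \<Rightarrow> 'k::field"
  assumes red: "reduction_choice G ord T k red" and cd: "c \<in> V_ad G ord T k red" "d \<in> V_ad G ord T k red"
    and eq: "G_ideal G ord T c = G_ideal G ord T d"
  shows "c = d"
proof -
  interpret C: reduction_system G ord T "g c" by (rule reduction_system_g)
  interpret D: reduction_system G ord T "g d" by (rule reduction_system_g)
  have gT: "g c ` T = g d ` T"
    using V_ad_G_ideal(2)[OF red cd(1)] V_ad_G_ideal(2)[OF red cd(2)] eq by simp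
  have g: "g c t = g d t" if t: "t \<in> T" for t
  proof -
    obtain u where u: "u \<in> T" "g c t = g d u" using gT t by blast
    then have "t = u" using C.g_tip[OF t] D.g_tip[OF u(1)] by simp
    with u show ?thesis by simp
  qed
  have "c (t, n) = d (t, n)" if "t \<in> T" "n \<in> normal_below G ord T t" for t n
    using arg_cong[OF g[OF that(1)], of "\<lambda>x. Poly_Mapping.lookup x n"] that(2) by (simp add: lookup_g)
  moreover have "c \<in> affine_space (coords G ord T)" "d \<in> affine_space (coords G ord T)"
    using cd by (simp_all add: V_ad_iff)
  ultimately show ?thesis
    unfolding affine_space_def coords_def by (intro PiE_ext) auto
qed

text \<open>
  The minimal tips generate the set of all tips as a monomial ideal.
\<close>

lemma nontips_eq_normal:
  fixes I :: "('a, 'b, 'k::field) path_elem set"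
  assumes "ideal I (path_algebra G)" "min_tips G ord I = T"
  shows "tips ord I = above T" "nontips I = N"
proof -
  show "tips ord I = above T" using min_tips_eq(2)[OF assms(1)] assms(2) by simp
  then show "nontips I = N" unfolding nontips_def by (auto simp: above_def normal_paths_def)
qed

text \<open>
  The point is read off from the reduced Groebner basis of \<open>I\<close>; its coordinates at paths of length
  at most one vanish because \<open>I\<close> contains only combinations of paths of length at least two.  The basis
  generates \<open>I\<close>, since reducing an element of \<open>I\<close> by it leaves a normal element of \<open>I\<close>, which is zero.
\<close>

lemma G_ideal_surj:
  fixes I :: "('a, 'b, 'k::field) path_elem set"
  assumes red: "reduction_choice G ord T k red"
    and I: "ideal I (path_algebra G)" "min_tips G ord I = T"
    and long: "supported_on {p \<in> paths G. k \<le> path_length p} \<subseteq> I"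
    and short: "I \<subseteq> supported_on {p \<in> paths G. 2 \<le> path_length p}"
  shows "\<exists>c\<in>V_ad G ord T k red. G_ideal G ord T c = I"
proof -
  let ?b = "gb_element G ord I"
  define c where "c = (\<lambda>i\<in>coords G ord T. - Poly_Mapping.lookup (?b (fst i)) (snd i))"
  interpret S: reduction_system G ord T "g c" by (rule reduction_system_g)
  note NI = nontips_eq_normal[OF I]
  have b: "?b t \<in> I" "of_path t - ?b t \<in> supported_on (normal_below G ord T t)" if t: "t \<in> T" for t
  proof -
    have "t \<in> tips ord I" using subset_above[OF T_paths] NI t by blast
    from gb_element_props[OF I(1) this]
    show "?b t \<in> I" "of_path t - ?b t \<in> supported_on (normal_below G ord T t)"
      by (simp_all add: NI normal_below_iff[OF t])
  qed
  have gb: "g c t = ?b t" if t: "t \<in> T" for t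
  proof (rule poly_mapping_eqI)
    fix n
    have "t \<notin> normal_below G ord T t" by (simp add: normal_below_def path_gt_def)
    moreover have "Poly_Mapping.lookup (of_path t - ?b t) n = 0" if "n \<notin> normal_below G ord T t"
      using b(2)[OF t] that by (auto simp: supported_on_def in_keys_iff)
    ultimately show "Poly_Mapping.lookup (g c t) n = Poly_Mapping.lookup (?b t) n"
      using t by (auto simp: lookup_g c_def coords_def lookup_minus of_path_def lookup_single when_def split: if_splits)
  qed
  have gT: "g c ` T \<subseteq> I" using gb b(1) by auto
  have low: "\<forall>i\<in>coords G ord T - X. c i = 0"
  proof
    fix i assume i: "i \<in> coords G ord T - X"
    then obtain t n where tn: "i = (t, n)" "t \<in> T" "\<not> 2 \<le> path_length n"
      by (auto simp: coords_def ad_coords_def)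
    have "n \<notin> Poly_Mapping.keys (?b t)" using b(1)[OF tn(2)] short tn(3) unfolding supported_on_def by blast
    then show "c i = 0" using i tn(1) by (simp add: c_def in_keys_iff)
  qed
  have "mpoly_eval c f = 0" if "f \<in> ad_polys G ord T k red" for f
    using long long_supported_subset_iff[OF I(1)] by (intro ideal_imp_vanishing[OF low red I(1) NI(1) gT _ that]) blast
  moreover have "c \<in> affine_space (coords G ord T)" by (simp add: affine_space_def c_def)
  ultimately have "c \<in> V_ad G ord T k red" using low by (simp add: V_ad_iff)
  moreover have "G_ideal G ord T c = I"
  proof
    show GI: "G_ideal G ord T c \<subseteq> I"
      unfolding G_ideal_eq by (rule ring.genideal_minimal[OF ring_path_algebra I(1) gT])
    show "I \<subseteq> G_ideal G ord T c"
    proof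
      fix x assume x: "x \<in> I"
      have sub: "pv.subspace (S.rewrite_span (paths G))" by (rule pv.subspace_span)
      have "\<exists>n\<in>supported_on N. of_path p - n \<in> S.rewrite_span (paths G)" if "p \<in> paths G" for p
        using normal_form_path[OF sub S.rewrite_span_reduces that] unfolding supported_on_def by blast
      moreover have "x \<in> supported_on (paths G)" using x I(1) by (auto simp: ideal_iff)
      ultimately obtain n where n: "n \<in> supported_on N" "x - n \<in> S.rewrite_span (paths G)"
        using normal_form_extend[OF sub] by blast
      then have xn: "x - n \<in> G_ideal G ord T c" unfolding G_ideal_eq S.genideal_eq_rewrite_span by blast
      have subI: "pv.subspace I" using I(1) by (simp add: ideal_iff)
      have "x - (x - n) \<in> I" by (rule pv.subspace_diff[OF subI x]) (use xn GI in blast)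
      then have "n = 0" using ideal_nontips_trivial[OF I(1), of n] n(1) NI(2) by simp
      with xn show "x \<in> G_ideal G ord T c" by simp
    qed
  qed
  ultimately show ?thesis by blast
qed

lemma finite_dim_quotient_tips:
  fixes I :: "('a, 'b, 'k::field) path_elem set"
  assumes I: "ideal I (path_algebra G)" "min_tips G ord I = T"
  shows "finite_dim (quotient_algebra (path_algebra G) I)"
proof (rule finite_dim_quotient[OF I(1) finite_normal normal_in_paths])
  fix p assume "p \<in> paths G"
  moreover have "pv.subspace I" using I(1) by (simp add: ideal_iff)
  ultimately show "\<exists>n\<in>supported_on N. of_path p - n \<in> I"
    using normal_form_path[OF _ ideal_reduces[OF I(1)]] unfolding nontips_eq_normal[OF I] supported_on_def by blast
qed

end

section \<open>The correspondence\<close>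

theorem proposition6p11:
  fixes Q :: "('v, 'e) pre_digraph"
    and ord :: "('v, 'e) path rel"
    and T :: "('v, 'e) path set"
    and m :: nat
    and red :: "('v, 'e, 'k::field) generic_elem \<Rightarrow> ('v, 'e, 'k) generic_elem"
  defines "KQ \<equiv> (path_algebra Q :: ('k, ('v, 'e, 'k) path_elem) module)"
    and "J \<equiv> (arrow_ideal Q :: ('v, 'e, 'k) path_elem set)"
  assumes "fin_digraph Q"
    and "admissible_order Q ord"
    and "2 \<le> m"
    and "T \<subseteq> paths Q"
    and "tip_reduced Q ord (of_path ` T :: ('v, 'e, 'k) path_elem set)"
    and "\<forall>t\<in>T. 2 \<le> path_length t"
    and "ideal_power KQ J m \<subseteq> path_ideal Q T"
    and "reduction_choice Q ord T m red"
  shows "subvariety (coords Q ord T) (V_ad Q ord T m red) (V_variety Q ord T)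
    \<and> affine_variety (coords Q ord T) (V_ad Q ord T m red)
    \<and> bij_betw (\<lambda>c. quotient_algebra KQ (G_ideal Q ord T c)) (V_ad Q ord T m red)
        {quotient_algebra KQ I |I.
           finite_dim (quotient_algebra KQ I) \<and>
           admissible_ideal Q I \<and> ideal_power KQ J m \<subseteq> I \<and> I \<subseteq> ideal_power KQ J 2 \<and>
           tips ord (reduced_groebner_basis Q ord I) = T}"
proof -
  interpret ordered_quiver Q ord
    using assms(3,4) by (simp add: ordered_quiver_def ordered_quiver_axioms_def)
  have J: "ideal_power KQ J k = supported_on {p \<in> paths Q. k \<le> path_length p}" for k
    unfolding KQ_def J_def by (rule arrow_ideal_power_eq)
  have tip: "tip ord (of_path t :: ('v, 'e, 'k) path_elem) = t" if "t \<in> T" for t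
    using that assms(6) by (intro tip_eqI) auto
  interpret truncated_tips Q ord T m
  proof
    fix t u assume tu: "t \<in> T" "u \<in> T" "subpath Q t u"
    show "t = u"
    proof (rule ccontr)
      assume "t \<noteq> u"
      then have "Poly_Mapping.keys (of_path t :: ('v, 'e, 'k) path_elem) \<noteq> Poly_Mapping.keys (of_path u :: ('v, 'e, 'k) path_elem)"
        by simp
      then have "(of_path t :: ('v, 'e, 'k) path_elem) \<noteq> of_path u" by metis
      moreover have "(of_path t :: ('v, 'e, 'k) path_elem) \<noteq> 0" "(of_path u :: ('v, 'e, 'k) path_elem) \<noteq> 0"
        by (simp_all flip: keys_eq_empty)
      ultimately have "\<not> subpath Q (tip ord (of_path t :: ('v, 'e, 'k) path_elem)) (tip ord (of_path u :: ('v, 'e, 'k) path_elem))"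
        using assms(7) tu(1,2) unfolding tip_reduced_def by blast
      with tu tip show False by simp
    qed
  next
    fix p assume "p \<in> paths Q" "m \<le> path_length p"
    then have "of_path p \<in> ideal_power KQ J m" unfolding J by (simp add: of_path_supported)
    with assms(9) have "of_path p \<in> (supported_on (above T) :: ('v, 'e, 'k) path_elem set)"
      unfolding path_ideal_eq[OF assms(6)] by blast
    then show "p \<in> above T" by (simp add: supported_on_def)
  qed (use assms(6,8) in auto)
  note red = assms(10)
  let ?V = "V_ad Q ord T m red"
  have good: "ideal I KQ \<and> min_tips Q ord I = T \<and> ideal_power KQ J m \<subseteq> I \<and> I \<subseteq> ideal_power KQ J 2 \<longleftrightarrow>
      finite_dim (quotient_algebra KQ I) \<and> admissible_ideal Q I \<and> ideal_power KQ J m \<subseteq> I \<and>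
      I \<subseteq> ideal_power KQ J 2 \<and> tips ord (reduced_groebner_basis Q ord I) = T" for I
    using assms(5) finite_dim_quotient_tips[of I] tips_reduced_groebner_basis[of I]
    unfolding admissible_ideal_def KQ_def J_def by blast
  have V: "ideal (G_ideal Q ord T c) KQ \<and> min_tips Q ord (G_ideal Q ord T c) = T \<and>
      ideal_power KQ J m \<subseteq> G_ideal Q ord T c \<and> G_ideal Q ord T c \<subseteq> ideal_power KQ J 2" if "c \<in> ?V" for c
    using V_ad_G_ideal[OF red that] unfolding J unfolding KQ_def by blast
  have "?V \<subseteq> V_variety Q ord T"
    using V_ad_G_ideal(2)[OF red] by (auto simp: V_variety_def G_family_eq V_ad_iff)
  moreover have "bij_betw (\<lambda>c. quotient_algebra KQ (G_ideal Q ord T c)) ?V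
        {quotient_algebra KQ I |I.
           finite_dim (quotient_algebra KQ I) \<and>
           admissible_ideal Q I \<and> ideal_power KQ J m \<subseteq> I \<and> I \<subseteq> ideal_power KQ J 2 \<and>
           tips ord (reduced_groebner_basis Q ord I) = T}"
    unfolding good[symmetric]
  proof (rule bij_betw_imageI)
    show "inj_on (\<lambda>c. quotient_algebra KQ (G_ideal Q ord T c)) ?V"
    proof (rule inj_onI)
      fix c d assume cd: "c \<in> ?V" "d \<in> ?V"
        and eq: "quotient_algebra KQ (G_ideal Q ord T c) = quotient_algebra KQ (G_ideal Q ord T d)"
      have "G_ideal Q ord T c = G_ideal Q ord T d"
        \<comment> \<open>The zero element of a quotient is the ideal itself.\<close>
        using arg_cong[OF eq, of zero] by (simp only: quotient_algebra_simps)
      with G_ideal_inj[OF red cd] show "c = d" by blast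
    qed
    show "(\<lambda>c. quotient_algebra KQ (G_ideal Q ord T c)) ` ?V =
      {quotient_algebra KQ I |I. ideal I KQ \<and> min_tips Q ord I = T \<and> ideal_power KQ J m \<subseteq> I \<and> I \<subseteq> ideal_power KQ J 2}"
    proof (intro subset_antisym subsetI)
      fix A assume "A \<in> (\<lambda>c. quotient_algebra KQ (G_ideal Q ord T c)) ` ?V"
      then show "A \<in> {quotient_algebra KQ I |I. ideal I KQ \<and> min_tips Q ord I = T \<and> ideal_power KQ J m \<subseteq> I \<and> I \<subseteq> ideal_power KQ J 2}"
        using V by blast
    next
      fix A assume "A \<in> {quotient_algebra KQ I |I. ideal I KQ \<and> min_tips Q ord I = T \<and> ideal_power KQ J m \<subseteq> I \<and> I \<subseteq> ideal_power KQ J 2}"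
      then obtain I where I: "A = quotient_algebra KQ I" "ideal I KQ" "min_tips Q ord I = T"
        "ideal_power KQ J m \<subseteq> I" "I \<subseteq> ideal_power KQ J 2" by blast
      from G_ideal_surj[OF red I(2)[unfolded KQ_def] I(3) I(4)[unfolded J] I(5)[unfolded J]]
      obtain c where "c \<in> ?V" "G_ideal Q ord T c = I" by blast
      then show "A \<in> (\<lambda>c. quotient_algebra KQ (G_ideal Q ord T c)) ` ?V" unfolding I(1) by blast
    qed
  qed
  ultimately show ?thesis using affine_variety_V_ad by (simp add: subvariety_def)
qed

end
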